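(* Consider the three-dimensional leap-frog discontinuous Galerkin scheme described in the context, with one of the three types of discrete boundary conditions (PEC, PMC or Silver-Müller) imposed on $\partial\Omega$, with flux parameter $\alpha\in[0,1]$, polynomial degree $N$ and time step $\Delta t>0$. Set $\beta_1=\alpha$, $\beta_2=0$, $\beta_3=0$ for PEC; $\beta_1=0$, $\beta_2=1$, $\beta_3=\alpha$ for PMC; $\beta_1=\beta_2=\tfrac12$, $\beta_3=1$ for Silver-Müller. Let $$C_E=\tfrac12 C_{inv}N^2+C_\tau^2(N+1)(N+3)\left(3+\frac{\beta_2}{2}+\frac{\alpha+\beta_1}{2\min\{Z_k\}}\right),$$ $$C_H=\tfrac12 C_{inv}N^2+C_\tau^2(N+1)(N+3)\left(3+\frac{\beta_2}{2}+\frac{\alpha+\beta_3}{2\min\{Y_k\}}\right),$$ with the constants $C_\tau$, $C_{inv}$ defined in the context. If $$\Delta t<\frac{\min\{\underline\epsilon,\underline\mu\}}{\max\{C_E,C_H\}}\,\min_k\{h_k\},$$ then the method is stable, i.e. there is a constant $C>0$, independent of the number of time steps $M\ge1$ and of the initial data $(\tilde E^0,\tilde H^{1/2})\in V_N$, such that $$\|\tilde E^M\|_{L^2(\Omega)}^2+\|\tilde H^{M+1/2}\|_{L^2(\Omega)}^2\le C\left(\|\tilde E^0\|_{L^2(\Omega)}^2+\|\tilde H^{1/2}\|_{L^2(\Omega)}^2\right).$$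
   Context: Domain and coefficients: $\Omega\subset\mathbb R^3$ is a bounded polyhedral domain; $\epsilon(x,y,z)$ and $\mu(x,y,z)$ are symmetric $3\times3$ matrices; there are constants $\underline\epsilon,\overline\epsilon,\underline\mu,\overline\mu>0$ with $\underline\epsilon|\xi|^2\le\xi^T\epsilon\xi\le\overline\epsilon|\xi|^2$ and $\underline\mu|\xi|^2\le\xi^T\mu\xi\le\overline\mu|\xi|^2$ for all $\xi\in\mathbb R^3$ and almost every point of $\Omega$ (the coefficients are assumed to have traces on element faces wherever these are used). Mesh: $\mathcal T_h=\{T_1,\dots,T_K\}$ is a conforming partition of $\overline\Omega$ into tetrahedra with disjoint interiors; $h_k$ is the diameter of $T_k$; with $\tau_k$ the maximum diameter of a ball inscribed in $T_k$, there is $\tau>0$ with $h_k/\tau_k\le\tau$ for all $k$. $P_N(T_k)$ is the space of polynomials of degree at most $N$ on $T_k$ and $V_N=\{v\in L^2(\Omega)^6: v|_{T_k}\in P_N(T_k)^6\ \forall k\}$. Flux notation: on $\partial T_k$, $n$ is the unit outward normal, superscript $-$ denotes values from $T_k$ and $+$ values from the neighboring element; $[v]=v^--v^+$; $\epsilon_{eff}=\det(\epsilon)/(n^T\epsilon n)$, $\mu_{eff}=\det(\mu)/(n^T\mu n)$, $c=1/\sqrt{\mu_{eff}\epsilon_{eff}}$, $Z^\pm=\mu_{eff}^\pm c^\pm$, $Y^\pm=1/Z^\pm$; on faces contained in $\partial\Omega$, $Z^+=Z^-$ (and $Y^+=Y^-$). $Z_k$, $Y_k$ denote the values of $Z$,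 $Y$ computed from $T_k$ on its faces, and $\min\{Z_k\}$, $\min\{Y_k\}$ are the minima (infima) over all elements and all their faces. Scheme: let $t^m=m\Delta t$, $T=M\Delta t$. Given $(\tilde E^0,\tilde H^{1/2})\in V_N$ (each of $\tilde E,\tilde H$ has three components), for $m=0,\dots,M-1$ find $(\tilde E^{m+1},\tilde H^{m+3/2})\in V_N$ such that for every $k$ and all $u_k,w_k\in P_N(T_k)^3$ (subscript $k$ denotes restriction to $T_k$; $(\cdot,\cdot)_{T_k}$, $(\cdot,\cdot)_{\partial T_k}$ are the $L^2$ inner products): $$\left(\epsilon\,\tfrac{\tilde E_k^{m+1}-\tilde E_k^m}{\Delta t},u_k\right)_{T_k}=(\nabla\times\tilde H_k^{m+1/2},u_k)_{T_k}-\left(\tfrac{1}{Z^++Z^-}\,n\times\big(Z^+[\tilde H^{m+1/2}]-\alpha\,n\times[\tilde E^m]\big),u_k\right)_{\partial T_k},$$ $$\left(\mu\,\tfrac{\tilde H_k^{m+3/2}-\tilde H_k^{m+1/2}}{\Delta t},w_k\right)_{T_k}=-(\nabla\times\tilde E_k^{m+1},w_k)_{T_k}+\left(\tfrac{1}{Y^++Y^-}\,n\times\big(Y^+[\tilde E^{m+1}]+\alpha\,n\times[\tilde H^{m+1/2}]\big),w_k\right)_{\partial T_k}.$$ Discrete boundary conditions, on all faces contained in $\partial\Omega$: PEC: $[\tilde E]=2\tilde E^-$, $[\tilde H]=0$. PMC: $[\tilde E]=0$, $[\tilde H]=2\tilde H^-$. Silver-Müller: $[\tilde E]=\tilde E^-$,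 $[\tilde H]=\tilde H^-$, and in the flux on the outer boundary faces $\alpha$ is replaced by $1$ (on interior faces $\alpha$ is unchanged). Constants: $C_\tau>0$ is a constant, independent of $h_k$ and $N$ (depending on the shape-regularity), such that for all $T_k\in\mathcal T_h$ and $u\in P_N(T_k)$, $\|u\|_{L^2(\partial T_k)}\le C_\tau\sqrt{(N+1)(N+3)}\,h_k^{-1/2}\|u\|_{L^2(T_k)}$. $C_{inv}>0$ is a constant, independent of $h_k$ and $N$, such that $\|u\|_{H^1(T_k)}\le C_{inv}N^2h_k^{-1}\|u\|_{L^2(T_k)}$ for all $T_k\in\mathcal T_h$ and $u\in P_N(T_k)$. *)

theory Defs
  imports "HOL-Analysis.Analysis"
begin

section \<open>Domain, mesh and faces\<close>

text \<open>The boundary is a finite union of convex polygons. It need not be Lipschitz. Boundedness is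
  stated separately.\<close>

definition polyhedral_domain :: "(real^3) set \<Rightarrow> bool" where
  "polyhedral_domain \<Omega> \<longleftrightarrow>
     open \<Omega> \<and> connected \<Omega> \<and> \<Omega> \<noteq> {} \<and>
     (\<exists>\<P>. finite \<P> \<and> (\<forall>P\<in>\<P>. polytope P \<and> aff_dim P = 2) \<and> frontier \<Omega> = \<Union>\<P>)"

text \<open>\<^const>\<open>triangulation\<close> is finiteness together with conformity: two elements meet in a common
  face (possibly empty). In particular distinct elements have disjoint interiors.\<close>

definition tetrahedral_mesh :: "(real^3) set \<Rightarrow> (real^3) set set \<Rightarrow> bool" where
  "tetrahedral_mesh \<Omega> \<T> \<longleftrightarrow>
     triangulation \<T> \<and> (\<forall>T\<in>\<T>. 3 simplex T) \<and> \<Union>\<T> = closure \<Omega>"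

definition inball_diameter :: "(real^3) set \<Rightarrow> real" where
  "inball_diameter T = Sup {2 * r | r. 0 \<le> r \<and> (\<exists>x. cball x r \<subseteq> T)}"

definition facets :: "(real^3) set \<Rightarrow> (real^3) set set" where
  "facets T = {F. F facet_of T}"

definition outward_normal :: "(real^3) set \<Rightarrow> (real^3) set \<Rightarrow> real^3" where
  "outward_normal T F = (THE n. norm n = 1 \<and> (\<forall>x\<in>F. \<forall>y\<in>T. n \<bullet> (y - x) \<le> 0))"

text \<open>The element on the other side of the facet \<open>F\<close> of \<open>T\<close>; used only for facets not contained
  in the boundary of the domain, where it exists and is unique.\<close>

definition neighbour :: "(real^3) set set \<Rightarrow> (real^3) set \<Rightarrow> (real^3) set \<Rightarrow> (real^3) set" where
  "neighbour \<T> T F = (THE T'. T' \<in> \<T> \<and> T' \<noteq> T \<and> F \<in> facets T')"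

text \<open>Surface (area) measure on a triangle, as a Borel measure on space: the image of Lebesgue
  measure on the reference triangle under the affine parametrization, times the area element. It
  does not depend on the order in which the vertices are chosen.\<close>

definition surface_measure :: "(real^3) set \<Rightarrow> (real^3) measure" where
  "surface_measure F =
     (let (a, b, c) = (SOME (a, b, c). F = convex hull {a, b, c})
      in scale_measure (ennreal (norm (cross3 (b - a) (c - a))))
           (distr (restrict_space lborel {(s, t). 0 \<le> s \<and> 0 \<le> t \<and> s + t \<le> (1::real)}) borel
             (\<lambda>(s, t). a + s *\<^sub>R (b - a) + t *\<^sub>R (c - a))))"

section \<open>Norms, derivatives and polynomial spaces\<close>

definition L2_norm :: "(real^3) set \<Rightarrow> (real^3 \<Rightarrow> 'b::euclidean_space) \<Rightarrow> real" where
  "L2_norm S f = sqrt (LINT x:S|lebesgue. (norm (f x))\<^sup>2)"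

definition L2_norm_bdry :: "(real^3) set \<Rightarrow> (real^3 \<Rightarrow> 'b::euclidean_space) \<Rightarrow> real" where
  "L2_norm_bdry T f = sqrt (\<Sum>F\<in>facets T. LINT x|surface_measure F. (norm (f x))\<^sup>2)"

definition partial :: "3 \<Rightarrow> (real^3 \<Rightarrow> 'b::real_normed_vector) \<Rightarrow> real^3 \<Rightarrow> 'b" where
  "partial i f x = frechet_derivative f (at x) (axis i 1)"

definition H1_norm :: "(real^3) set \<Rightarrow> (real^3 \<Rightarrow> real) \<Rightarrow> real" where
  "H1_norm S f = sqrt (LINT x:S|lebesgue. (f x)\<^sup>2 + (\<Sum>i\<in>UNIV. (partial i f x)\<^sup>2))"

definition curl :: "(real^3 \<Rightarrow> real^3) \<Rightarrow> real^3 \<Rightarrow> real^3" where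
  "curl v x = vector [partial 2 v x $ 3 - partial 3 v x $ 2,
                      partial 3 v x $ 1 - partial 1 v x $ 3,
                      partial 1 v x $ 2 - partial 2 v x $ 1]"

text \<open>Polynomials are taken as functions on the whole space. A tetrahedron has nonempty interior,
  so its polynomial space is the same as this one, by restriction.\<close>

definition poly_space :: "nat \<Rightarrow> (real^3 \<Rightarrow> real) set" where
  "poly_space N =
     range (\<lambda>a x. \<Sum>(i, j, k)\<in>{(i, j, k). i + j + k \<le> N}. a (i, j, k) * x$1 ^ i * x$2 ^ j * x$3 ^ k)"

definition poly_space3 :: "nat \<Rightarrow> (real^3 \<Rightarrow> real^3) set" where
  "poly_space3 N = {v. \<forall>i. (\<lambda>x. v x $ i) \<in> poly_space N}"

text \<open>Three components of the broken polynomial space. Elements are square integrable functions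
  defined up to null sets; square integrability is automatic on a finite mesh of bounded elements.\<close>

definition dg_space :: "(real^3) set set \<Rightarrow> nat \<Rightarrow> (real^3 \<Rightarrow> real^3) set" where
  "dg_space \<T> N = {v. \<forall>T\<in>\<T>. \<exists>p\<in>poly_space3 N. AE x in lebesgue_on T. v x = p x}"

text \<open>The restriction to \<open>T\<close> as a polynomial, which also gives the values on the faces from
  inside \<open>T\<close>.\<close>

definition piece :: "nat \<Rightarrow> (real^3 \<Rightarrow> real^3) \<Rightarrow> (real^3) set \<Rightarrow> real^3 \<Rightarrow> real^3" where
  "piece N v T = (THE p. p \<in> poly_space3 N \<and> (AE x in lebesgue_on T. v x = p x))"

section \<open>Coefficients\<close>

definition coefficient ::
  "(real^3) set \<Rightarrow> (real^3 \<Rightarrow> real^3^3) \<Rightarrow> real \<Rightarrow> real \<Rightarrow> bool" where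
  "coefficient \<Omega> A lo hi \<longleftrightarrow>
     A \<in> borel_measurable (lebesgue_on \<Omega>) \<and>
     (AE x in lebesgue_on \<Omega>. transpose (A x) = A x \<and>
        (\<forall>\<xi>. lo * (norm \<xi>)\<^sup>2 \<le> \<xi> \<bullet> (A x *v \<xi>) \<and> \<xi> \<bullet> (A x *v \<xi>) \<le> hi * (norm \<xi>)\<^sup>2))"

text \<open>\<open>g\<close> is the trace of \<open>f\<close> on the boundary of \<open>T\<close>, taken from inside \<open>T\<close>: at almost every
  boundary point the mean oscillation of \<open>f\<close> around \<open>g x\<close> over small balls intersected with \<open>T\<close>
  tends to zero. This is the usual trace for functions continuous up to the boundary, Sobolev
  functions and functions of bounded variation, and does not depend on the representative of \<open>f\<close>.\<close>

definition is_trace ::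
  "(real^3) set \<Rightarrow> (real^3 \<Rightarrow> 'b::euclidean_space) \<Rightarrow> (real^3 \<Rightarrow> 'b) \<Rightarrow> bool" where
  "is_trace T f g \<longleftrightarrow>
     (\<forall>F\<in>facets T. g \<in> borel_measurable (surface_measure F) \<and>
        (AE x in surface_measure F.
           ((\<lambda>r. (LINT y:(T \<inter> ball x r)|lebesgue. norm (f y - g x))
                  / measure lebesgue (T \<inter> ball x r)) \<longlongrightarrow> 0) (at_right 0)))"

definition effective :: "real^3^3 \<Rightarrow> real^3 \<Rightarrow> real" where
  "effective A n = det A / (n \<bullet> (A *v n))"

text \<open>In the following, \<open>\<epsilon>t T\<close> and \<open>\<mu>t T\<close> are the traces of the coefficients from inside \<open>T\<close>;
  \<open>Zm\<close>, \<open>Zp\<close> stand for the impedance with superscript minus and plus, likewise \<open>Ym\<close>, \<open>Yp\<close>.\<close>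

definition Zm ::
  "((real^3) set \<Rightarrow> real^3 \<Rightarrow> real^3^3) \<Rightarrow> ((real^3) set \<Rightarrow> real^3 \<Rightarrow> real^3^3) \<Rightarrow>
   (real^3) set \<Rightarrow> (real^3) set \<Rightarrow> real^3 \<Rightarrow> real" where
  "Zm \<epsilon>t \<mu>t T F x =
     (let n = outward_normal T F;
          \<epsilon>eff = effective (\<epsilon>t T x) n;
          \<mu>eff = effective (\<mu>t T x) n;
          c = 1 / sqrt (\<mu>eff * \<epsilon>eff)
      in \<mu>eff * c)"

definition Ym where
  "Ym \<epsilon>t \<mu>t T F x = 1 / Zm \<epsilon>t \<mu>t T F x"

definition Zp where
  "Zp \<Omega> \<T> \<epsilon>t \<mu>t T F x =
     (if F \<subseteq> frontier \<Omega> then Zm \<epsilon>t \<mu>t T F x else Zm \<epsilon>t \<mu>t (neighbour \<T> T F) F x)"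

definition Yp where
  "Yp \<Omega> \<T> \<epsilon>t \<mu>t T F x = 1 / Zp \<Omega> \<T> \<epsilon>t \<mu>t T F x"

text \<open>Infimum over all faces of all elements. Traces being determined only almost everywhere, it is
  the essential infimum with respect to surface measure.\<close>

definition min_over_faces ::
  "(real^3) set set \<Rightarrow> ((real^3) set \<Rightarrow> (real^3) set \<Rightarrow> real^3 \<Rightarrow> real) \<Rightarrow> real" where
  "min_over_faces \<T> f =
     Sup {z. \<forall>T\<in>\<T>. \<forall>F\<in>facets T. AE x in surface_measure F. z \<le> f T F x}"

section \<open>The scheme\<close>

datatype boundary_condition = PEC | PMC | Silver_Mueller

text \<open>Jumps seen from \<open>T\<close> across its facet \<open>F\<close>, for a piecewise field given by its pieces.\<close>

definition jump_E where
  "jump_E bc \<Omega> \<T> (E :: (real^3) set \<Rightarrow> real^3 \<Rightarrow> real^3) T F x =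
     (if F \<subseteq> frontier \<Omega>
      then (case bc of PEC \<Rightarrow> 2 *\<^sub>R E T x | PMC \<Rightarrow> 0 | Silver_Mueller \<Rightarrow> E T x)
      else E T x - E (neighbour \<T> T F) x)"

definition jump_H where
  "jump_H bc \<Omega> \<T> (H :: (real^3) set \<Rightarrow> real^3 \<Rightarrow> real^3) T F x =
     (if F \<subseteq> frontier \<Omega>
      then (case bc of PEC \<Rightarrow> 0 | PMC \<Rightarrow> 2 *\<^sub>R H T x | Silver_Mueller \<Rightarrow> H T x)
      else H T x - H (neighbour \<T> T F) x)"

definition flux_param :: "boundary_condition \<Rightarrow> (real^3) set \<Rightarrow> real \<Rightarrow> (real^3) set \<Rightarrow> real" where
  "flux_param bc \<Omega> \<alpha> F = (if F \<subseteq> frontier \<Omega> \<and> bc = Silver_Mueller then 1 else \<alpha>)"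

definition flux_E where
  "flux_E bc \<Omega> \<T> \<epsilon>t \<mu>t \<alpha> E H T F x =
     (let n = outward_normal T F in
      (1 / (Zp \<Omega> \<T> \<epsilon>t \<mu>t T F x + Zm \<epsilon>t \<mu>t T F x)) *\<^sub>R
        cross3 n (Zp \<Omega> \<T> \<epsilon>t \<mu>t T F x *\<^sub>R jump_H bc \<Omega> \<T> H T F x
                  - flux_param bc \<Omega> \<alpha> F *\<^sub>R cross3 n (jump_E bc \<Omega> \<T> E T F x)))"

definition flux_H where
  "flux_H bc \<Omega> \<T> \<epsilon>t \<mu>t \<alpha> E H T F x =
     (let n = outward_normal T F in
      (1 / (Yp \<Omega> \<T> \<epsilon>t \<mu>t T F x + Ym \<epsilon>t \<mu>t T F x)) *\<^sub>R
        cross3 n (Yp \<Omega> \<T> \<epsilon>t \<mu>t T F x *\<^sub>R jump_E bc \<Omega> \<T> E T F x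
                  + flux_param bc \<Omega> \<alpha> F *\<^sub>R cross3 n (jump_H bc \<Omega> \<T> H T F x)))"

definition bdry_inner ::
  "(real^3) set \<Rightarrow> ((real^3) set \<Rightarrow> real^3 \<Rightarrow> real^3) \<Rightarrow> (real^3 \<Rightarrow> real^3) \<Rightarrow> real" where
  "bdry_inner T f u = (\<Sum>F\<in>facets T. LINT x|surface_measure F. f F x \<bullet> u x)"

definition vol_inner ::
  "(real^3) set \<Rightarrow> (real^3 \<Rightarrow> real^3) \<Rightarrow> (real^3 \<Rightarrow> real^3) \<Rightarrow> real" where
  "vol_inner T f u = (LINT x:T|lebesgue. f x \<bullet> u x)"

text \<open>One step, from \<open>E, H\<close> at times \<open>m, m + 1/2\<close> to \<open>E', H'\<close> at times \<open>m + 1, m + 3/2\<close>.\<close>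

definition leapfrog_step where
  "leapfrog_step bc \<Omega> \<T> \<epsilon> \<mu> \<epsilon>t \<mu>t \<alpha> N \<Delta>t E H E' H' \<longleftrightarrow>
     (\<forall>T\<in>\<T>. \<forall>u\<in>poly_space3 N.
        vol_inner T (\<lambda>x. \<epsilon> x *v ((piece N E' T x - piece N E T x) /\<^sub>R \<Delta>t)) u
        = vol_inner T (curl (piece N H T)) u
          - bdry_inner T (flux_E bc \<Omega> \<T> \<epsilon>t \<mu>t \<alpha> (piece N E) (piece N H) T) u) \<and>
     (\<forall>T\<in>\<T>. \<forall>w\<in>poly_space3 N.
        vol_inner T (\<lambda>x. \<mu> x *v ((piece N H' T x - piece N H T x) /\<^sub>R \<Delta>t)) w
        = - vol_inner T (curl (piece N E' T)) w
          + bdry_inner T (flux_H bc \<Omega> \<T> \<epsilon>t \<mu>t \<alpha> (piece N E') (piece N H) T) w)"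

end

theory Submission
  imports Defs
begin

text \<open>
The proof is by an energy argument. Write \<open>D(H, E)\<close> for the discrete curl: the curl of \<open>H\<close> on the elements
minus the part of the numerical flux with the jump of \<open>H\<close>, tested with \<open>E\<close> and summed over the mesh. The
averaging weights \<open>Z\<^sup>+ / (Z\<^sup>+ + Z\<^sup>-)\<close> and \<open>Y\<^sup>+ / (Y\<^sup>+ + Y\<^sup>-)\<close> of the two equations are complementary on
interior facets, and the boundary factors of the two jumps add up to \<open>2\<close>. Integration by parts therefore shows
that \<open>D\<close> is self-adjoint (\<open>dcurl_adjoint\<close>): the discrete curl of the second equation is \<open>D(H, E)\<close> again. The
remaining part of the flux, multiplied by \<open>\<alpha>\<close>, is a symmetric nonnegative form \<open>p\<close> in the tangential jumps.

Testing the two equations with \<open>E\<^sup>m\<^sup>+\<^sup>1 + E\<^sup>m\<close> and with the sum of the corresponding magnetic fields, the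
increments of \<open>(\<epsilon> E, E)\<close> and \<open>(\<mu> H, H)\<close> contain the values of \<open>D\<close> at consecutive half steps. They telescope, and
since \<open>p(a, a + b) \<ge> (p(a, a) - p(b, b)) / 2\<close> the energy
  \<open>(\<epsilon> E, E) + (\<mu> H, H) + \<Delta>t D(H, E) - \<Delta>t / 2 (p(E, E) + p(H, H))\<close>
does not increase (\<open>energy_decreasing\<close>). It remains to see that it is equivalent to the squared norm
(\<open>energy_bounds\<close>). The jumps are controlled by the trace inequality and the curl by the inverse inequality. The
time step condition has no room for the factor \<open>\<surd>2\<close> by which the curl can exceed the gradient pointwise, but the
squared norm of the curl exceeds that of the gradient by at most a boundary term, to which the trace
inequality applies (\<open>curl_norm_bound\<close>).

Several facts about the data are needed for this. The divergence theorem on a tetrahedron follows by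
integrating a derivative in the direction of an edge first, since the edges at a vertex span the space
(\<open>divergence_tetrahedron\<close>). Its surface integrals do not depend on the enumeration of the vertices, so the
integrals from the two sides of a facet agree. A facet that is not contained in the frontier of the domain has
exactly one neighbouring element, with the opposite normal (\<open>neighbour\<close>). The traces of the coefficients
inherit the bounds of the coefficients, because the symmetric matrices with these bounds form a closed
set (\<open>trace_spd\<close>). Hence the impedances are bounded from above and below, and their minimum over the faces is a
positive lower bound (\<open>min_over_faces_bound\<close>).
\<close>

section \<open>Polynomials\<close>

definition monomial :: "nat \<times> nat \<times> nat \<Rightarrow> real^3 \<Rightarrow> real" where
  "monomial = (\<lambda>(i, j, k) x. x$1 ^ i * x$2 ^ j * x$3 ^ k)"

abbreviation exponents :: "nat \<Rightarrow> (nat \<times> nat \<times> nat) set" where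
  "exponents N \<equiv> {(i, j, k). i + j + k \<le> N}"

lemma finite_exponents [simp]: "finite (exponents N)"
proof (rule finite_subset)
  show "exponents N \<subseteq> {..N} \<times> {..N} \<times> {..N}" by auto
qed auto

lemma poly_space_iff:
  "p \<in> poly_space N \<longleftrightarrow> (\<exists>a. p = (\<lambda>x. \<Sum>e\<in>exponents N. a e * monomial e x))"
  unfolding poly_space_def monomial_def
  by (auto simp: image_iff case_prod_unfold mult.assoc)

lemma poly_space_monomial:
  assumes "e \<in> exponents N" shows "monomial e \<in> poly_space N"
  unfolding poly_space_iff
proof (intro exI ext)
  fix x
  have "(\<Sum>e'\<in>exponents N. (if e' = e then 1 else 0) * monomial e' x)
      = (\<Sum>e'\<in>exponents N. if e' = e then monomial e' x else 0)"
    by (intro sum.cong) auto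
  also have "\<dots> = monomial e x"
    using assms by (subst sum.delta) auto
  finally show "monomial e x = (\<Sum>e'\<in>exponents N. (if e' = e then 1 else 0) * monomial e' x)" ..
qed

lemma poly_space_add:
  assumes "p \<in> poly_space N" "q \<in> poly_space N" shows "(\<lambda>x. p x + q x) \<in> poly_space N"
proof -
  obtain a b where "p = (\<lambda>x. \<Sum>e\<in>exponents N. a e * monomial e x)"
      "q = (\<lambda>x. \<Sum>e\<in>exponents N. b e * monomial e x)"
    using assms unfolding poly_space_iff by blast
  then have "(\<lambda>x. p x + q x) = (\<lambda>x. \<Sum>e\<in>exponents N. (a e + b e) * monomial e x)"
    by (simp add: sum.distrib distrib_right)
  then show ?thesis unfolding poly_space_iff by (rule exI[of _ "\<lambda>e. a e + b e"])
qed

lemma poly_space_scale: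
  assumes "p \<in> poly_space N" shows "(\<lambda>x. c * p x) \<in> poly_space N"
proof -
  obtain a where "p = (\<lambda>x. \<Sum>e\<in>exponents N. a e * monomial e x)"
    using assms unfolding poly_space_iff by blast
  then have "(\<lambda>x. c * p x) = (\<lambda>x. \<Sum>e\<in>exponents N. (c * a e) * monomial e x)"
    by (simp add: sum_distrib_left mult.assoc)
  then show ?thesis unfolding poly_space_iff by (rule exI[of _ "\<lambda>e. c * a e"])
qed

lemma poly_space_zero: "(\<lambda>x. 0) \<in> poly_space N"
  using poly_space_scale[OF poly_space_monomial[of "(0,0,0)" N], of 0] by simp

lemma poly_space_diff:
  assumes "p \<in> poly_space N" "q \<in> poly_space N" shows "(\<lambda>x. p x - q x) \<in> poly_space N"
  using poly_space_add[OF assms(1) poly_space_scale[OF assms(2), of "-1"]] by simp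

lemma poly_space_induct [consumes 1, case_names zero add monomial]:
  assumes "p \<in> poly_space N"
    and zero: "P (\<lambda>x. 0)"
    and add: "\<And>c e q. e \<in> exponents N \<Longrightarrow> q \<in> poly_space N \<Longrightarrow> P q \<Longrightarrow> P (\<lambda>x. c * monomial e x + q x)"
  shows "P p"
proof -
  obtain a where a: "p = (\<lambda>x. \<Sum>e\<in>exponents N. a e * monomial e x)"
    using assms unfolding poly_space_iff by blast
  have "P (\<lambda>x. \<Sum>e\<in>A. a e * monomial e x) \<and> (\<lambda>x. \<Sum>e\<in>A. a e * monomial e x) \<in> poly_space N"
    if "finite A" "A \<subseteq> exponents N" for A
    using that
  proof (induction A)
    case empty
    then show ?case by (simp add: zero poly_space_zero)
  next
    case (insert e A)
    then show ?case
      by (auto intro!: add poly_space_add poly_space_scale poly_space_monomial)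
  qed
  from this[of "exponents N"] show ?thesis
    unfolding a by auto
qed

lemma has_derivative_monomial:
  "(monomial (i, j, k) has_derivative
     (\<lambda>v. v$1 * (real i * monomial (i - 1, j, k) x) + v$2 * (real j * monomial (i, j - 1, k) x)
        + v$3 * (real k * monomial (i, j, k - 1) x))) (at x)"
  unfolding monomial_def
  by (auto intro!: derivative_eq_intros has_derivative_power[THEN has_derivative_eq_rhs]
      simp: fun_eq_iff algebra_simps bounded_linear_imp_has_derivative bounded_linear_vec_nth)

lemma poly_space_differentiable:
  assumes "p \<in> poly_space N" shows "p differentiable (at x)"
  using assms
proof (induction rule: poly_space_induct)
  case zero
  show ?case by simp
next
  case (add c e q)
  obtain i j k where e: "e = (i, j, k)" by (cases e)
  have "monomial e differentiable (at x)"
    unfolding e differentiable_def using has_derivative_monomial by blast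
  then show ?case using add by (intro derivative_intros) auto
qed

lemma partial_has_derivative:
  assumes "(f has_derivative f') (at x)"
  shows "partial i f x = f' (axis i 1)"
  unfolding partial_def using frechet_derivative_at[OF assms] by simp

lemma partial_linear:
  assumes "f differentiable (at x)" "g differentiable (at x)"
  shows "partial i (\<lambda>x. f x + g x) x = partial i f x + partial i g x"
    and "partial i (\<lambda>x. f x - g x) x = partial i f x - partial i g x"
    and "partial i (\<lambda>x. c *\<^sub>R f x) x = c *\<^sub>R partial i f x"
proof -
  have fg: "(f has_derivative frechet_derivative f (at x)) (at x)"
      "(g has_derivative frechet_derivative g (at x)) (at x)"
    using assms frechet_derivative_works by blast+
  show "partial i (\<lambda>x. f x + g x) x = partial i f x + partial i g x"
    "partial i (\<lambda>x. f x - g x) x = partial i f x - partial i g x"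
    "partial i (\<lambda>x. c *\<^sub>R f x) x = c *\<^sub>R partial i f x"
    using partial_has_derivative[OF has_derivative_add[OF fg]]
      partial_has_derivative[OF has_derivative_diff[OF fg]]
      partial_has_derivative[OF has_derivative_scaleR_right[OF fg(1)]]
    by (simp_all add: partial_def)
qed

lemma partial_component:
  fixes v :: "real^3 \<Rightarrow> real^3"
  assumes "v differentiable (at x)"
  shows "partial i (\<lambda>x. v x $ k) x = partial i v x $ k"
proof -
  have "(v has_derivative frechet_derivative v (at x)) (at x)"
    using assms frechet_derivative_works by blast
  then have "((\<lambda>x. v x $ k) has_derivative (\<lambda>h. frechet_derivative v (at x) h $ k)) (at x)"
    by (rule bounded_linear.has_derivative[OF bounded_linear_vec_nth])
  from partial_has_derivative[OF this] show ?thesis by (simp add: partial_def)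
qed

lemma partial_monomial:
  "partial 1 (monomial (i, j, k)) = (\<lambda>x. real i * monomial (i - 1, j, k) x)"
  "partial 2 (monomial (i, j, k)) = (\<lambda>x. real j * monomial (i, j - 1, k) x)"
  "partial 3 (monomial (i, j, k)) = (\<lambda>x. real k * monomial (i, j, k - 1) x)"
  by (auto simp: fun_eq_iff partial_has_derivative[OF has_derivative_monomial] axis_def)

lemma partial_const: "partial i (\<lambda>x. c) = (\<lambda>x. 0)"
  by (simp add: partial_def fun_eq_iff frechet_derivative_const)

lemma monomial_differentiable: "monomial e differentiable (at x)"
  using has_derivative_monomial[of "fst e" "fst (snd e)" "snd (snd e)" x] unfolding differentiable_def by auto

lemma partial_cmult:
  fixes f :: "real^3 \<Rightarrow> real"
  assumes "f differentiable (at x)"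
  shows "partial i (\<lambda>x. c * f x) x = c * partial i f x"
  using partial_linear(3)[OF assms assms, of i c] by simp

lemma partial_combine:
  assumes "q \<in> poly_space N"
  shows "partial i (\<lambda>x. c * monomial e x + q x) = (\<lambda>x. c * partial i (monomial e) x + partial i q x)"
proof
  fix x
  show "partial i (\<lambda>x. c * monomial e x + q x) x = c * partial i (monomial e) x + partial i q x"
    using monomial_differentiable[of e x] poly_space_differentiable[OF assms, of x]
    by (subst partial_linear(1)) (auto simp: partial_cmult intro!: derivative_intros)
qed

lemma partial_monomial_in:
  assumes "e \<in> exponents N" shows "partial i (monomial e) \<in> poly_space N"
proof -
  obtain a b c where e: "e = (a, b, c)" by (cases e)
  show ?thesis
    using exhaust_3[of i] assms
    by (auto simp: e partial_monomial intro!: poly_space_scale poly_space_monomial)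
qed

lemma partial_poly_space:
  assumes "p \<in> poly_space N" shows "partial i p \<in> poly_space N"
  using assms
proof (induction rule: poly_space_induct)
  case zero
  show ?case by (simp add: partial_const poly_space_zero)
next
  case (add c e q)
  then show ?case
    by (auto simp: partial_combine[OF add(2)]
        intro!: poly_space_add poly_space_scale partial_monomial_in)
qed

lemma partial_commute:
  assumes "p \<in> poly_space N"
  shows "partial i (partial j p) = partial j (partial i p)"
  using assms
proof (induction rule: poly_space_induct)
  case zero
  show ?case by (simp add: partial_const)
next
  case (add c e q)
  obtain k l m where e: "e = (k, l, m)" by (cases e)
  have lin: "partial i' (\<lambda>x. c * partial j' (monomial e) x + partial j' q x)
      = (\<lambda>x. c * partial i' (partial j' (monomial e)) x + partial i' (partial j' q) x)" for i' j'
  proof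
    fix x
    have "partial j' (monomial e) differentiable (at x)" "partial j' q differentiable (at x)"
      using partial_monomial_in[OF add(1)] partial_poly_space[OF add(2)] poly_space_differentiable
      by blast+
    then show "partial i' (\<lambda>x. c * partial j' (monomial e) x + partial j' q x) x
      = c * partial i' (partial j' (monomial e)) x + partial i' (partial j' q) x"
      by (subst partial_linear(1)) (auto simp: partial_cmult intro!: derivative_intros)
  qed
  have cm: "partial i' (\<lambda>x. r * monomial e' x) = (\<lambda>x. r * partial i' (monomial e') x)" for i' r e'
    by (simp add: fun_eq_iff partial_cmult monomial_differentiable)
  have "partial i (partial j (monomial e)) = partial j (partial i (monomial e))"
    unfolding e using exhaust_3[of i] exhaust_3[of j]
    by (auto simp: partial_monomial cm)
  then show ?case
    by (simp add: partial_combine[OF add(2)] lin add)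
qed

lemma poly_space_continuous:
  assumes "p \<in> poly_space N" shows "continuous_on S p"
  by (metis assms continuous_at_imp_continuous_on differentiable_imp_continuous_within poly_space_differentiable)

text \<open>On a line a polynomial in three variables is a polynomial in one variable, which vanishes
  identically once it vanishes on an interval.\<close>

lemma poly_space_line:
  assumes "p \<in> poly_space N" shows "\<exists>q::real poly. \<forall>t. p (x + t *\<^sub>R y) = poly q t"
  using assms
proof (induction rule: poly_space_induct)
  case zero
  show ?case by (intro exI[of _ 0]) simp
next
  case (add c e r)
  obtain q where q: "\<forall>t. r (x + t *\<^sub>R y) = poly q t" using add by blast
  obtain i j k where e: "e = (i, j, k)" by (cases e)
  show ?case
    by (rule exI[of _ "smult c ([:x$1, y$1:]^i * [:x$2, y$2:]^j * [:x$3, y$3:]^k) + q"])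
       (simp add: q e monomial_def poly_power)
qed

lemma poly_space_eq_zero:
  assumes p: "p \<in> poly_space N" and S: "open S" "S \<noteq> {}" and z: "\<And>x. x \<in> S \<Longrightarrow> p x = 0"
  shows "p y = 0"
proof -
  obtain x where x: "x \<in> S" using S by blast
  obtain q where q: "\<And>t. p (x + t *\<^sub>R (y - x)) = poly q t"
    using poly_space_line[OF p] by metis
  have "open ((\<lambda>t. x + t *\<^sub>R (y - x)) -` S)"
    by (intro open_vimage S continuous_intros)
  moreover have "0 \<in> (\<lambda>t. x + t *\<^sub>R (y - x)) -` S" using x by simp
  ultimately have "infinite ((\<lambda>t. x + t *\<^sub>R (y - x)) -` S)"
    using open_UNIV finite_imp_not_open by blast
  moreover have "(\<lambda>t. x + t *\<^sub>R (y - x)) -` S \<subseteq> {t. poly q t = 0}"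
    using q z by (auto simp flip: q)
  ultimately have "q = 0"
    using poly_roots_finite[of q] finite_subset by blast
  then show ?thesis using q[of 1] by simp
qed

text \<open>The set where two continuous functions differ is open, and open null sets are empty.\<close>

lemma AE_eq_imp_eq_open:
  fixes f g :: "real^3 \<Rightarrow> real^3"
  assumes "AE x in lebesgue_on T. f x = g x" and "open S" "S \<subseteq> T" "T \<in> sets lebesgue"
    and c: "continuous_on S f" "continuous_on S g" and x: "x \<in> S"
  shows "f x = g x"
proof (rule ccontr)
  assume ne: "f x \<noteq> g x"
  have "open (S \<inter> (\<lambda>x. f x - g x) -` (- {0}))"
    using continuous_open_preimage[OF _ \<open>open S\<close>, of "\<lambda>x. f x - g x" "-{0}"] c
    by (auto intro!: continuous_intros)
  moreover have "AE x in lebesgue. x \<in> T \<longrightarrow> f x = g x"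
    using assms(1,4) by (simp add: AE_restrict_space_iff)
  then have "AE x in lebesgue. x \<notin> S \<inter> (\<lambda>x. f x - g x) -` (- {0})"
    using \<open>S \<subseteq> T\<close> by (auto elim!: eventually_mono)
  then have "negligible (S \<inter> (\<lambda>x. f x - g x) -` (- {0}))"
    unfolding negligible_iff_null_sets
    by (subst AE_iff_null_sets) (use calculation in \<open>auto simp: lborelD\<close>)
  ultimately have "S \<inter> (\<lambda>x. f x - g x) -` (- {0}) = {}"
    using open_not_negligible by blast
  then show False using ne x by auto
qed

lemma poly_space3_component: "v \<in> poly_space3 N \<Longrightarrow> (\<lambda>x. v x $ i) \<in> poly_space N"
  by (simp add: poly_space3_def)

lemma poly_space3_differentiable:
  assumes "v \<in> poly_space3 N" shows "v differentiable (at x)"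
proof -
  have "v differentiable (at x within UNIV)"
    by (subst differentiable_componentwise_within)
      (use poly_space_differentiable[OF poly_space3_component[OF assms]] in
        \<open>auto simp: Basis_vec_def inner_axis\<close>)
  then show ?thesis by simp
qed

lemma poly_space3_continuous:
  assumes "v \<in> poly_space3 N" shows "continuous_on S v"
  by (metis assms continuous_at_imp_continuous_on differentiable_imp_continuous_within poly_space3_differentiable)

lemma poly_space3_add: "u \<in> poly_space3 N \<Longrightarrow> v \<in> poly_space3 N \<Longrightarrow> (\<lambda>x. u x + v x) \<in> poly_space3 N"
  by (auto simp: poly_space3_def poly_space_add)

text \<open>The definite description is justified because a polynomial is determined by its values almost
  everywhere on an element, which has interior points.\<close>

lemma piece:
  assumes v: "v \<in> dg_space \<T> N" and T: "T \<in> \<T>" "interior T \<noteq> {}" "T \<in> sets lebesgue"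
  shows "piece N v T \<in> poly_space3 N" "AE x in lebesgue_on T. v x = piece N v T x"
proof -
  let ?P = "\<lambda>p. p \<in> poly_space3 N \<and> (AE x in lebesgue_on T. v x = p x)"
  obtain p where p: "?P p" using v T unfolding dg_space_def by blast
  have uniq: "q = p" if q: "?P q" for q
  proof
    fix y
    have qp: "AE x in lebesgue_on T. q x = p x"
      using conjunct2[OF p] conjunct2[OF q] by eventually_elim simp
    have "q x = p x" if "x \<in> interior T" for x
      by (rule AE_eq_imp_eq_open[OF qp open_interior interior_subset T(3) _ _ that])
        (use p q poly_space3_continuous in auto)
    then have "q x $ i - p x $ i = 0" if "x \<in> interior T" for x i
      using that by simp
    moreover have "(\<lambda>x. q x $ i - p x $ i) \<in> poly_space N" for i
      using p q by (intro poly_space_diff poly_space3_component) auto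
    ultimately have "q y $ i - p y $ i = 0" for i
      using poly_space_eq_zero[OF _ open_interior T(2), of "\<lambda>x. q x $ i - p x $ i" N y] by blast
    then show "q y = p y" by (simp add: vec_eq_iff)
  qed
  have "?P (piece N v T)"
    unfolding piece_def using p uniq by (rule theI)
  then show "piece N v T \<in> poly_space3 N" "AE x in lebesgue_on T. v x = piece N v T x"
    by auto
qed

section \<open>Integration over triangles\<close>

definition ref_triangle :: "(real \<times> real) set" where
  "ref_triangle = {(s, t). 0 \<le> s \<and> 0 \<le> t \<and> s + t \<le> 1}"

definition tri_map :: "real^3 \<Rightarrow> real^3 \<Rightarrow> real^3 \<Rightarrow> real \<times> real \<Rightarrow> real^3" where
  "tri_map a b c = (\<lambda>(s, t). a + s *\<^sub>R (b - a) + t *\<^sub>R (c - a))"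

text \<open>Twice the area, that is, the factor between the measure of the parameter triangle and the surface
  measure.\<close>

definition tri_area2 :: "real^3 \<Rightarrow> real^3 \<Rightarrow> real^3 \<Rightarrow> real" where
  "tri_area2 a b c = norm (cross3 (b - a) (c - a))"

definition tri_measure :: "real^3 \<Rightarrow> real^3 \<Rightarrow> real^3 \<Rightarrow> (real^3) measure" where
  "tri_measure a b c =
     density (distr (restrict_space lborel ref_triangle) borel (tri_map a b c))
       (\<lambda>_. ennreal (tri_area2 a b c))"

definition tri_integral :: "real^3 \<Rightarrow> real^3 \<Rightarrow> real^3 \<Rightarrow> (real^3 \<Rightarrow> real) \<Rightarrow> real" where
  "tri_integral a b c f = (LINT p|lborel. indicator ref_triangle p * f (tri_map a b c p))"

lemma compact_ref_triangle: "compact ref_triangle"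
proof -
  have eq: "ref_triangle = {p. 0 \<le> fst p} \<inter> {p. 0 \<le> snd p} \<inter> {p. fst p + snd p \<le> 1}"
    by (auto simp: ref_triangle_def)
  have "closed ref_triangle"
    unfolding eq
    by (intro closed_Int closed_Collect_le continuous_intros)
  moreover have "ref_triangle \<subseteq> cbox (0, 0) (1, 1)"
    by (auto simp: ref_triangle_def cbox_Pair_eq)
  ultimately show ?thesis
    by (meson bounded_cbox bounded_subset compact_eq_bounded_closed)
qed

lemma ref_triangle_borel [measurable]: "ref_triangle \<in> sets borel"
  using compact_ref_triangle by (simp add: borel_compact)

lemma continuous_tri_map: "continuous_on S (tri_map a b c)"
  unfolding tri_map_def case_prod_unfold by (intro continuous_intros)

lemma tri_map_measurable [measurable]: "tri_map a b c \<in> borel_measurable borel"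
  by (intro borel_measurable_continuous_onI continuous_tri_map)

lemma tri_map_measurable_restrict [measurable]:
  "tri_map a b c \<in> restrict_space lborel ref_triangle \<rightarrow>\<^sub>M borel"
  by (intro measurable_restrict_space1) (simp add: tri_map_measurable)

lemma tri_map_image: "tri_map a b c ` ref_triangle = convex hull {a, b, c}"
proof -
  have "convex hull {a, b, c} = {a + u *\<^sub>R (b - a) + v *\<^sub>R (c - a) | u v. 0 \<le> u \<and> 0 \<le> v \<and> u + v \<le> 1}"
    by (rule convex_hull_3_alt)
  then show ?thesis
    unfolding tri_map_def ref_triangle_def by (auto simp: image_iff Bex_def)
qed

text \<open>The choice made in \<^const>\<open>surface_measure\<close> yields some enumeration of the vertices of the
  triangle, not necessarily the given one.\<close>

lemma surface_measure_cases:
  assumes "F = convex hull {a, b, c}"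
  obtains a' b' c' where "F = convex hull {a', b', c'}" "surface_measure F = tri_measure a' b' c'"
proof -
  obtain a' b' c' where s: "(SOME (a, b, c). F = convex hull {a, b, c}) = (a', b', c')"
    using prod_cases3 by blast
  have "case (a', b', c') of (a, b, c) \<Rightarrow> F = convex hull {a, b, c}"
    unfolding s[symmetric] by (rule someI_ex) (use assms in auto)
  then have "F = convex hull {a', b', c'}" by simp
  moreover have "surface_measure F = tri_measure a' b' c'"
    unfolding surface_measure_def s Let_def prod.case tri_measure_def
    by (rule measure_eqI)
      (auto simp: emeasure_density_const tri_area2_def tri_map_def ref_triangle_def)
  ultimately show ?thesis by (rule that)
qed

lemma finite_tri_measure: "finite_measure (tri_measure a b c)"
proof
  have "emeasure lborel ref_triangle < \<infinity>"
    using compact_ref_triangle emeasure_compact_finite by blast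
  then have "emeasure (tri_measure a b c) UNIV < \<infinity>"
    unfolding tri_measure_def
    by (subst emeasure_density_const)
      (auto simp: emeasure_distr space_restrict_space emeasure_restrict_space ennreal_mult_less_top)
  then show "emeasure (tri_measure a b c) (space (tri_measure a b c)) \<noteq> \<infinity>"
    by (simp add: tri_measure_def)
qed

lemma AE_tri_measure: "AE x in tri_measure a b c. x \<in> convex hull {a, b, c}"
proof -
  have "{x. x \<in> convex hull {a, b, c}} \<in> sets borel"
    using borel_compact[OF compact_convex_hull[OF finite_imp_compact[of "{a, b, c}"]]] by simp
  then have "AE x in distr (restrict_space lborel ref_triangle) borel (tri_map a b c). x \<in> convex hull {a, b, c}"
    by (subst AE_distr_iff) (auto simp: AE_restrict_space_iff simp flip: tri_map_image)
  then show ?thesis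
    unfolding tri_measure_def by (subst AE_density) auto
qed

lemma LINT_tri_measure:
  assumes "f \<in> borel_measurable borel"
  shows "(LINT x|tri_measure a b c. f x) = tri_area2 a b c * tri_integral a b c f"
proof -
  have "(LINT x|tri_measure a b c. f x)
      = (LINT x|distr (restrict_space lborel ref_triangle) borel (tri_map a b c). tri_area2 a b c *\<^sub>R f x)"
    unfolding tri_measure_def by (rule integral_density) (use assms in \<open>auto simp: tri_area2_def\<close>)
  also have "\<dots> = (LINT p|restrict_space lborel ref_triangle. tri_area2 a b c *\<^sub>R f (tri_map a b c p))"
    by (rule integral_distr) (use assms in auto)
  also have "\<dots> = tri_area2 a b c * tri_integral a b c f"
    unfolding tri_integral_def by (simp add: integral_restrict_space mult.left_commute)
  finally show ?thesis .
qed

lemma ref_triangle_null: "measure lborel ref_triangle > 0"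
proof -
  have sub: "box (0::real, 0::real) (1/2, 1/2) \<subseteq> ref_triangle"
    by (auto simp: ref_triangle_def box_def Basis_prod_def)
  have "measure lborel (box (0::real,0::real) (1/2, 1/2)) > 0"
    by (simp add: measure_lborel_box_eq Basis_prod_def)
  moreover have "measure lborel (box (0::real,0::real) (1/2, 1/2)) \<le> measure lborel ref_triangle"
    by (rule measure_mono_fmeasurable)
       (use sub fmeasurable_compact[OF compact_ref_triangle] in auto)
  ultimately show ?thesis by simp
qed

lemma space_tri_measure: "measure (tri_measure a b c) UNIV = tri_area2 a b c * measure lborel ref_triangle"
proof -
  have "measure (tri_measure a b c) UNIV = (LINT x|tri_measure a b c. 1)"
    by (simp add: tri_measure_def)
  also have "\<dots> = tri_area2 a b c * measure lborel ref_triangle"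
    by (subst LINT_tri_measure) (auto simp: tri_integral_def)
  finally show ?thesis .
qed

subsection \<open>Independence of the order of the vertices\<close>

lemma tri_integrable:
  fixes f :: "real^3 \<Rightarrow> real"
  assumes "continuous_on UNIV f"
  shows "integrable lborel (\<lambda>p. indicator ref_triangle p * f (tri_map a b c p))"
proof -
  have "continuous_on ref_triangle (\<lambda>p. f (tri_map a b c p))"
    by (rule continuous_on_compose2[OF assms continuous_tri_map]) auto
  from borel_integrable_compact[OF compact_ref_triangle this] show ?thesis by simp
qed

lemma tri_integral_swap:
  fixes f :: "real^3 \<Rightarrow> real"
  assumes "continuous_on UNIV f"
  shows "tri_integral a c b f = tri_integral a b c f"
proof -
  let ?g = "\<lambda>p. indicator ref_triangle p * f (tri_map a b c p)"
  have "tri_integral a c b f = (LINT (s, t)|lborel. ?g (t, s))"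
    unfolding tri_integral_def
    by (intro Bochner_Integration.integral_cong)
      (auto simp: tri_map_def ref_triangle_def indicator_def algebra_simps)
  also have "\<dots> = (LINT p|lborel. ?g p)"
    using lborel_pair.integral_product_swap[of ?g] tri_integrable[OF assms, of a b c]
    by (simp add: lborel_prod case_prod_unfold)
  finally show ?thesis by (simp add: tri_integral_def)
qed

text \<open>Swapping the vertices \<open>a\<close> and \<open>b\<close> is the substitution \<open>s \<mapsto> 1 - t - s\<close> in the inner integral
  of the reference triangle.\<close>

lemma tri_integral_rotate:
  fixes f :: "real^3 \<Rightarrow> real"
  assumes "continuous_on UNIV f"
  shows "tri_integral b a c f = tri_integral a b c f"
proof -
  let ?g = "\<lambda>p. indicator ref_triangle p * f (tri_map a b c p)"
  let ?h = "\<lambda>p. indicator ref_triangle p * f (tri_map b a c p)"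
  have "tri_integral b a c f = (LINT t|lborel. LINT s|lborel. ?h (s, t))"
    unfolding tri_integral_def
    using lborel_pair.integral_snd[of "\<lambda>s t. ?h (s, t)"] tri_integrable[OF assms, of b a c]
    by (simp add: lborel_prod case_prod_unfold)
  also have "\<dots> = (LINT t|lborel. LINT s|lborel. ?h (1 - t + (- 1) * s, t))"
  proof (rule Bochner_Integration.integral_cong[OF refl])
    fix t :: real
    show "(LINT s|lborel. ?h (s, t)) = (LINT s|lborel. ?h (1 - t + (- 1) * s, t))"
      by (subst lborel_integral_real_affine[where c = "-1" and t = "1 - t"]) auto
  qed
  also have "\<dots> = (LINT t|lborel. LINT s|lborel. ?g (s, t))"
  proof (intro Bochner_Integration.integral_cong refl)
    fix t s :: real
    have "tri_map b a c (1 - t + (- 1) * s, t) = tri_map a b c (s, t)"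
      unfolding tri_map_def by (simp add: algebra_simps)
    then show "?h (1 - t + (- 1) * s, t) = ?g (s, t)"
      by (auto simp: ref_triangle_def indicator_def)
  qed
  also have "\<dots> = tri_integral a b c f"
    unfolding tri_integral_def
    using lborel_pair.integral_snd[of "\<lambda>s t. ?g (s, t)"] tri_integrable[OF assms, of a b c]
    by (simp add: lborel_prod case_prod_unfold)
  finally show ?thesis .
qed

lemma tri_area2_perm:
  "tri_area2 a c b = tri_area2 a b c" "tri_area2 b a c = tri_area2 a b c"
proof -
  have "cross3 (c - a) (b - a) = - cross3 (b - a) (c - a)"
    by (rule cross_skew)
  then show "tri_area2 a c b = tri_area2 a b c" unfolding tri_area2_def by simp
  have "cross3 (a - b) (c - b) = - cross3 (b - a) (c - a)"
    by (simp add: cross3_simps)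
  then show "tri_area2 b a c = tri_area2 a b c" unfolding tri_area2_def by simp
qed

text \<open>Two transpositions generate all permutations of three vertices.\<close>

lemma tri_perm_set:
  assumes perm: "\<And>a b c. \<phi> a c b = \<phi> a b c" "\<And>a b c. \<phi> b a c = \<phi> a b c"
    and "{a, b, c} = {a', b', c'}" "a \<noteq> b" "a \<noteq> c" "b \<noteq> c"
  shows "\<phi> a' b' c' = \<phi> a b c"
proof -
  have "a' = a \<and> b' = b \<and> c' = c \<or> a' = a \<and> b' = c \<and> c' = b \<or> a' = b \<and> b' = a \<and> c' = c \<or>
        a' = b \<and> b' = c \<and> c' = a \<or> a' = c \<and> b' = a \<and> c' = b \<or> a' = c \<and> b' = b \<and> c' = a"
  proof -
    have "card {a', b', c'} = 3"
      using assms(3-6) by (simp flip: assms(3))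
    then have "a' \<noteq> b'" "a' \<noteq> c'" "b' \<noteq> c'"
      by (auto simp: card_insert_if split: if_splits)
    moreover have "a' \<in> {a, b, c}" "b' \<in> {a, b, c}" "c' \<in> {a, b, c}"
      using assms(3) by blast+
    ultimately show ?thesis by auto
  qed
  then show ?thesis
    using perm(1)[of a b c] perm(2)[of a b c] perm(1)[of b a c] perm(2)[of a c b] perm(2)[of b c a]
    by (elim disjE) simp_all
qed

lemma not_affine_dependent_3:
  assumes "tri_area2 a b c \<noteq> 0"
  shows "\<not> affine_dependent {a, b, c}" "a \<noteq> b" "a \<noteq> c" "b \<noteq> c"
proof -
  show ne: "a \<noteq> b" "a \<noteq> c" "b \<noteq> c" using assms by (auto simp: tri_area2_def)
  have "\<not> collinear {0, b - a, c - a}"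
    using assms by (simp add: tri_area2_def cross_eq_0)
  then have "\<not> collinear {b, a, c}"
    using collinear_3[of b a c] by (cases "b = 0") (auto simp: NO_MATCH_def)
  moreover have "{b, a, c} = {a, b, c}" by (rule insert_commute)
  ultimately have "\<not> collinear {a, b, c}" by (simp only: not_False_eq_True)
  then show "\<not> affine_dependent {a, b, c}"
    using affine_dependent_imp_collinear_3 by blast
qed

text \<open>The vertices of a triangle are its extreme points, so a different description of the same
  triangle is a permutation of the vertices.\<close>

lemma convex_hull_3_eq_imp:
  assumes "tri_area2 a b c \<noteq> 0" "convex hull {a, b, c} = convex hull {a', b', c'}"
  shows "{a, b, c} = {a', b', c'}"
proof (rule card_seteq)
  show "finite {a', b', c'}" by simp
  show "{a, b, c} \<subseteq> {a', b', c'}"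
    using extreme_point_of_convex_hull[of _ "{a', b', c'}"]
      extreme_point_of_convex_hull_affine_independent[OF not_affine_dependent_3(1)[OF assms(1)]]
      assms(2) by auto
  show "card {a', b', c'} \<le> card {a, b, c}"
    using not_affine_dependent_3[OF assms(1)] by (simp add: card_insert_if)
qed

text \<open>The integral may be computed from any enumeration of the vertices, because the enumerations of a
  nondegenerate triangle differ by a permutation.\<close>

lemma LINT_surface_measure:
  assumes F: "F = convex hull {a, b, c}" and ne: "tri_area2 a b c \<noteq> 0" and f: "continuous_on UNIV f"
  shows "(LINT x|surface_measure F. f x) = tri_area2 a b c * tri_integral a b c f"
proof -
  obtain a' b' c' where s: "F = convex hull {a', b', c'}" "surface_measure F = tri_measure a' b' c'"
    using surface_measure_cases[OF F] by blast
  have eq: "{a, b, c} = {a', b', c'}"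
    using convex_hull_3_eq_imp[OF ne] F s by simp
  note ne3 = not_affine_dependent_3(2-4)[OF ne]
  have "tri_area2 a' b' c' = tri_area2 a b c"
    by (rule tri_perm_set[of tri_area2, OF tri_area2_perm eq ne3])
  moreover have "tri_integral a' b' c' f = tri_integral a b c f"
    by (rule tri_perm_set[of "\<lambda>a b c. tri_integral a b c f", OF tri_integral_swap[OF f] tri_integral_rotate[OF f] eq ne3])
  moreover have "f \<in> borel_measurable borel" using f by (rule borel_measurable_continuous_onI)
  ultimately show ?thesis unfolding s(2) by (simp add: LINT_tri_measure)
qed

section \<open>The divergence theorem on a tetrahedron\<close>

subsection \<open>Parametrization of tetrahedra\<close>

definition tet_map :: "real^3 \<Rightarrow> real^3 \<Rightarrow> real^3 \<Rightarrow> real^3 \<Rightarrow> real \<times> real \<times> real \<Rightarrow> real^3" where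
  "tet_map d a b c = (\<lambda>(s, t, r). d + s *\<^sub>R (a - d) + t *\<^sub>R (b - d) + r *\<^sub>R (c - d))"

text \<open>Its absolute value is six times the volume of the tetrahedron.\<close>

definition tet_det :: "real^3 \<Rightarrow> real^3 \<Rightarrow> real^3 \<Rightarrow> real^3 \<Rightarrow> real" where
  "tet_det d a b c = (a - d) \<bullet> cross3 (b - d) (c - d)"

definition ref_tet :: "(real \<times> real \<times> real) set" where
  "ref_tet = {(s, t, r). 0 \<le> s \<and> 0 \<le> t \<and> 0 \<le> r \<and> s + t + r \<le> 1}"

lemma prod_Basis_3:
  fixes f :: "real^3 \<Rightarrow> 'a::comm_monoid_mult"
  shows "(\<Prod>b\<in>Basis. f b) = f (axis 1 1) * f (axis 2 1) * f (axis 3 (1::real))"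
proof -
  have eq: "(Basis :: (real^3) set) = (\<lambda>i. axis i 1) ` UNIV"
    by (auto simp: Basis_vec_def)
  have "(\<Prod>b\<in>Basis. f b) = (\<Prod>i\<in>UNIV. f (axis (i::3) 1))"
    unfolding eq by (subst prod.reindex) (simp_all add: inj_on_def axis_eq_axis)
  also have "\<dots> = f (axis 1 1) * f (axis 2 1) * f (axis 3 1)"
    unfolding UNIV_3 by (simp add: mult.assoc)
  finally show ?thesis .
qed

lemma vector3_measurable [measurable]:
  "(\<lambda>(s, t, r). vector [s, t, r] :: real^3) \<in> borel_measurable borel"
proof -
  have eq: "(\<lambda>(s, t, r). vector [s, t, r] :: real^3)
      = (\<lambda>p. fst p *\<^sub>R axis 1 1 + fst (snd p) *\<^sub>R axis 2 1 + snd (snd p) *\<^sub>R axis 3 1)"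
    by (auto simp: fun_eq_iff vec_eq_iff forall_3 axis_def)
  show ?thesis
    unfolding eq by (intro borel_measurable_continuous_onI continuous_intros)
qed

lemma Basis_prod_real3: "(Basis :: (real \<times> real \<times> real) set) = {(1, 0, 0), (0, 1, 0), (0, 0, 1)}"
  by (auto simp: Basis_prod_def zero_prod_def)

lemma emeasure_lborel_box3:
  fixes l u :: "real^3"
  assumes le: "\<And>i. l $ i \<le> u $ i"
  shows "emeasure lborel (box (l$1, l$2, l$3) (u$1, u$2, u$3)) = ennreal ((u$1 - l$1) * (u$2 - l$2) * (u$3 - l$3))"
proof -
  have "emeasure lborel (box (l$1, l$2, l$3) (u$1, u$2, u$3)) = ennreal (\<Prod>b\<in>Basis. ((u$1, u$2, u$3) - (l$1, l$2, l$3)) \<bullet> b)"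
    by (rule emeasure_lborel_box) (use le in \<open>simp add: Basis_prod_real3; fastforce\<close>)
  also have "(\<Prod>b\<in>Basis. ((u$1, u$2, u$3) - (l$1, l$2, l$3)) \<bullet> b) = (u$1 - l$1) * (u$2 - l$2) * (u$3 - l$3)"
    unfolding Basis_prod_real3 by simp
  finally show ?thesis .
qed

text \<open>Triples carry a product measure, to which the theorem of Fubini applies. This transfers it to vectors.\<close>

lemma distr_lborel_vector3:
  "distr lborel borel (\<lambda>(s, t, r). vector [s, t, r] :: real^3) = lborel"
proof (rule lborel_eqI[symmetric])
  fix l u :: "real^3"
  assume lu: "\<And>b. b \<in> Basis \<Longrightarrow> l \<bullet> b \<le> u \<bullet> b"
  have le: "l $ i \<le> u $ i" for i
    using lu[of "axis i 1"] by (simp add: inner_axis)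
  have eq: "(\<lambda>(s, t, r). vector [s, t, r] :: real^3) -` box l u = box (l$1, l$2, l$3) (u$1, u$2, u$3)"
    by (rule set_eqI) (simp add: mem_box_cart forall_3 mem_box Basis_prod_real3 split_beta inner_prod_def)
  have "emeasure (distr lborel borel (\<lambda>(s, t, r). vector [s, t, r] :: real^3)) (box l u)
      = emeasure lborel (box (l$1, l$2, l$3) (u$1, u$2, u$3))"
  proof (subst emeasure_distr)
    show "(\<lambda>(s, t, r). vector [s, t, r] :: real^3) \<in> borel_measurable lborel"
      using vector3_measurable by simp
  qed (simp_all only: eq space_lborel space_borel Int_UNIV_right borel_open open_box)
  also have "\<dots> = ennreal ((u$1 - l$1) * (u$2 - l$2) * (u$3 - l$3))"
    by (rule emeasure_lborel_box3[OF le])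
  also have "(u$1 - l$1) * (u$2 - l$2) * (u$3 - l$3) = (\<Prod>b\<in>Basis. (u - l) \<bullet> b)"
    by (simp add: prod_Basis_3 inner_axis)
  finally show "emeasure (distr lborel borel (\<lambda>(s, t, r). vector [s, t, r] :: real^3)) (box l u)
      = ennreal (\<Prod>b\<in>Basis. (u - l) \<bullet> b)" .
qed simp

text \<open>The two measures need only be compared on boxes, where the claim is the scaling of volumes by the
  determinant.\<close>

lemma lborel_linear_image:
  fixes g :: "real^3 \<Rightarrow> real^3"
  assumes g: "linear g" and det: "det (matrix g) \<noteq> 0"
  shows "lborel = density (distr lborel borel g) (\<lambda>_. ennreal \<bar>det (matrix g)\<bar>)"
proof (rule lborel_eqI)
  fix l u :: "real^3"
  assume lu: "\<And>b. b \<in> Basis \<Longrightarrow> l \<bullet> b \<le> u \<bullet> b"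
  have "inj g" using det_nz_iff_inj[OF g] det by blast
  then obtain h where h: "linear h" "\<And>x. h (g x) = x" "\<And>x. g (h x) = x"
    using linear_injective_isomorphism[OF g] by blast
  have m: "g \<in> borel_measurable lborel"
    using borel_measurable_continuous_onI[OF linear_continuous_on, of g] g
    by (simp add: linear_conv_bounded_linear)
  have S: "g -` box l u = h ` box l u"
  proof (intro equalityI subsetI)
    fix x assume "x \<in> g -` box l u"
    then show "x \<in> h ` box l u" using h(2)[of x] by (intro image_eqI[of _ _ "g x"]) simp_all
  next
    fix x assume "x \<in> h ` box l u"
    then show "x \<in> g -` box l u" using h(3) by force
  qed
  have lm: "g -` box l u \<in> lmeasurable"
    unfolding S by (rule measurable_linear_image) (use h in auto)
  have "g ` (g -` box l u) = box l u"
    using surjI[of g h, OF h(3)] by (rule surj_image_vimage_eq)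
  then have meas: "measure lebesgue (box l u) = \<bar>det (matrix g)\<bar> * measure lebesgue (g -` box l u)"
    using measure_linear_image[OF g lm] by simp
  have "g -` box l u \<in> sets borel"
    using measurable_sets_borel[of g borel "box l u"] m by simp
  then have "emeasure lborel (g -` box l u) = emeasure lebesgue (g -` box l u)"
    by simp
  also have "\<dots> = ennreal (measure lebesgue (g -` box l u))"
    using lm by (rule emeasure_eq_measure2)
  finally have "emeasure (density (distr lborel borel g) (\<lambda>_. ennreal \<bar>det (matrix g)\<bar>)) (box l u)
      = ennreal (measure lebesgue (box l u))"
    using m by (simp add: emeasure_density_const emeasure_distr meas ennreal_mult)
  also have "\<dots> = ennreal (\<Prod>b\<in>Basis. (u - l) \<bullet> b)"
    using lu by (simp add: measure_lborel_box_eq)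
  finally show "emeasure (density (distr lborel borel g) (\<lambda>_. ennreal \<bar>det (matrix g)\<bar>)) (box l u)
      = ennreal (\<Prod>b\<in>Basis. (u - l) \<bullet> b)" .
qed simp

lemma LINT_tet_map:
  fixes \<phi> :: "real^3 \<Rightarrow> real"
  assumes D: "tet_det d a b c \<noteq> 0" and [measurable]: "\<phi> \<in> borel_measurable borel"
  shows "(LINT x|lborel. \<phi> x) = \<bar>tet_det d a b c\<bar> * (LINT p|lborel. \<phi> (tet_map d a b c p))"
proof -
  define g :: "real^3 \<Rightarrow> real^3" where "g x = x$1 *\<^sub>R (a - d) + x$2 *\<^sub>R (b - d) + x$3 *\<^sub>R (c - d)" for x
  have g: "linear g" unfolding g_def by (rule linearI) (simp_all add: algebra_simps)
  have det: "det (matrix g) = tet_det d a b c"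
    unfolding g_def tet_det_def matrix_def by (simp add: det_3 cross3_simps axis_def)
  have [measurable]: "g \<in> borel_measurable borel"
    using borel_measurable_continuous_onI[OF linear_continuous_on, of g] g
    by (simp add: linear_conv_bounded_linear)
  have "(LINT x|lborel. \<phi> x) = (LINT x|lborel. \<phi> (d + x))"
    by (subst lborel_distr_plus[of d, symmetric]) (simp add: integral_distr)
  also have "\<dots> = (LINT x|distr lborel borel g. \<bar>det (matrix g)\<bar> *\<^sub>R \<phi> (d + x))"
    by (subst lborel_linear_image[OF g]) (use D det in \<open>auto simp: integral_density\<close>)
  also have "\<dots> = \<bar>det (matrix g)\<bar> * (LINT x|lborel. \<phi> (d + g x))"
    by (simp add: integral_distr)
  also have "(LINT x|lborel. \<phi> (d + g x)) = (LINT (s, t, r)|lborel. \<phi> (d + g (vector [s, t, r])))"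
  proof (subst distr_lborel_vector3[symmetric], subst integral_distr)
    show "(LINT p|lborel. \<phi> (d + g (case p of (s, t, r) \<Rightarrow> vector [s, t, r])))
      = (LINT (s, t, r)|lborel. \<phi> (d + g (vector [s, t, r])))"
      by (simp add: case_prod_unfold)
  qed (simp_all add: vector3_measurable)
  also have "\<dots> = (LINT p|lborel. \<phi> (tet_map d a b c p))"
    by (intro Bochner_Integration.integral_cong) (auto simp: tet_map_def g_def add.assoc)
  finally show ?thesis by (simp add: det)
qed

lemma tet_map_image: "tet_map d a b c ` ref_tet = convex hull {a, b, c, d}"
proof
  show "tet_map d a b c ` ref_tet \<subseteq> convex hull {a, b, c, d}"
  proof clarify
    fix s t r :: real assume "(s, t, r) \<in> ref_tet"
    then have nn: "0 \<le> s" "0 \<le> t" "0 \<le> r" "s + t + r \<le> 1" by (auto simp: ref_tet_def)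
    let ?w = "\<lambda>i::nat. [s, t, r, 1 - s - t - r] ! i" and ?y = "\<lambda>i::nat. [a, b, c, d] ! i"
    have "(\<Sum>i\<in>{..<4}. ?w i *\<^sub>R ?y i) \<in> convex hull {a, b, c, d}"
    proof (rule convex_sum)
      show "sum ?w {..<4} = 1" by (simp add: eval_nat_numeral)
      fix i :: nat assume "i \<in> {..<4}"
      then have "i = 0 \<or> i = 1 \<or> i = 2 \<or> i = 3" by auto
      then show "0 \<le> ?w i" "?y i \<in> convex hull {a, b, c, d}"
        using nn by (auto intro!: hull_inc simp: eval_nat_numeral)
    qed auto
    also have "(\<Sum>i\<in>{..<4}. ?w i *\<^sub>R ?y i) = tet_map d a b c (s, t, r)"
      by (simp add: eval_nat_numeral tet_map_def algebra_simps)
    finally show "tet_map d a b c (s, t, r) \<in> convex hull {a, b, c, d}" .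
  qed
  have "convex (tet_map d a b c ` ref_tet)"
  proof (rule convexI)
    fix x y :: "real^3" and u v :: real
    assume x: "x \<in> tet_map d a b c ` ref_tet" and y: "y \<in> tet_map d a b c ` ref_tet"
      and uv: "0 \<le> u" "0 \<le> v" "u + v = 1"
    obtain s t r where 1: "(s, t, r) \<in> ref_tet" "x = tet_map d a b c (s, t, r)" using x by auto
    obtain s' t' r' where 2: "(s', t', r') \<in> ref_tet" "y = tet_map d a b c (s', t', r')" using y by auto
    let ?p = "(u * s + v * s', u * t + v * t', u * r + v * r')"
    have v: "v = 1 - u" using uv by simp
    have "u * (s + t + r) + v * (s' + t' + r') \<le> u * 1 + v * 1"
      using 1 2 uv by (intro add_mono mult_left_mono) (auto simp: ref_tet_def)
    then have "?p \<in> ref_tet"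
      using 1 2 uv by (auto simp: ref_tet_def algebra_simps)
    moreover have "u *\<^sub>R x + v *\<^sub>R y = tet_map d a b c ?p"
      by (simp add: 1 2 v tet_map_def algebra_simps)
    ultimately show "u *\<^sub>R x + v *\<^sub>R y \<in> tet_map d a b c ` ref_tet" by blast
  qed
  moreover have "{a, b, c, d} \<subseteq> tet_map d a b c ` ref_tet"
  proof -
    have "a = tet_map d a b c (1, 0, 0)" "b = tet_map d a b c (0, 1, 0)"
      "c = tet_map d a b c (0, 0, 1)" "d = tet_map d a b c (0, 0, 0)"
      by (simp_all add: tet_map_def)
    moreover have "(1, 0, 0) \<in> ref_tet" "(0, 1, 0) \<in> ref_tet" "(0, 0, 1) \<in> ref_tet" "(0, 0, 0) \<in> ref_tet"
      by (simp_all add: ref_tet_def)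
    ultimately show ?thesis by blast
  qed
  ultimately show "convex hull {a, b, c, d} \<subseteq> tet_map d a b c ` ref_tet"
    by (simp add: hull_minimal)
qed

text \<open>Cramer's rule.\<close>

lemma cramer3:
  fixes A B C v :: "real^3"
  shows "(A \<bullet> cross3 B C) *\<^sub>R v
    = (v \<bullet> cross3 B C) *\<^sub>R A + (A \<bullet> cross3 v C) *\<^sub>R B + (A \<bullet> cross3 B v) *\<^sub>R C"
  unfolding vec_eq_iff forall_3 inner_vec_def sum_3 cross_components vector_add_component
    vector_scaleR_component inner_real_def real_scaleR_def
  by (intro conjI; algebra)

lemma tet_edges_span:
  assumes "tet_det p q r s \<noteq> 0"
  shows "\<exists>a b c. v = a *\<^sub>R (q - p) + b *\<^sub>R (r - p) + c *\<^sub>R (s - p)"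
proof (intro exI)
  let ?D = "tet_det p q r s"
  have "v = (1 / ?D) *\<^sub>R (?D *\<^sub>R v)" using assms by simp
  also have "?D *\<^sub>R v = (v \<bullet> cross3 (r - p) (s - p)) *\<^sub>R (q - p) + ((q - p) \<bullet> cross3 v (s - p)) *\<^sub>R (r - p)
        + ((q - p) \<bullet> cross3 (r - p) v) *\<^sub>R (s - p)"
    unfolding tet_det_def by (rule cramer3)
  finally show "v = (1 / ?D * (v \<bullet> cross3 (r - p) (s - p))) *\<^sub>R (q - p)
        + (1 / ?D * ((q - p) \<bullet> cross3 v (s - p))) *\<^sub>R (r - p) + (1 / ?D * ((q - p) \<bullet> cross3 (r - p) v)) *\<^sub>R (s - p)"
    by (simp only: scaleR_right_distrib scaleR_scaleR)
qed

lemma inj_tet_map: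
  assumes D: "tet_det d a b c \<noteq> 0"
  shows "inj (tet_map d a b c)"
proof (rule injI)
  fix p q :: "real \<times> real \<times> real"
  assume eq: "tet_map d a b c p = tet_map d a b c q"
  obtain s t r s' t' r' where p: "p = (s, t, r)" and q: "q = (s', t', r')"
    by (cases p, cases q)
  define A B C where "A = a - d" and "B = b - d" and "C = c - d"
  have 0: "(s - s') *\<^sub>R A + (t - t') *\<^sub>R B + (r - r') *\<^sub>R C = 0"
    using eq unfolding p q tet_map_def A_def B_def C_def by (simp add: algebra_simps)
  have "((s - s') *\<^sub>R A + (t - t') *\<^sub>R B + (r - r') *\<^sub>R C) \<bullet> cross3 B C = (s - s') * (A \<bullet> cross3 B C)"
    "A \<bullet> cross3 ((s - s') *\<^sub>R A + (t - t') *\<^sub>R B + (r - r') *\<^sub>R C) C = (t - t') * (A \<bullet> cross3 B C)"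
    "A \<bullet> cross3 B ((s - s') *\<^sub>R A + (t - t') *\<^sub>R B + (r - r') *\<^sub>R C) = (r - r') * (A \<bullet> cross3 B C)"
    by (simp_all add: inner_add_left inner_add_right cross_add_left cross_add_right cross_mult_left
        cross_mult_right dot_cross_self)
  then have "(s - s') * (A \<bullet> cross3 B C) = 0" "(t - t') * (A \<bullet> cross3 B C) = 0" "(r - r') * (A \<bullet> cross3 B C) = 0"
    unfolding 0 by simp_all
  then show "p = q"
    using D unfolding p q tet_det_def A_def B_def C_def by auto
qed

lemma compact_ref_tet: "compact ref_tet"
proof -
  have eq: "ref_tet = {p. 0 \<le> fst p} \<inter> {p. 0 \<le> fst (snd p)} \<inter> {p. 0 \<le> snd (snd p)}
      \<inter> {p. fst p + fst (snd p) + snd (snd p) \<le> 1}"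
    by (auto simp: ref_tet_def)
  have "closed ref_tet"
    unfolding eq by (intro closed_Int closed_Collect_le continuous_intros)
  moreover have "ref_tet \<subseteq> cbox (0, 0, 0) (1, 1, 1)"
    by (auto simp: ref_tet_def cbox_Pair_eq)
  ultimately show ?thesis
    by (meson bounded_cbox bounded_subset compact_eq_bounded_closed)
qed

subsection \<open>Integration of a derivative along an edge\<close>

text \<open>Integrating over the reference tetrahedron first in the direction of the edge from \<open>d\<close> to
  \<open>a\<close> leaves the difference of the integrals over the two facets that the edge connects.\<close>

lemma LINT_edge_derivative:
  fixes f :: "real^3 \<Rightarrow> real"
  assumes D: "tet_det d a b c \<noteq> 0"
    and f: "\<And>x. (f has_derivative f' x) (at x)" and cont: "continuous_on UNIV (\<lambda>x. f' x (a - d))"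
  shows "(LINT x|lborel. indicator (convex hull {a, b, c, d}) x * f' x (a - d))
    = \<bar>tet_det d a b c\<bar> * (tri_integral a b c f - tri_integral d b c f)"
proof -
  let ?T = "convex hull {a, b, c, d}" and ?L = "tet_map d a b c"
  let ?h = "\<lambda>s q. indicator ref_tet (s, q) * f' (?L (s, q)) (a - d)"
  have fc: "continuous_on S f" for S
    by (meson continuous_at_imp_continuous_on f has_derivative_continuous)
  have [measurable]: "?T \<in> sets borel"
    using borel_compact[OF compact_convex_hull[OF finite_imp_compact[of "{a, b, c, d}"]]] by simp
  have [measurable]: "(\<lambda>x. f' x (a - d)) \<in> borel_measurable borel"
    by (rule borel_measurable_continuous_onI[OF cont])
  have Lc: "continuous_on S ?L" for S
    unfolding tet_map_def case_prod_unfold by (intro continuous_intros)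
  have ind: "indicator ?T (?L p) = (indicator ref_tet p :: real)" for p
    using inj_image_mem_iff[OF inj_tet_map[OF D], of p ref_tet] by (simp add: indicator_def tet_map_image)
  have "(LINT x|lborel. indicator ?T x * f' x (a - d))
      = \<bar>tet_det d a b c\<bar> * (LINT p|lborel. indicator ?T (?L p) * f' (?L p) (a - d))"
    by (rule LINT_tet_map[OF D]) measurable
  also have "(LINT p|lborel. indicator ?T (?L p) * f' (?L p) (a - d))
      = (LINT p|lborel. indicator ref_tet p * f' (?L p) (a - d))"
    unfolding ind ..
  also have "\<dots> = (LINT q|lborel. LINT s|lborel. ?h s q)"
  proof -
    have "integrable lborel (\<lambda>p. indicator ref_tet p *\<^sub>R f' (?L p) (a - d))"
      by (intro borel_integrable_compact compact_ref_tet continuous_on_compose2[OF cont Lc]) auto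
    then show ?thesis
      using lborel_pair.integral_snd[of ?h] by (simp add: lborel_prod case_prod_unfold)
  qed
  also have "\<dots> = (LINT q|lborel. indicator ref_triangle q * f (tri_map a b c q)
      - indicator ref_triangle q * f (tri_map d b c q))"
  proof (rule Bochner_Integration.integral_cong[OF refl])
    fix q :: "real \<times> real"
    obtain t r where q: "q = (t, r)" by (cases q)
    show "(LINT s|lborel. ?h s q) = indicator ref_triangle q * f (tri_map a b c q)
      - indicator ref_triangle q * f (tri_map d b c q)"
    proof (cases "q \<in> ref_triangle")
      case False
      then have "(s, q) \<notin> ref_tet" for s
        by (auto simp: q ref_tet_def ref_triangle_def)
      then show ?thesis using False by simp
    next
      case True
      have eq: "?h s q = f' (?L (s, q)) (a - d) * indicator {0..1 - t - r} s" for s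
        using True by (auto simp: q ref_tet_def ref_triangle_def indicator_def)
      have d: "((\<lambda>s. f (?L (s, q))) has_real_derivative f' (?L (s, q)) (a - d)) (at s)" for s
      proof -
        have "((\<lambda>s. ?L (s, q)) has_derivative (\<lambda>h. h *\<^sub>R (a - d))) (at s)"
          unfolding tet_map_def q prod.case by (auto intro!: derivative_eq_intros)
        from has_derivative_compose[OF this f]
        have "((\<lambda>s. f (?L (s, q))) has_derivative (\<lambda>h. f' (?L (s, q)) (h *\<^sub>R (a - d)))) (at s)" .
        also have "(\<lambda>h. f' (?L (s, q)) (h *\<^sub>R (a - d))) = (\<lambda>h. f' (?L (s, q)) (a - d) * h)"
          using has_derivative_linear[OF f] by (simp add: linear_scale mult.commute)
        finally show ?thesis by (simp add: has_field_derivative_def)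
      qed
      have "(LINT s|lborel. ?h s q) = f (?L (1 - t - r, q)) - f (?L (0, q))"
        unfolding eq
      proof (rule integral_FTC_Icc_real[where F = "\<lambda>s. f (?L (s, q))"])
        show "0 \<le> 1 - t - r" using True by (simp add: q ref_triangle_def)
        show "((\<lambda>s. f (?L (s, q))) has_real_derivative f' (?L (s, q)) (a - d)) (at s)" for s by (rule d)
        have "continuous_on UNIV (\<lambda>s. f' (?L (s, q)) (a - d))"
          by (rule continuous_on_compose2[OF cont continuous_on_compose2[OF Lc[of UNIV]]])
            (auto intro!: continuous_intros)
        then show "isCont (\<lambda>s. f' (?L (s, q)) (a - d)) s" for s
          by (simp add: continuous_on_eq_continuous_at)
      qed
      moreover have "?L (1 - t - r, q) = tri_map a b c q" "?L (0, q) = tri_map d b c q"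
        by (simp_all add: q tet_map_def tri_map_def algebra_simps)
      ultimately show ?thesis using True by simp
    qed
  qed
  also have "\<dots> = tri_integral a b c f - tri_integral d b c f"
    unfolding tri_integral_def by (rule Bochner_Integration.integral_diff) (rule tri_integrable[OF fc])+
  finally show ?thesis .
qed

subsection \<open>Facets and outward normals\<close>

definition tet :: "real^3 \<Rightarrow> real^3 \<Rightarrow> real^3 \<Rightarrow> real^3 \<Rightarrow> bool" where
  "tet a b c d \<longleftrightarrow> \<not> affine_dependent {a, b, c, d} \<and> card {a, b, c, d} = 4"

lemma tet_distinct:
  assumes "tet a b c d" shows "a \<noteq> b" "a \<noteq> c" "a \<noteq> d" "b \<noteq> c" "b \<noteq> d" "c \<noteq> d"
  using assms unfolding tet_def by (auto simp: card_insert_if split: if_splits)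

lemma simplex_tetE:
  assumes "3 simplex T"
  obtains a b c d where "T = convex hull {a, b, c, d}" "tet a b c d"
proof -
  obtain C where C: "\<not> affine_dependent C" "int (card C) = 3 + 1" "T = convex hull C"
    using assms unfolding simplex_def by blast
  then have "card C = Suc (Suc (Suc (Suc 0)))" by simp
  then obtain a b c d where "C = {a, b, c, d}" by (auto simp: card_Suc_eq)
  then show thesis using C that[of a b c d] by (simp add: tet_def)
qed

lemma tet_det_nonzero:
  assumes "tet a b c d" shows "tet_det d a b c \<noteq> 0"
proof
  define A B C where "A = a - d" and "B = b - d" and "C = c - d"
  assume "tet_det d a b c = 0"
  then have D: "A \<bullet> cross3 B C = 0" by (simp add: tet_det_def A_def B_def C_def)
  have "d \<notin> {a, b, c}" using tet_distinct[OF assms] by auto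
  then have "affine_dependent (insert d {a, b, c}) \<longleftrightarrow> dependent ((\<lambda>x. - d + x) ` {a, b, c})"
    by (rule affine_dependent_iff_dependent)
  moreover have "insert d {a, b, c} = {a, b, c, d}" by auto
  moreover have "(\<lambda>x. - d + x) ` {a, b, c} = {A, B, C}"
    by (auto simp: A_def B_def C_def)
  ultimately have ind: "independent {A, B, C}"
    using assms by (simp add: tet_def)
  have ne: "A \<noteq> B" "A \<noteq> C" "B \<noteq> C" using tet_distinct[OF assms] by (auto simp: A_def B_def C_def)
  have "UNIV \<subseteq> span {A, B, C}"
    by (rule card_ge_dim_independent[OF _ ind]) (use ne in \<open>auto simp: card_insert_if\<close>)
  then have "cross3 B C \<in> span {A, B, C}" by blast
  then have "orthogonal (cross3 B C) (cross3 B C)"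
  proof (rule orthogonal_to_span)
    fix y assume "y \<in> {A, B, C}"
    then show "orthogonal (cross3 B C) y"
      using D by (auto simp: orthogonal_def inner_commute[of "cross3 B C"] dot_cross_self)
  qed
  then have "collinear {0, B, C}" by (simp add: orthogonal_self cross_eq_0)
  then consider "B = 0" | "C = 0" | e where "C = e *\<^sub>R B" unfolding collinear_lemma by blast
  then show False
  proof cases
    case 3
    have "B \<in> {A, B, C} - {C}" using ne by simp
    then have "C \<in> span ({A, B, C} - {C})"
      unfolding 3 by (rule span_scale[OF span_base])
    then show False using ind unfolding dependent_def by blast
  qed (use ind in \<open>auto simp: dependent_zero\<close>)
qed

lemma tet_area_nonzero:
  assumes "tet a b c d" shows "tri_area2 b c d \<noteq> 0"
proof
  assume "tri_area2 b c d = 0"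
  then have "cross3 (c - b) (d - b) = 0" by (simp add: tri_area2_def)
  then have "tet_det b a c d = 0" by (simp add: tet_det_def)
  moreover have "tet_det b a c d \<noteq> 0"
    using tet_det_nonzero[of a c d b] assms by (simp add: tet_def insert_commute)
  ultimately show False by simp
qed

lemma tet_det_perm:
  "\<bar>tet_det d b a c\<bar> = \<bar>tet_det d a b c\<bar>" "\<bar>tet_det d a c b\<bar> = \<bar>tet_det d a b c\<bar>"
  "\<bar>tet_det a d b c\<bar> = \<bar>tet_det d a b c\<bar>"
proof -
  have "tet_det d b a c = - tet_det d a b c" "tet_det d a c b = - tet_det d a b c"
    "tet_det a d b c = - tet_det d a b c"
    unfolding tet_det_def inner_vec_def sum_3 cross_components vector_minus_component inner_real_def
    by algebra+
  then show "\<bar>tet_det d b a c\<bar> = \<bar>tet_det d a b c\<bar>" "\<bar>tet_det d a c b\<bar> = \<bar>tet_det d a b c\<bar>"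
    "\<bar>tet_det a d b c\<bar> = \<bar>tet_det d a b c\<bar>" by simp_all
qed

lemma facets_tet:
  assumes "tet a b c d"
  shows "facets (convex hull {a, b, c, d})
      = {convex hull {b, c, d}, convex hull {a, c, d}, convex hull {a, b, d}, convex hull {a, b, c}}"
proof -
  have S: "\<not> affine_dependent {a, b, c, d}" "card {a, b, c, d} = 4" using assms by (auto simp: tet_def)
  have "facets (convex hull {a, b, c, d}) = (\<lambda>u. convex hull ({a, b, c, d} - {u})) ` {a, b, c, d}"
    unfolding facets_def facet_of_convex_hull_affine_independent_alt[OF S(1)] S(2) by auto
  moreover have "{a, b, c, d} - {a} = {b, c, d}" "{a, b, c, d} - {b} = {a, c, d}"
    "{a, b, c, d} - {c} = {a, b, d}" "{a, b, c, d} - {d} = {a, b, c}"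
    using tet_distinct[OF assms] by auto
  ultimately show ?thesis by simp
qed

lemma facet_eq_iff:
  assumes "tet a b c d" shows "convex hull {b, c, d} \<noteq> convex hull {a, c, d}"
proof
  assume "convex hull {b, c, d} = convex hull {a, c, d}"
  then have "{b, c, d} = {a, c, d}"
    using convex_hull_3_eq_imp[OF tet_area_nonzero[OF assms]] by blast
  then show False using tet_distinct[OF assms] by (auto simp: set_eq_iff)
qed

lemma sum_facets_tet:
  assumes t: "tet a b c d"
  shows "(\<Sum>F\<in>facets (convex hull {a, b, c, d}). \<phi> F)
    = \<phi> (convex hull {b, c, d}) + \<phi> (convex hull {a, c, d}) + \<phi> (convex hull {a, b, d}) + \<phi> (convex hull {a, b, c})"
proof -
  have 1: "convex hull {b, c, d} \<noteq> convex hull {a, c, d}" by (rule facet_eq_iff[OF t])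
  have 2: "convex hull {b, c, d} \<noteq> convex hull {a, b, d}"
    using facet_eq_iff[of a c b d] t by (simp add: tet_def insert_commute)
  have 3: "convex hull {b, c, d} \<noteq> convex hull {a, b, c}"
    using facet_eq_iff[of a d b c] t by (simp add: tet_def insert_commute)
  have 4: "convex hull {a, c, d} \<noteq> convex hull {a, b, d}"
    using facet_eq_iff[of b c a d] t by (simp add: tet_def insert_commute)
  have 5: "convex hull {a, c, d} \<noteq> convex hull {a, b, c}"
    using facet_eq_iff[of b d a c] t by (simp add: tet_def insert_commute)
  have 6: "convex hull {a, b, d} \<noteq> convex hull {a, b, c}"
    using facet_eq_iff[of c d a b] t by (simp add: tet_def insert_commute)
  show ?thesis unfolding facets_tet[OF t] using 1 2 3 4 5 6 by (simp add: add.assoc)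
qed

lemma tet_facetE:
  assumes "3 simplex T" "F \<in> facets T"
  obtains p q r s where "T = convex hull {p, q, r, s}" "F = convex hull {q, r, s}" "tet p q r s"
proof -
  obtain a b c d where T: "T = convex hull {a, b, c, d}" and t: "tet a b c d"
    using simplex_tetE[OF assms(1)] by blast
  have F: "F = convex hull {b, c, d} \<or> F = convex hull {a, c, d} \<or> F = convex hull {a, b, d} \<or> F = convex hull {a, b, c}"
    using assms(2) facets_tet[OF t] unfolding T by blast
  have perm: "T = convex hull {b, a, c, d}" "T = convex hull {c, a, b, d}" "T = convex hull {d, a, b, c}"
    "tet b a c d" "tet c a b d" "tet d a b c"
    using T t by (simp_all add: tet_def insert_commute)
  from F show thesis
    by (elim disjE) (rule that[OF T _ t] that[OF perm(1) _ perm(4)] that[OF perm(2) _ perm(5)]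
        that[OF perm(3) _ perm(6)], assumption)+
qed

text \<open>For the facet opposite to the vertex \<open>p\<close> the outward normal is the cross product of two edges,
  normalized and oriented away from \<open>p\<close>.\<close>

lemma outward_normal_tet:
  assumes t: "tet p q r s"
  shows "outward_normal (convex hull {p, q, r, s}) (convex hull {q, r, s})
    = - (sgn (tet_det q p r s) / tri_area2 q r s) *\<^sub>R cross3 (r - q) (s - q)"
proof -
  let ?T = "convex hull {p, q, r, s}" and ?F = "convex hull {q, r, s}"
  let ?X = "cross3 (r - q) (s - q)" and ?D = "tet_det q p r s"
  define n where "n = - (sgn ?D / tri_area2 q r s) *\<^sub>R ?X"
  have D: "?D \<noteq> 0" using tet_det_nonzero[of p r s q] t by (simp add: tet_def insert_commute)
  have X: "norm ?X = tri_area2 q r s" "tri_area2 q r s > 0"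
    using tet_area_nonzero[OF t] by (simp_all add: tri_area2_def)
  have nr: "n \<bullet> (r - q) = 0" "n \<bullet> (s - q) = 0"
    by (simp_all add: n_def dot_cross_self)
  have "n \<bullet> (p - q) = - (sgn ?D / tri_area2 q r s) * ?D"
    unfolding n_def tet_det_def by (simp add: inner_commute)
  also have "\<dots> = - (\<bar>?D\<bar> / tri_area2 q r s)"
    by (simp add: abs_sgn mult.commute)
  finally have np: "n \<bullet> (p - q) \<le> 0"
    using X(2) by simp
  have n1: "norm n = 1"
    using X D by (simp add: n_def abs_sgn_eq)
  have "?F \<subseteq> {x. n \<bullet> x = n \<bullet> q}"
    using nr by (intro hull_minimal convex_hyperplane) (auto simp: inner_diff_right)
  moreover have "?T \<subseteq> {y. n \<bullet> y \<le> n \<bullet> q}"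
    using nr np by (intro hull_minimal convex_halfspace_le) (auto simp: inner_diff_right)
  ultimately have n2: "\<forall>x\<in>?F. \<forall>y\<in>?T. n \<bullet> (y - x) \<le> 0"
  proof (intro ballI)
    fix x y assume "x \<in> ?F" "y \<in> ?T"
    then have "n \<bullet> x = n \<bullet> q" "n \<bullet> y \<le> n \<bullet> q"
      using \<open>?F \<subseteq> _\<close> \<open>?T \<subseteq> _\<close> by blast+
    then show "n \<bullet> (y - x) \<le> 0" by (simp add: inner_diff_right)
  qed
  have "n' = n" if n': "norm n' = 1 \<and> (\<forall>x\<in>?F. \<forall>y\<in>?T. n' \<bullet> (y - x) \<le> 0)" for n'
  proof -
    have mem: "q \<in> ?F" "r \<in> ?F" "s \<in> ?F" "p \<in> ?T" "q \<in> ?T" "r \<in> ?T" "s \<in> ?T" by (auto intro: hull_inc)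
    have le: "n' \<bullet> (y - x) \<le> 0" if "x \<in> ?F" "y \<in> ?T" for x y using n' that by blast
    have 0: "n' \<bullet> (r - q) = 0" "n' \<bullet> (s - q) = 0" "n' \<bullet> (p - q) \<le> 0"
      using le[of q r] le[of r q] le[of q s] le[of s q] le[of q p] mem by (auto simp: inner_diff_right)
    have "cross3 n' ?X = 0" unfolding Lagrange using 0 by simp
    then have "cross3 ?X n' = 0" using cross_skew[of ?X n'] by simp
    then have "collinear {0, ?X, n'}" by (simp only: cross_eq_0)
    moreover have "?X \<noteq> 0" "n' \<noteq> 0" using X n' by auto
    ultimately obtain c where c: "n' = c *\<^sub>R ?X" unfolding collinear_lemma by blast
    have "\<bar>c\<bar> * tri_area2 q r s = 1" using n' X by (simp add: c)
    then have c1: "\<bar>c\<bar> = 1 / tri_area2 q r s" using X by (simp add: field_simps)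
    have cD: "c * ?D \<le> 0" using 0(3) by (simp add: c tet_det_def inner_commute)
    have "c = - (sgn ?D / tri_area2 q r s)"
    proof (cases "?D > 0")
      case True
      then have "c \<le> 0" using cD by (simp add: mult_le_0_iff)
      then show ?thesis using c1 True by simp
    next
      case False
      then have "?D < 0" using D by simp
      then have "c \<ge> 0" using cD by (simp add: mult_le_0_iff)
      then show ?thesis using c1 \<open>?D < 0\<close> by simp
    qed
    then show ?thesis by (simp add: c n_def)
  qed
  then have "outward_normal ?T ?F = n"
    unfolding outward_normal_def by (rule the_equality[rotated]) (use n1 n2 in auto)
  then show ?thesis by (simp add: n_def)
qed

lemma outward_normal_props:
  assumes t: "tet p q r s"
  defines "n \<equiv> outward_normal (convex hull {p, q, r, s}) (convex hull {q, r, s})"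
  shows "norm n = 1" "n \<bullet> (r - q) = 0" "n \<bullet> (s - q) = 0"
    "tri_area2 q r s * (n \<bullet> (q - p)) = \<bar>tet_det q p r s\<bar>"
proof -
  let ?X = "cross3 (r - q) (s - q)" and ?D = "tet_det q p r s"
  have D: "?D \<noteq> 0" using tet_det_nonzero[of p r s q] t by (simp add: tet_def insert_commute)
  have X: "norm ?X = tri_area2 q r s" "tri_area2 q r s > 0"
    using tet_area_nonzero[OF t] by (simp_all add: tri_area2_def)
  have n: "n = - (sgn ?D / tri_area2 q r s) *\<^sub>R ?X"
    unfolding n_def by (rule outward_normal_tet[OF t])
  show "norm n = 1" using X D by (simp add: n abs_sgn_eq)
  show "n \<bullet> (r - q) = 0" "n \<bullet> (s - q) = 0" by (simp_all add: n dot_cross_self)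
  have "?X \<bullet> (q - p) = - ?D" by (simp add: tet_det_def inner_diff_left inner_diff_right inner_commute)
  then have "n \<bullet> (q - p) = sgn ?D * ?D / tri_area2 q r s" by (simp add: n)
  then show "tri_area2 q r s * (n \<bullet> (q - p)) = \<bar>?D\<bar>"
    using X(2) abs_sgn[of ?D] by simp
qed

subsection \<open>The divergence theorem\<close>

text \<open>The flux through the boundary of the field with values \<open>f x *\<^sub>R v\<close>.\<close>

definition facet_flux :: "(real^3) set \<Rightarrow> (real^3 \<Rightarrow> real) \<Rightarrow> real^3 \<Rightarrow> real" where
  "facet_flux T f v = (\<Sum>F\<in>facets T. (outward_normal T F \<bullet> v) * (LINT x|surface_measure F. f x))"

text \<open>Two facets contain the edge and have normals orthogonal to it. For each of the other two, twice the
  area times the normal component of the edge is the determinant up to the sign. The outcome is the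
  right-hand side of \<open>LINT_edge_derivative\<close>.\<close>

lemma facet_flux_edge:
  assumes t: "tet a b c d" and f: "continuous_on UNIV f"
  shows "facet_flux (convex hull {a, b, c, d}) f (a - d)
    = \<bar>tet_det d a b c\<bar> * (tri_integral a b c f - tri_integral d b c f)"
proof -
  let ?T = "convex hull {a, b, c, d}"
  have td: "tet d a b c" "tet b a d c" "tet c a d b" "tet a d b c"
    using t by (simp_all add: tet_def insert_commute)
  have T: "convex hull {d, a, b, c} = ?T" "convex hull {b, a, d, c} = ?T" "convex hull {c, a, d, b} = ?T"
    "convex hull {a, d, b, c} = ?T"
    by (simp_all add: insert_commute)
  have F: "convex hull {b, c, d} = convex hull {d, b, c}" "convex hull {a, c, d} = convex hull {a, d, c}"
    "convex hull {a, b, d} = convex hull {a, d, b}"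
    by (simp_all add: insert_commute)
  note pd = outward_normal_props[OF td(1), unfolded T] and pb = outward_normal_props[OF td(2), unfolded T]
    and pc = outward_normal_props[OF td(3), unfolded T] and pa = outward_normal_props[OF td(4), unfolded T]
  have L: "(LINT x|surface_measure (convex hull {a, b, c}). f x) = tri_area2 a b c * tri_integral a b c f"
    "(LINT x|surface_measure (convex hull {d, b, c}). f x) = tri_area2 d b c * tri_integral d b c f"
    by (rule LINT_surface_measure[OF refl tet_area_nonzero f], rule td)+
  have zero: "outward_normal ?T (convex hull {a, d, c}) \<bullet> (a - d) = 0"
    "outward_normal ?T (convex hull {a, d, b}) \<bullet> (a - d) = 0"
    using pb(2) pc(2) by (simp_all add: inner_diff_right)
  have "outward_normal ?T (convex hull {a, b, c}) \<bullet> (a - d) * (tri_area2 a b c * x)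
      = (tri_area2 a b c * (outward_normal ?T (convex hull {a, b, c}) \<bullet> (a - d))) * x" for x
    by simp
  also have "tri_area2 a b c * (outward_normal ?T (convex hull {a, b, c}) \<bullet> (a - d)) * x = \<bar>tet_det d a b c\<bar> * x" for x
    unfolding pd(4) tet_det_perm(3) ..
  finally have 1: "outward_normal ?T (convex hull {a, b, c}) \<bullet> (a - d) * (tri_area2 a b c * x)
      = \<bar>tet_det d a b c\<bar> * x" for x .
  have "outward_normal ?T (convex hull {d, b, c}) \<bullet> (a - d) * (tri_area2 d b c * x)
      = - (tri_area2 d b c * (outward_normal ?T (convex hull {d, b, c}) \<bullet> (d - a))) * x" for x
    unfolding inner_diff_right by algebra
  also have "- (tri_area2 d b c * (outward_normal ?T (convex hull {d, b, c}) \<bullet> (d - a))) * x = - \<bar>tet_det d a b c\<bar> * x" for x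
    unfolding pa(4) ..
  finally have 2: "outward_normal ?T (convex hull {d, b, c}) \<bullet> (a - d) * (tri_area2 d b c * x)
      = - \<bar>tet_det d a b c\<bar> * x" for x .
  show ?thesis
    unfolding facet_flux_def sum_facets_tet[OF t] F L zero 1 2 by (simp add: right_diff_distrib)
qed

text \<open>The edges at one vertex span the space, so the case of an edge suffices.\<close>

theorem divergence_tetrahedron:
  fixes f :: "real^3 \<Rightarrow> real"
  assumes T: "3 simplex T" and f: "\<And>x. (f has_derivative f' x) (at x)"
    and cont: "\<And>v. continuous_on UNIV (\<lambda>x. f' x v)"
  shows "(LINT x:T|lebesgue. f' x v) = facet_flux T f v"
proof -
  obtain a b c d where Td: "T = convex hull {a, b, c, d}" and t: "tet a b c d"
    using simplex_tetE[OF T] by blast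
  have fc: "continuous_on UNIV f"
    by (meson continuous_at_imp_continuous_on f has_derivative_continuous)
  have TB: "T \<in> sets borel" using T by (simp add: borel_compact compact_simplex)
  define I where "I v = (LINT x|lborel. indicator T x * f' x v)" for v
  have int: "integrable lborel (\<lambda>x. indicator T x * f' x v)" for v
    using borel_integrable_compact[OF compact_simplex[OF T] continuous_on_subset[OF cont[of v]]] by simp
  have Ilin: "I (x *\<^sub>R u + y *\<^sub>R v + z *\<^sub>R w) = x * I u + y * I v + z * I w" for x y z u v w
  proof -
    have "indicator T p * f' p (x *\<^sub>R u + y *\<^sub>R v + z *\<^sub>R w)
        = x * (indicator T p * f' p u) + y * (indicator T p * f' p v) + z * (indicator T p * f' p w)" for p
      using has_derivative_linear[OF f[of p]] by (simp add: linear_add linear_scale algebra_simps)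
    then show ?thesis unfolding I_def by (simp add: int)
  qed
  have edge: "I (a' - d) = facet_flux T f (a' - d)" if "T = convex hull {a', b', c', d}" "tet a' b' c' d" for a' b' c'
    unfolding I_def that(1) LINT_edge_derivative[OF tet_det_nonzero[OF that(2)] f cont] facet_flux_edge[OF that(2) fc] ..
  have "T = convex hull {b, a, c, d}" "tet b a c d" "T = convex hull {c, a, b, d}" "tet c a b d"
    using Td t by (simp_all add: tet_def insert_commute)
  then have e: "I (a - d) = facet_flux T f (a - d)" "I (b - d) = facet_flux T f (b - d)"
    "I (c - d) = facet_flux T f (c - d)"
    using edge Td t by blast+
  have flin: "facet_flux T f (x *\<^sub>R u + y *\<^sub>R v + z *\<^sub>R w)
      = x * facet_flux T f u + y * facet_flux T f v + z * facet_flux T f w" for x y z u v w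
    unfolding facet_flux_def by (simp add: inner_add_right sum_distrib_left sum.distrib algebra_simps)
  obtain x y z where v: "v = x *\<^sub>R (a - d) + y *\<^sub>R (b - d) + z *\<^sub>R (c - d)"
    using tet_edges_span[OF tet_det_nonzero[OF t]] by blast
  have "I v = facet_flux T f v" unfolding v Ilin flin e ..
  moreover have "(LINT x:T|lebesgue. f' x v) = I v"
    unfolding set_lebesgue_integral_def I_def
    using integral_completion[of "\<lambda>x. indicator T x * f' x v" lborel] int by (simp add: borel_measurable_integrable)
  ultimately show ?thesis by simp
qed

section \<open>Geometry of the mesh\<close>

lemma facet_subset_face:
  fixes T :: "(real^3) set"
  assumes F: "F facet_of T" and G: "G face_of T" "F \<subseteq> G" and T: "convex T"
  shows "F = G \<or> G = T"
proof (rule ccontr)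
  assume ne: "\<not> (F = G \<or> G = T)"
  have "F face_of G"
    using F G by (meson face_of_imp_subset face_of_subset facet_of_imp_face_of)
  then have "aff_dim F < aff_dim G"
    using ne face_of_aff_dim_lt face_of_imp_convex[OF G(1)] by blast
  moreover have "aff_dim G < aff_dim T"
    using ne face_of_aff_dim_lt[OF T G(1)] by blast
  ultimately show False using F by (simp add: facet_of_def)
qed

lemma facet_of_normal:
  assumes "3 simplex T" "F \<in> facets T"
  shows "norm (outward_normal T F) = 1"
    and "x \<in> F \<Longrightarrow> y \<in> F \<Longrightarrow> outward_normal T F \<bullet> x = outward_normal T F \<bullet> y"
    and "x \<in> F \<Longrightarrow> y \<in> T \<Longrightarrow> outward_normal T F \<bullet> y \<le> outward_normal T F \<bullet> x"
proof -
  obtain p q r s where T: "T = convex hull {p, q, r, s}" and F: "F = convex hull {q, r, s}" and t: "tet p q r s"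
    using tet_facetE[OF assms] by blast
  let ?n = "outward_normal T F"
  note n = outward_normal_props[OF t, folded F, folded T]
  show "norm ?n = 1" by (rule n(1))
  have "0 \<le> tri_area2 q r s * (?n \<bullet> (q - p))" using n(4) by simp
  moreover have "tri_area2 q r s > 0" using tet_area_nonzero[OF t] by (simp add: tri_area2_def)
  ultimately have "0 \<le> ?n \<bullet> (q - p)" by (simp add: zero_le_mult_iff)
  then have "T \<subseteq> {y. ?n \<bullet> y \<le> ?n \<bullet> q}"
    unfolding T using n(2,3) by (intro hull_minimal convex_halfspace_le) (auto simp: inner_diff_right T)
  moreover have eq: "F \<subseteq> {x. ?n \<bullet> x = ?n \<bullet> q}"
    using n(2,3) by (subst F, intro hull_minimal convex_hyperplane) (auto simp: inner_diff_right)
  ultimately show "x \<in> F \<Longrightarrow> y \<in> F \<Longrightarrow> ?n \<bullet> x = ?n \<bullet> y"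
    "x \<in> F \<Longrightarrow> y \<in> T \<Longrightarrow> ?n \<bullet> y \<le> ?n \<bullet> x"
    by (blast intro: trans sym, metis (mono_tags) mem_Collect_eq subsetD)
qed

lemma tet_facet_vertices:
  assumes T: "3 simplex T" "F \<in> facets T" and F: "F = convex hull {q, r, s}" "tri_area2 q r s \<noteq> 0"
  obtains p where "T = convex hull {p, q, r, s}" "tet p q r s"
proof -
  obtain p q' r' s' where T': "T = convex hull {p, q', r', s'}" "F = convex hull {q', r', s'}" "tet p q' r' s'"
    using tet_facetE[OF T] by blast
  have "{q, r, s} = {q', r', s'}"
    using convex_hull_3_eq_imp[OF F(2)] F(1) T'(2) by simp
  then have "{p, q', r', s'} = {p, q, r, s}" by simp
  then show thesis using T' that[of p] by (simp add: tet_def)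
qed

text \<open>Both normals are multiples of the cross product of the same two edges.\<close>

lemma common_facet_normals:
  assumes T: "3 simplex T" "F \<in> facets T" and T': "3 simplex T'" "F \<in> facets T'"
  shows "outward_normal T' F = outward_normal T F \<or> outward_normal T' F = - outward_normal T F"
proof -
  obtain p q r s where 1: "T = convex hull {p, q, r, s}" and F: "F = convex hull {q, r, s}" and t: "tet p q r s"
    using tet_facetE[OF T] by blast
  obtain p' where 2: "T' = convex hull {p', q, r, s}" and t': "tet p' q r s"
    using tet_facet_vertices[OF T' F tet_area_nonzero[OF t]] by blast
  have D: "tet_det q p r s \<noteq> 0" "tet_det q p' r s \<noteq> 0"
    using tet_det_nonzero[of p r s q] tet_det_nonzero[of p' r s q] t t' by (simp_all add: tet_def insert_commute)
  then have "sgn (tet_det q p' r s) = sgn (tet_det q p r s) \<or> sgn (tet_det q p' r s) = - sgn (tet_det q p r s)"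
    by (simp add: sgn_if)
  then show ?thesis
    using outward_normal_tet[OF t, folded F, folded 1] outward_normal_tet[OF t', folded F, folded 2] by auto
qed

lemma tet_inner_point:
  assumes t: "tet p q r s"
  defines "n \<equiv> outward_normal (convex hull {p, q, r, s}) (convex hull {q, r, s})"
  shows "\<exists>e>0. \<forall>t. 0 < t \<and> t \<le> e \<longrightarrow> (1/3) *\<^sub>R (q + r + s) - t *\<^sub>R n \<in> convex hull {p, q, r, s}"
proof -
  have "tet_det p q r s \<noteq> 0" using tet_det_nonzero[of q r s p] t by (simp add: tet_def insert_commute)
  then obtain a b c where n: "- n = a *\<^sub>R (q - p) + b *\<^sub>R (r - p) + c *\<^sub>R (s - p)"
    using tet_edges_span by blast
  note np = outward_normal_props[OF t, folded n_def]
  define k where "k = n \<bullet> (q - p)"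
  have "0 \<le> tri_area2 q r s * k" using np(4) by (simp add: k_def)
  moreover have "tri_area2 q r s > 0" using tet_area_nonzero[OF t] by (simp add: tri_area2_def)
  ultimately have k: "0 \<le> k" by (simp add: zero_le_mult_iff)
  have k2: "n \<bullet> (r - p) = k" "n \<bullet> (s - p) = k" using np(2,3) by (simp_all add: k_def inner_diff_right)
  have "n \<bullet> (-n) = a * k + b * k + c * k"
    unfolding n by (simp add: inner_add_right k2 flip: k_def)
  moreover have "n \<bullet> (-n) = -1" using np(1) by (simp add: norm_eq_1)
  ultimately have "(a + b + c) * k = -1" by (simp add: algebra_simps)
  then have abc: "a + b + c \<le> 0" using k by (metis mult_nonneg_nonneg linear not_one_le_zero neg_0_le_iff_le)
  define e where "e = 1 / (3 * (\<bar>a\<bar> + \<bar>b\<bar> + \<bar>c\<bar> + 1))"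
  have S: "\<bar>a\<bar> + \<bar>b\<bar> + \<bar>c\<bar> + 1 > 0" by linarith
  have e: "e > 0" using S by (simp add: e_def)
  have "(1/3) *\<^sub>R (q + r + s) - t *\<^sub>R n \<in> convex hull {p, q, r, s}" if t: "0 < t" "t \<le> e" for t
  proof -
    have bound: "0 \<le> 1/3 + t * x" if "\<bar>x\<bar> \<le> \<bar>a\<bar> + \<bar>b\<bar> + \<bar>c\<bar> + 1" for x
    proof -
      have "t * \<bar>x\<bar> \<le> e * (\<bar>a\<bar> + \<bar>b\<bar> + \<bar>c\<bar> + 1)"
        using t e that by (intro mult_mono) auto
      also have "\<dots> = 1/3" using S by (simp add: e_def)
      finally have "\<bar>t * x\<bar> \<le> 1/3" using t by (simp add: abs_mult)
      then show ?thesis by linarith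
    qed
    have "t * (a + b + c) \<le> 0" using t abc by (simp add: mult_nonneg_nonpos)
    then have "(1/3 + t * a, 1/3 + t * b, 1/3 + t * c) \<in> ref_tet"
      unfolding ref_tet_def using bound[of a] bound[of b] bound[of c] by (auto simp: algebra_simps)
    then have "tet_map p q r s (1/3 + t * a, 1/3 + t * b, 1/3 + t * c) \<in> convex hull {q, r, s, p}"
      unfolding tet_map_image[symmetric] by (rule imageI)
    also have "tet_map p q r s (1/3 + t * a, 1/3 + t * b, 1/3 + t * c) = (1/3) *\<^sub>R (q + r + s) + t *\<^sub>R (-n)"
      unfolding n tet_map_def prod.case
      by (simp add: vec_eq_iff forall_3 algebra_simps)
    also have "{q, r, s, p} = {p, q, r, s}" by auto
    finally show ?thesis by simp
  qed
  then show ?thesis using e by blast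
qed

locale mesh =
  fixes \<Omega> :: "(real^3) set" and \<T> :: "(real^3) set set"
  assumes domain: "polyhedral_domain \<Omega>"
    and mesh: "tetrahedral_mesh \<Omega> \<T>"
begin

lemma simplices: "T \<in> \<T> \<Longrightarrow> 3 simplex T"
  and finite_mesh: "finite \<T>"
  and Union_mesh: "\<Union>\<T> = closure \<Omega>"
  and face_Int: "T \<in> \<T> \<Longrightarrow> T' \<in> \<T> \<Longrightarrow> T \<inter> T' face_of T"
  using mesh unfolding tetrahedral_mesh_def triangulation_def by auto

lemma face_Int': "T \<in> \<T> \<Longrightarrow> T' \<in> \<T> \<Longrightarrow> T \<inter> T' face_of T'"
  using face_Int[of T' T] by (simp add: Int_commute)

lemma mesh_inclusion_eq:
  assumes "T \<in> \<T>" "T' \<in> \<T>" "T \<subseteq> T'" shows "T = T'"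
proof (rule ccontr)
  assume "T \<noteq> T'"
  moreover have "T face_of T'" using face_Int'[OF assms(1,2)] assms(3) by (simp add: Int_absorb2)
  ultimately have "aff_dim T < aff_dim T'"
    using face_of_aff_dim_lt convex_simplex[OF simplices[OF assms(2)]] by blast
  then show False using aff_dim_simplex[OF simplices] assms by simp
qed

text \<open>By conformity the intersection is a common face. It contains a facet and is not the whole element,
  so it is that facet.\<close>

lemma mesh_Int_facet:
  assumes T: "T \<in> \<T>" "T' \<in> \<T>" "T \<noteq> T'" and F: "F \<in> facets T" "F \<subseteq> T'"
  shows "F = T \<inter> T'" "F \<in> facets T'"
proof -
  have Ff: "F facet_of T" using F by (simp add: facets_def)
  then have "F \<subseteq> T \<inter> T'" using F(2) facet_of_imp_subset by blast
  moreover have "T \<inter> T' \<noteq> T" using mesh_inclusion_eq[OF T(1,2)] T(3) by blast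
  ultimately show eq: "F = T \<inter> T'"
    using facet_subset_face[OF Ff face_Int[OF T(1,2)] _ convex_simplex[OF simplices[OF T(1)]]] by blast
  then have "F face_of T'" using face_Int'[OF T(1,2)] by simp
  then show "F \<in> facets T'"
    using Ff aff_dim_simplex[OF simplices] T by (simp add: facets_def facet_of_def)
qed

text \<open>Two elements on the same side of a common facet share points next to the barycentre of the
  facet, so that their intersection is larger than a common facet.\<close>

lemma same_side_eq:
  assumes T: "T \<in> \<T>" "T' \<in> \<T>" and F: "F \<in> facets T" "F \<in> facets T'"
    and n: "outward_normal T F = outward_normal T' F"
  shows "T = T'"
proof (rule ccontr)
  assume ne: "T \<noteq> T'"
  obtain p q r s where 1: "T = convex hull {p, q, r, s}" and Fh: "F = convex hull {q, r, s}" and t: "tet p q r s"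
    using tet_facetE[OF simplices[OF T(1)] F(1)] by blast
  obtain p' where 2: "T' = convex hull {p', q, r, s}" and t': "tet p' q r s"
    using tet_facet_vertices[OF simplices[OF T(2)] F(2) Fh tet_area_nonzero[OF t]] by blast
  let ?n = "outward_normal T F" and ?m = "(1/3) *\<^sub>R (q + r + s)"
  obtain e where e: "e > 0" "\<And>t. 0 < t \<Longrightarrow> t \<le> e \<Longrightarrow> ?m - t *\<^sub>R ?n \<in> T"
    using tet_inner_point[OF t, folded Fh, folded 1] by blast
  obtain e' where e': "e' > 0" "\<And>t. 0 < t \<Longrightarrow> t \<le> e' \<Longrightarrow> ?m - t *\<^sub>R ?n \<in> T'"
    using tet_inner_point[OF t', folded Fh, folded 2, folded n] by blast
  define x where "x = ?m - min e e' *\<^sub>R ?n"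
  have x: "x \<in> T \<inter> T'" using e e' by (simp add: x_def)
  have "F \<subseteq> T'" using F(2) by (simp add: facets_def facet_of_imp_subset)
  then have xF: "x \<in> F" using mesh_Int_facet(1)[OF T ne F(1)] x by simp
  have "?m \<in> F"
    unfolding Fh convex_hull_3
    by (rule CollectI, rule exI[of _ "1/3"], rule exI[of _ "1/3"], rule exI[of _ "1/3"])
      (simp add: scaleR_add_right)
  then have "?n \<bullet> x = ?n \<bullet> ?m"
    using facet_of_normal(2)[OF simplices[OF T(1)] F(1) xF] by simp
  then have "min e e' * (?n \<bullet> ?n) = 0" unfolding x_def by (simp add: inner_diff_right)
  moreover have "?n \<bullet> ?n = 1" using facet_of_normal(1)[OF simplices[OF T(1)] F(1)] by (simp add: norm_eq_1)
  ultimately show False using e e' by (simp add: min_def split: if_splits)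
qed

text \<open>The facet has a point \<open>y\<close> of its relative interior inside the domain. A step from \<open>y\<close> along the
  outward normal leaves \<open>T\<close>. If it is short enough, it stays in the domain and meets only elements
  that contain \<open>y\<close>. The element reached thus contains \<open>y\<close>, and by conformity the whole facet.\<close>

lemma neighbour_exists:
  assumes T: "T \<in> \<T>" and F: "F \<in> facets T" "\<not> F \<subseteq> frontier \<Omega>"
  shows "\<exists>T'\<in>\<T>. T' \<noteq> T \<and> F \<in> facets T'"
proof -
  have Ff: "F facet_of T" using F by (simp add: facets_def)
  have FT: "F \<subseteq> T" using Ff by (rule facet_of_imp_subset)
  have op: "open \<Omega>" using domain by (simp add: polyhedral_domain_def)
  obtain x where x: "x \<in> F" "x \<notin> frontier \<Omega>" using F by blast
  have "x \<in> closure \<Omega>" using x FT T Union_mesh by blast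
  then have "x \<in> \<Omega>" using x op by (simp add: frontier_def interior_open)
  moreover have "convex F" using Ff facet_of_imp_face_of face_of_imp_convex by blast
  then have "x \<in> closure (rel_interior F)"
    using x closure_subset convex_closure_rel_interior by blast
  ultimately obtain y where y: "y \<in> rel_interior F" "y \<in> \<Omega>"
    using open_Int_closure_eq_empty[OF op, of "rel_interior F"] by blast
  have yF: "y \<in> F" using y rel_interior_subset by blast
  let ?U = "\<Union>{T'\<in>\<T>. y \<notin> T'}"
  have "closed ?U"
    using finite_mesh simplices closed_simplex by (intro closed_Union) auto
  then have "open (\<Omega> - ?U)" using op by (rule open_Diff[rotated])
  moreover have "y \<in> \<Omega> - ?U" using y by blast
  ultimately obtain e where e: "e > 0" "cball y e \<subseteq> \<Omega> - ?U"
    using open_contains_cball by blast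
  let ?n = "outward_normal T F"
  have n1: "norm ?n = 1" by (rule facet_of_normal(1)[OF simplices[OF T] F(1)])
  define z where "z = y + e *\<^sub>R ?n"
  have "z \<in> cball y e" using e n1 by (simp add: z_def dist_norm)
  then have z: "z \<in> \<Omega>" "z \<notin> ?U" using e by blast+
  then have "z \<in> \<Union>\<T>" using Union_mesh closure_subset by blast
  then obtain T' where T': "T' \<in> \<T>" "z \<in> T'" "y \<in> T'" using z by blast
  have "z \<notin> T"
  proof
    assume "z \<in> T"
    then have "?n \<bullet> z \<le> ?n \<bullet> y" using facet_of_normal(3)[OF simplices[OF T] F(1) yF] by blast
    moreover have "?n \<bullet> z = ?n \<bullet> y + e" using n1 by (simp add: z_def inner_add_right norm_eq_1)
    ultimately show False using e by simp
  qed
  then have ne: "T' \<noteq> T" using T' by blast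
  have "F \<subseteq> T \<inter> T'"
    by (rule subset_of_face_of[OF face_Int[OF T T'(1)] FT]) (use y yF FT T' in blast)
  then have "F \<in> facets T'"
    using mesh_Int_facet(2)[OF T T'(1) ne[symmetric] F(1)] by blast
  then show ?thesis using T' ne by blast
qed

text \<open>Both candidates lie on the side of the facet opposite to \<open>T\<close>, hence on the same side.\<close>

lemma neighbour_unique:
  assumes T: "T \<in> \<T>" "F \<in> facets T" and 1: "T1 \<in> \<T>" "T1 \<noteq> T" "F \<in> facets T1"
    and 2: "T2 \<in> \<T>" "T2 \<noteq> T" "F \<in> facets T2"
  shows "T1 = T2"
proof -
  note s = simplices[OF T(1)]
  have "outward_normal T1 F = - outward_normal T F"
    using common_facet_normals[OF s T(2) simplices[OF 1(1)] 1(3)] same_side_eq[OF T(1) 1(1) T(2) 1(3)] 1 by metis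
  moreover have "outward_normal T2 F = - outward_normal T F"
    using common_facet_normals[OF s T(2) simplices[OF 2(1)] 2(3)] same_side_eq[OF T(1) 2(1) T(2) 2(3)] 2 by metis
  ultimately show ?thesis using same_side_eq[OF 1(1) 2(1) 1(3) 2(3)] by simp
qed

lemma neighbour:
  assumes T: "T \<in> \<T>" and F: "F \<in> facets T" "\<not> F \<subseteq> frontier \<Omega>"
  shows "neighbour \<T> T F \<in> \<T>" "neighbour \<T> T F \<noteq> T" "F \<in> facets (neighbour \<T> T F)"
    "outward_normal (neighbour \<T> T F) F = - outward_normal T F"
    "neighbour \<T> (neighbour \<T> T F) F = T"
proof -
  obtain T' where T': "T' \<in> \<T>" "T' \<noteq> T" "F \<in> facets T'"
    using neighbour_exists[OF assms] by blast
  have nb: "neighbour \<T> T F = T'"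
    unfolding neighbour_def using T' neighbour_unique[OF T F(1)] by (intro the_equality) auto
  show "neighbour \<T> T F \<in> \<T>" "neighbour \<T> T F \<noteq> T" "F \<in> facets (neighbour \<T> T F)"
    using T' nb by auto
  show "outward_normal (neighbour \<T> T F) F = - outward_normal T F"
    using common_facet_normals[OF simplices[OF T] F(1) simplices[OF T'(1)] T'(3)]
      same_side_eq[OF T T'(1) F(1) T'(3)] T'(2) nb by metis
  show "neighbour \<T> (neighbour \<T> T F) F = T"
    unfolding nb unfolding neighbour_def
    using T F T' neighbour_unique[OF T'(1,3)] by (intro the_equality) auto
qed

lemma negligible_frontier: "negligible (frontier \<Omega>)"
proof -
  obtain P where P: "finite P" "\<forall>Q\<in>P. polytope Q \<and> aff_dim Q = 2" "frontier \<Omega> = \<Union>P"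
    using domain unfolding polyhedral_domain_def by blast
  have "negligible Q" if "Q \<in> P" for Q
  proof -
    have "aff_dim Q < DIM(real^3)" using P that by simp
    then obtain a b where "a \<noteq> 0" "Q \<subseteq> {x. a \<bullet> x = b}"
      using aff_lowdim_subset_hyperplane by blast
    then show ?thesis using negligible_hyperplane negligible_subset by blast
  qed
  then show ?thesis unfolding P(3) using P(1) by (rule negligible_Union[rotated])
qed

lemma negligible_Int:
  assumes "T \<in> \<T>" "T' \<in> \<T>" "T \<noteq> T'" shows "negligible (T \<inter> T')"
proof -
  have "T \<inter> T' \<noteq> T" using mesh_inclusion_eq[OF assms(1,2)] assms(3) by blast
  then have "aff_dim (T \<inter> T') < aff_dim T"
    using face_of_aff_dim_lt[OF convex_simplex[OF simplices[OF assms(1)]] face_Int[OF assms(1,2)]] by blast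
  then have "aff_dim (T \<inter> T') < DIM(real^3)"
    using aff_dim_simplex[OF simplices[OF assms(1)]] by simp
  then obtain a b where "a \<noteq> 0" "T \<inter> T' \<subseteq> {x. a \<bullet> x = b}"
    using aff_lowdim_subset_hyperplane by blast
  then show ?thesis using negligible_hyperplane negligible_subset by blast
qed

lemma simplex_nonempty_interior:
  assumes "T \<in> \<T>" shows "interior T \<noteq> {}"
proof -
  have "aff_dim T = 3" by (rule aff_dim_simplex[OF simplices[OF assms]])
  then have "interior T = rel_interior T"
    by (intro interior_rel_interior_gen[THEN trans]) simp
  then show ?thesis
    using \<open>aff_dim T = 3\<close> rel_interior_eq_empty[OF convex_simplex[OF simplices[OF assms]]] by auto
qed

lemma mesh_sets [simp]: "T \<in> \<T> \<Longrightarrow> T \<in> sets borel" "T \<in> \<T> \<Longrightarrow> T \<in> sets lebesgue"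
  and mesh_compact: "T \<in> \<T> \<Longrightarrow> compact T"
  using borel_compact[OF compact_simplex[OF simplices]] compact_simplex[OF simplices] by auto

lemma mesh_nonempty: "\<T> \<noteq> {}"
  using Union_mesh domain closure_subset unfolding polyhedral_domain_def by fastforce

lemma finite_facets: "T \<in> \<T> \<Longrightarrow> finite (facets T)"
  using finite_polyhedron_facets simplex_imp_polyhedron[OF simplices] unfolding facets_def by blast

end

section \<open>Coefficients, traces and impedances\<close>

definition spd :: "real \<Rightarrow> real \<Rightarrow> (real^3^3) set" where
  "spd lo hi = {A. transpose A = A \<and>
     (\<forall>\<xi>. lo * (norm \<xi>)\<^sup>2 \<le> \<xi> \<bullet> (A *v \<xi>) \<and> \<xi> \<bullet> (A *v \<xi>) \<le> hi * (norm \<xi>)\<^sup>2)}"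

lemma continuous_mat_entry: "continuous_on S (\<lambda>A::real^3^3. A $ i $ j)"
  by (intro continuous_intros)

lemma matrix_form_3:
  fixes A :: "real^3^3"
  shows "u \<bullet> (A *v v) = (\<Sum>i\<in>UNIV. \<Sum>j\<in>UNIV. u $ i * (A $ i $ j * v $ j))"
  by (simp add: inner_vec_def matrix_vector_mult_def sum_distrib_left)

lemma continuous_form: "continuous_on S (\<lambda>A::real^3^3. u \<bullet> (A *v v))"
  unfolding matrix_form_3 by (intro continuous_intros)

lemma closed_spd: "closed (spd lo hi)"
proof -
  have eq: "spd lo hi = (\<Inter>i. \<Inter>j. {A. A $ j $ i = A $ i $ j}) \<inter>
      (\<Inter>\<xi>. {A. lo * (norm \<xi>)\<^sup>2 \<le> \<xi> \<bullet> (A *v \<xi>)} \<inter> {A. \<xi> \<bullet> (A *v \<xi>) \<le> hi * (norm \<xi>)\<^sup>2})"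
    by (auto simp: spd_def transpose_def vec_eq_iff)
  show ?thesis
    unfolding eq
    by (intro closed_Int closed_INT ballI closed_Collect_le closed_Collect_eq continuous_form
        continuous_mat_entry continuous_on_const)
qed

lemma spd_symmetric:
  assumes "A \<in> spd lo hi" shows "u \<bullet> (A *v v) = v \<bullet> (A *v u)"
  using assms dot_lmul_matrix[of u A v] by (simp add: spd_def inner_commute flip: vector_transpose_matrix)

text \<open>The quadratic form is nonnegative at \<open>u + v\<close> and at \<open>u - v\<close>.\<close>

lemma spd_bilinear_bound:
  assumes A: "A \<in> spd lo hi" and "lo \<ge> 0"
  shows "\<bar>u \<bullet> (A *v v)\<bar> \<le> hi * ((norm u)\<^sup>2 + (norm v)\<^sup>2) / 2"
proof -
  have q: "0 \<le> x \<bullet> (A *v x)" "x \<bullet> (A *v x) \<le> hi * (norm x)\<^sup>2" for x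
  proof -
    have l: "lo * (norm x)\<^sup>2 \<le> x \<bullet> (A *v x)" using A unfolding spd_def by blast
    show "x \<bullet> (A *v x) \<le> hi * (norm x)\<^sup>2" using A unfolding spd_def by blast
    have "0 \<le> lo * (norm x)\<^sup>2" using assms(2) by simp
    then show "0 \<le> x \<bullet> (A *v x)" using l by linarith
  qed
  have "(u + v) \<bullet> (A *v (u + v)) = u \<bullet> (A *v u) + 2 * (u \<bullet> (A *v v)) + v \<bullet> (A *v v)"
    "(u - v) \<bullet> (A *v (u - v)) = u \<bullet> (A *v u) - 2 * (u \<bullet> (A *v v)) + v \<bullet> (A *v v)"
    using spd_symmetric[OF A, of v u]
    by (simp_all add: matrix_vector_right_distrib matrix_vector_mult_diff_distrib inner_simps)
  then have "\<bar>2 * (u \<bullet> (A *v v))\<bar> \<le> u \<bullet> (A *v u) + v \<bullet> (A *v v)"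
    using q(1)[of "u + v"] q(1)[of "u - v"] by simp
  also have "\<dots> \<le> hi * (norm u)\<^sup>2 + hi * (norm v)\<^sup>2" by (intro add_mono q)
  finally show ?thesis by (simp add: algebra_simps)
qed

lemma spd_entry_bound:
  assumes "A \<in> spd lo hi" "lo \<ge> 0"
  shows "\<bar>A $ i $ j\<bar> \<le> hi"
proof -
  have "axis i 1 \<bullet> (A *v axis j 1) = A $ i $ j"
    by (simp add: inner_axis' matrix_vector_mult_basis column_def)
  then show ?thesis using spd_bilinear_bound[OF assms, of "axis i 1" "axis j 1"] by simp
qed

lemma spd_norm_bound:
  assumes "A \<in> spd lo hi" "lo \<ge> 0"
  shows "norm A \<le> 9 * hi"
proof -
  have "norm A \<le> (\<Sum>i\<in>UNIV. norm (A $ i))"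
    unfolding norm_vec_def[of A] by (rule L2_set_le_sum) simp
  also have "\<dots> \<le> (\<Sum>i\<in>(UNIV::3 set). \<Sum>j\<in>(UNIV::3 set). \<bar>A $ i $ j\<bar>)"
    by (intro sum_mono norm_le_l1_cart)
  also have "\<dots> \<le> (\<Sum>i\<in>(UNIV::3 set). \<Sum>j\<in>(UNIV::3 set). hi)"
    by (intro sum_mono spd_entry_bound[OF assms])
  finally show ?thesis by simp
qed

text \<open>The leading principal minors of orders two and three are bounded below successively, by testing
  the quadratic form with the vector of cofactors of the last row of each minor.\<close>

lemma spd_det_lower:
  assumes A: "A \<in> spd lo hi" and lo: "lo > 0"
  shows "lo ^ 3 \<le> det A"
proof -
  define a b c d e f where "a = A$1$1" and "b = A$1$2" and "c = A$1$3" and "d = A$2$2" and "e = A$2$3" and "f = A$3$3"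
  have "transpose A = A" using A by (simp add: spd_def)
  then have "transpose A $ i $ j = A $ i $ j" for i j by simp
  then have tr: "A $ j $ i = A $ i $ j" for i j by (simp add: transpose_def)
  have sym: "A$2$1 = b" "A$3$1 = c" "A$3$2 = e"
    unfolding b_def c_def e_def by (rule tr)+
  have Q: "lo * (x\<^sup>2 + y\<^sup>2 + z\<^sup>2) \<le> a*x\<^sup>2 + d*y\<^sup>2 + f*z\<^sup>2 + 2*b*x*y + 2*c*x*z + 2*e*y*z" for x y z
  proof -
    have "lo * (norm (vector [x, y, z] :: real^3))\<^sup>2 \<le> vector [x, y, z] \<bullet> (A *v vector [x, y, z])"
      using A unfolding spd_def by blast
    moreover have "(norm (vector [x, y, z] :: real^3))\<^sup>2 = x\<^sup>2 + y\<^sup>2 + z\<^sup>2"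
      unfolding power2_norm_eq_inner inner_vec_def sum_3 vector_3 by (simp add: power2_eq_square)
    moreover have "vector [x, y, z] \<bullet> (A *v vector [x, y, z])
        = a*x\<^sup>2 + d*y\<^sup>2 + f*z\<^sup>2 + 2*b*x*y + 2*c*x*z + 2*e*y*z"
      unfolding matrix_form_3 sum_3 vector_3 sym a_def[symmetric] b_def[symmetric] c_def[symmetric]
        d_def[symmetric] e_def[symmetric] f_def[symmetric] by algebra
    ultimately show ?thesis by simp
  qed
  have a: "lo \<le> a" using Q[of 1 0 0] by simp
  define M where "M = a * d - b\<^sup>2"
  have "lo * a\<^sup>2 \<le> lo * ((-b)\<^sup>2 + a\<^sup>2 + 0\<^sup>2)" using lo by (intro mult_left_mono) auto
  also have "\<dots> \<le> a*(-b)\<^sup>2 + d*a\<^sup>2 + f*0\<^sup>2 + 2*b*(-b)*a + 2*c*(-b)*0 + 2*e*a*0" by (rule Q)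
  also have "\<dots> = a * M" by (simp add: M_def power2_eq_square algebra_simps)
  finally have "a * (lo * a) \<le> a * M" by (simp add: power2_eq_square algebra_simps)
  then have M1: "lo * a \<le> M" using a lo by (simp add: mult_le_cancel_left)
  have "lo * lo \<le> lo * a" using a lo by (intro mult_left_mono) auto
  then have M: "lo\<^sup>2 \<le> M" using M1 by (simp add: power2_eq_square)
  then have Mpos: "M > 0" using lo by (meson less_le_trans zero_less_power)
  define p q where "p = b * e - c * d" and "q = b * c - a * e"
  have det: "det A = a*d*f + 2*b*c*e - a*e\<^sup>2 - d*c\<^sup>2 - f*b\<^sup>2"
    unfolding det_3 sym a_def[symmetric] b_def[symmetric] c_def[symmetric]
      d_def[symmetric] e_def[symmetric] f_def[symmetric] by algebra
  have "lo * M\<^sup>2 \<le> lo * (p\<^sup>2 + q\<^sup>2 + M\<^sup>2)" using lo by (intro mult_left_mono) auto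
  also have "\<dots> \<le> a*p\<^sup>2 + d*q\<^sup>2 + f*M\<^sup>2 + 2*b*p*q + 2*c*p*M + 2*e*q*M" by (rule Q)
  also have "\<dots> = M * det A" unfolding det p_def q_def M_def by algebra
  finally have "M * (lo * M) \<le> M * det A" by (simp add: power2_eq_square algebra_simps)
  then have "lo * M \<le> det A" using Mpos by (simp add: mult_le_cancel_left)
  moreover have "lo * lo\<^sup>2 \<le> lo * M" using M lo by (intro mult_left_mono) auto
  ultimately show ?thesis by (simp add: power3_eq_cube power2_eq_square)
qed

lemma spd_det_upper:
  assumes A: "A \<in> spd lo hi" and lo: "lo \<ge> 0"
  shows "det A \<le> 6 * hi ^ 3"
proof -
  have e: "\<bar>A $ i $ j\<bar> \<le> hi" for i j by (rule spd_entry_bound[OF A lo])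
  have hi: "0 \<le> hi" using e[of 1 1] by linarith
  have p: "\<bar>A$i$j * A$k$l * A$m$n\<bar> \<le> hi ^ 3" for i j k l m n
  proof -
    have "\<bar>A$i$j * A$k$l * A$m$n\<bar> = \<bar>A$i$j\<bar> * \<bar>A$k$l\<bar> * \<bar>A$m$n\<bar>" by (simp add: abs_mult)
    also have "\<dots> \<le> hi * hi * hi" using e hi by (intro mult_mono) auto
    finally show ?thesis by (simp add: power3_eq_cube)
  qed
  show ?thesis
    unfolding det_3
    using p[of 1 1 2 2 3 3] p[of 1 2 2 3 3 1] p[of 1 3 2 1 3 2] p[of 1 1 2 3 3 2] p[of 1 2 2 1 3 3] p[of 1 3 2 2 3 1]
    by linarith
qed

lemma effective_bounds:
  assumes A: "A \<in> spd lo hi" and lo: "lo > 0" and n: "norm n = 1"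
  shows "lo ^ 3 / hi \<le> effective A n" "effective A n \<le> 6 * hi ^ 3 / lo"
proof -
  have q: "lo \<le> n \<bullet> (A *v n)" "n \<bullet> (A *v n) \<le> hi"
  proof -
    have "lo * (norm n)\<^sup>2 \<le> n \<bullet> (A *v n) \<and> n \<bullet> (A *v n) \<le> hi * (norm n)\<^sup>2"
      using A unfolding spd_def by blast
    then show "lo \<le> n \<bullet> (A *v n)" "n \<bullet> (A *v n) \<le> hi" using n by simp_all
  qed
  have d: "lo ^ 3 \<le> det A" "det A \<le> 6 * hi ^ 3" using spd_det_lower[OF A lo] spd_det_upper[OF A] lo by auto
  have "0 < lo ^ 3" using lo by simp
  then have pos: "0 \<le> det A" "0 < n \<bullet> (A *v n)" "0 \<le> 6 * hi ^ 3" using d q lo by linarith+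
  show "lo ^ 3 / hi \<le> effective A n" "effective A n \<le> 6 * hi ^ 3 / lo"
    unfolding effective_def
    by (rule frac_le[OF pos(1) d(1) pos(2) q(2)]) (rule frac_le[OF pos(3) d(2) lo q(1)])
qed

lemma impedance_bounds:
  fixes e m :: real
  assumes "0 < e0" "e0 \<le> e" "e \<le> e1" "0 < m0" "m0 \<le> m" "m \<le> m1"
  shows "m0 / sqrt (m1 * e1) \<le> m * (1 / sqrt (m * e))" "m * (1 / sqrt (m * e)) \<le> m1 / sqrt (m0 * e0)"
proof -
  have "m * e \<le> m1 * e1" "m0 * e0 \<le> m * e" using assms by (auto intro!: mult_mono)
  moreover have "0 < m0 * e0" using assms by simp
  ultimately show "m0 / sqrt (m1 * e1) \<le> m * (1 / sqrt (m * e))" "m * (1 / sqrt (m * e)) \<le> m1 / sqrt (m0 * e0)"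
    using assms by (auto intro!: frac_le)
qed

subsection \<open>Surface measure on the facets\<close>

lemma surface_measure_triE:
  assumes F: "F = convex hull {q, r, s}" and ne: "tri_area2 q r s \<noteq> 0"
  obtains a b c where "F = convex hull {a, b, c}" "surface_measure F = tri_measure a b c" "tri_area2 a b c = tri_area2 q r s"
proof -
  obtain a b c where s: "F = convex hull {a, b, c}" "surface_measure F = tri_measure a b c"
    by (rule surface_measure_cases[OF F])
  have eq: "{q, r, s} = {a, b, c}"
    by (rule convex_hull_3_eq_imp[OF ne]) (simp only: F[symmetric] s(1)[symmetric])
  have "tri_area2 a b c = tri_area2 q r s"
    by (rule tri_perm_set[of tri_area2, OF tri_area2_perm eq not_affine_dependent_3(2-4)[OF ne]])
  then show thesis using that s by blast
qed

lemma lebesgue_cong_AE: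
  fixes f g :: "'a::euclidean_space \<Rightarrow> 'b::euclidean_space"
  assumes f: "f \<in> borel_measurable lebesgue" and ae: "AE x in lebesgue. f x = g x"
  shows "integral\<^sup>L lebesgue f = integral\<^sup>L lebesgue g"
    "integrable lebesgue f \<Longrightarrow> integrable lebesgue g"
proof -
  note g = borel_measurable_AE[OF f ae]
  show "integral\<^sup>L lebesgue f = integral\<^sup>L lebesgue g" by (rule integral_cong_AE[OF f g ae])
  show "integrable lebesgue f \<Longrightarrow> integrable lebesgue g" using integrable_cong_AE[OF f g ae] by blast
qed

lemma tri_measure_pos: "0 < tri_area2 a b c \<Longrightarrow> measure (tri_measure a b c) UNIV > 0"
    unfolding space_tri_measure using ref_triangle_null by simp

lemma sets_tri_measure: "sets (tri_measure a b c) = sets borel" by (simp add: tri_measure_def)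

context mesh begin

lemma facet_measure:
  assumes T: "T \<in> \<T>" "F \<in> facets T"
  shows "sets (surface_measure F) = sets borel" "finite_measure (surface_measure F)"
    "AE x in surface_measure F. x \<in> F" "measure (surface_measure F) UNIV > 0"
proof -
  obtain p q r s where F: "F = convex hull {q, r, s}" and t: "tet p q r s"
    using tet_facetE[OF simplices[OF T(1)] T(2)] by metis
  note ne = tet_area_nonzero[OF t]
  obtain a b c where s: "F = convex hull {a, b, c}" "surface_measure F = tri_measure a b c" "tri_area2 a b c = tri_area2 q r s"
    by (rule surface_measure_triE[OF F ne])
  have "0 < tri_area2 a b c" unfolding s(3) using ne by (simp add: tri_area2_def)
  from tri_measure_pos[OF this] show "measure (surface_measure F) UNIV > 0" unfolding s(2) .
  show "sets (surface_measure F) = sets borel" unfolding s(2) by (rule sets_tri_measure)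
  show "finite_measure (surface_measure F)" unfolding s(2) by (rule finite_tri_measure)
  show "AE x in surface_measure F. x \<in> F"
    using AE_tri_measure[of a b c] unfolding s(2) s(1)[symmetric] .
qed

subsection \<open>Representatives and traces of the coefficients\<close>

text \<open>The bounds of the coefficient hold almost everywhere. Changing the coefficient on a null set, which
  may contain the frontier of the domain, makes them hold everywhere, without effect on integrals.\<close>

lemma coefficient_representative:
  assumes A: "coefficient \<Omega> A lo hi"
  obtains A' where "A' \<in> borel_measurable lebesgue" "\<And>x. A' x \<in> spd lo hi"
    "AE x in lebesgue. x \<in> closure \<Omega> \<longrightarrow> A x = A' x"
proof -
  have op: "open \<Omega>" "\<Omega> \<noteq> {}" using domain by (auto simp: polyhedral_domain_def)
  then have OS: "\<Omega> \<in> sets lebesgue" by simp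
  define B where "B x = indicator \<Omega> x *\<^sub>R A x" for x
  have Bm: "B \<in> borel_measurable lebesgue"
    using A borel_measurable_restrict_space_iff[of \<Omega> lebesgue A] OS unfolding coefficient_def B_def by simp
  have "AE x in lebesgue_on \<Omega>. A x \<in> spd lo hi"
    using A unfolding coefficient_def spd_def by auto
  then have ae: "AE x in lebesgue. x \<in> \<Omega> \<longrightarrow> A x \<in> spd lo hi"
    using OS by (simp add: AE_restrict_space_iff)
  have "\<exists>x\<in>\<Omega>. A x \<in> spd lo hi"
  proof (rule ccontr)
    assume "\<not> (\<exists>x\<in>\<Omega>. A x \<in> spd lo hi)"
    with ae have "AE x in lebesgue. x \<notin> \<Omega>" by (auto elim: eventually_mono)
    then have "negligible \<Omega>" using OS by (simp add: AE_iff_null_sets negligible_iff_null_sets)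
    then show False using op open_not_negligible by blast
  qed
  then obtain A0 where A0: "A0 \<in> spd lo hi" by blast
  define A' where "A' x = (if B x \<in> spd lo hi then B x else A0)" for x
  have "A' \<in> borel_measurable lebesgue"
    unfolding A'_def
    by (rule measurable_If[OF Bm])
      (use measurable_sets[OF Bm borel_closed[OF closed_spd]] in \<open>simp_all add: vimage_def\<close>)
  moreover have "A' x \<in> spd lo hi" for x using A0 by (simp add: A'_def)
  moreover have "AE x in lebesgue. x \<notin> frontier \<Omega>"
    using negligible_frontier by (simp add: AE_iff_null_sets negligible_iff_null_sets null_setsD2)
  then have "AE x in lebesgue. x \<in> closure \<Omega> \<longrightarrow> A x = A' x"
    using ae
  proof eventually_elim
    case (elim x)
    then show ?case using op by (auto simp: A'_def B_def frontier_def interior_open)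
  qed
  ultimately show thesis by (rule that)
qed

lemma ball_Int_simplex_measure:
  assumes T: "T \<in> \<T>" "x \<in> T" and r: "r > 0"
  shows "measure lebesgue (T \<inter> ball x r) > 0" "T \<inter> ball x r \<in> lmeasurable"
proof -
  show lm: "T \<inter> ball x r \<in> lmeasurable"
    using T by (intro fmeasurable.Int) (auto simp: lmeasurable_compact mesh_compact)
  have "closure (interior T) = T"
    using convex_closure_interior[OF convex_simplex[OF simplices[OF T(1)]] simplex_nonempty_interior[OF T(1)]]
      closed_simplex[OF simplices[OF T(1)]] by simp
  then have "ball x r \<inter> interior T \<noteq> {}"
    using T r open_Int_closure_eq_empty[OF open_ball, of x r "interior T"] by force
  then have "\<not> negligible (interior T \<inter> ball x r)"
    by (intro open_not_negligible) (auto simp: Int_commute)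
  then have "\<not> negligible (T \<inter> ball x r)"
    using negligible_subset[of "T \<inter> ball x r" "interior T \<inter> ball x r"] interior_subset[of T] by blast
  then show "measure lebesgue (T \<inter> ball x r) > 0"
    using lm unfolding negligible_iff_measure by (simp add: zero_less_measure_iff)
qed

text \<open>The trace is known only through mean oscillations, so its bounds are not part of the data. But
  the matrices with the given bounds form a closed set. At a point where the trace had a positive
  distance to this set, the mean oscillation would not drop below this distance.\<close>

lemma trace_spd:
  assumes A: "coefficient \<Omega> A lo hi" and lo: "lo > 0" and T: "T \<in> \<T>" "F \<in> facets T"
    and g: "is_trace T A g"
  shows "AE x in surface_measure F. g x \<in> spd lo hi"
proof -
  obtain A' where A': "A' \<in> borel_measurable lebesgue" "\<And>x. A' x \<in> spd lo hi"
    "AE x in lebesgue. x \<in> closure \<Omega> \<longrightarrow> A x = A' x"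
    using coefficient_representative[OF A] by blast
  have TO: "T \<subseteq> closure \<Omega>" using T Union_mesh by blast
  have FT: "F \<subseteq> T" using T by (simp add: facets_def facet_of_imp_subset)
  have "AE x in surface_measure F.
           ((\<lambda>r. (LINT y:(T \<inter> ball x r)|lebesgue. norm (A y - g x))
                  / measure lebesgue (T \<inter> ball x r)) \<longlongrightarrow> 0) (at_right 0)"
    using g T(2) unfolding is_trace_def by blast
  then show ?thesis
    using facet_measure(3)[OF T]
  proof eventually_elim
    case (elim x)
    have xT: "x \<in> T" using elim FT by blast
    show "g x \<in> spd lo hi"
    proof (rule ccontr)
      assume "g x \<notin> spd lo hi"
      then obtain \<delta> where \<delta>: "\<delta> > 0" "ball (g x) \<delta> \<subseteq> - spd lo hi"
        using closed_spd[of lo hi] open_contains_ball[of "- spd lo hi"] by (auto simp: open_Compl)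
      have far: "\<delta> \<le> norm (A' y - g x)" for y
        using \<delta>(2) A'(2)[of y] by (force simp: dist_norm norm_minus_commute)
      have "\<delta> \<le> (LINT y:(T \<inter> ball x r)|lebesgue. norm (A y - g x)) / measure lebesgue (T \<inter> ball x r)"
        if r: "r > 0" for r
      proof -
        let ?S = "T \<inter> ball x r"
        note S = ball_Int_simplex_measure[OF T(1) xT r]
        have SS: "?S \<in> sets lebesgue" using S(2) by (rule fmeasurableD)
        have iS: "integrable lebesgue (indicator ?S :: _ \<Rightarrow> real)"
          using S(2) by (simp only: lmeasurable_iff_integrable)
        have A'x: "(\<lambda>y. norm (A' y - g x)) \<in> borel_measurable lebesgue"
          using A'(1) by measurable
        have i: "integrable lebesgue (\<lambda>y. indicator ?S y * norm (A' y - g x))"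
        proof (rule Bochner_Integration.integrable_bound)
          show "integrable lebesgue (\<lambda>y. (9 * hi + norm (g x)) * indicator ?S y)"
            using iS by simp
          show "(\<lambda>y. indicator ?S y * norm (A' y - g x)) \<in> borel_measurable lebesgue"
            using A'x SS by measurable
          have "norm (A' y - g x) \<le> 9 * hi + norm (g x)" for y
            using norm_triangle_ineq4[of "A' y" "g x"] spd_norm_bound[OF A'(2)[of y]] lo by linarith
          then show "AE y in lebesgue. norm (indicator ?S y * norm (A' y - g x)) \<le> norm ((9 * hi + norm (g x)) * indicator ?S y)"
            by (auto simp: indicator_def intro!: always_eventually order_trans[OF _ abs_ge_self])
        qed
        have "\<delta> * measure lebesgue ?S = (LINT y|lebesgue. \<delta> * indicator ?S y)"
          using S(2) by (simp add: fmeasurable_def)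
        also have "\<dots> \<le> (LINT y|lebesgue. indicator ?S y * norm (A' y - g x))"
        proof (rule integral_mono[OF _ i])
          show "integrable lebesgue (\<lambda>y. \<delta> * indicator ?S y)" using iS by (rule integrable_mult_right)
          show "\<delta> * indicator ?S y \<le> indicator ?S y * norm (A' y - g x)" for y
            using far[of y] by (simp add: indicator_def)
        qed
        also have "\<dots> = (LINT y:?S|lebesgue. norm (A y - g x))"
          unfolding set_lebesgue_integral_def real_scaleR_def
        proof (rule lebesgue_cong_AE(1))
          show "(\<lambda>y. indicator ?S y * norm (A' y - g x)) \<in> borel_measurable lebesgue"
            using A'x SS by measurable
          show ae: "AE y in lebesgue. indicator ?S y * norm (A' y - g x) = indicator ?S y * norm (A y - g x)"
            using A'(3) by eventually_elim (use TO in \<open>auto simp: indicator_def\<close>)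
        qed
        finally show ?thesis using S(1) by (simp add: field_simps)
      qed
      then have "eventually (\<lambda>r. \<delta> \<le> (LINT y:(T \<inter> ball x r)|lebesgue. norm (A y - g x))
          / measure lebesgue (T \<inter> ball x r)) (at_right 0)"
        by (auto simp: eventually_at_filter intro: always_eventually)
      then have "\<delta> \<le> 0" using elim(1) by (intro tendsto_lowerbound[OF elim(1)]) auto
      then show False using \<delta> by simp
    qed
  qed
qed

subsection \<open>Bounds for the impedance\<close>

lemma Zm_bounds:
  assumes \<epsilon>: "coefficient \<Omega> \<epsilon> \<epsilon>lo \<epsilon>hi" "\<epsilon>lo > 0" "\<And>T. T \<in> \<T> \<Longrightarrow> is_trace T \<epsilon> (\<epsilon>t T)"
    and \<mu>: "coefficient \<Omega> \<mu> \<mu>lo \<mu>hi" "\<mu>lo > 0" "\<And>T. T \<in> \<T> \<Longrightarrow> is_trace T \<mu> (\<mu>t T)"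
    and hi: "\<epsilon>hi > 0" "\<mu>hi > 0"
  obtains zlo zhi where "0 < zlo" "\<And>T F. T \<in> \<T> \<Longrightarrow> F \<in> facets T \<Longrightarrow>
    AE x in surface_measure F. zlo \<le> Zm \<epsilon>t \<mu>t T F x \<and> Zm \<epsilon>t \<mu>t T F x \<le> zhi"
proof -
  let ?e0 = "\<epsilon>lo ^ 3 / \<epsilon>hi" and ?e1 = "6 * \<epsilon>hi ^ 3 / \<epsilon>lo" and ?m0 = "\<mu>lo ^ 3 / \<mu>hi" and ?m1 = "6 * \<mu>hi ^ 3 / \<mu>lo"
  show thesis
  proof (rule that)
    show "0 < ?m0 / sqrt (?m1 * ?e1)" using \<epsilon> \<mu> hi by simp
    fix T F assume T: "T \<in> \<T>" "F \<in> facets T"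
    have n: "norm (outward_normal T F) = 1" by (rule facet_of_normal(1)[OF simplices[OF T(1)] T(2)])
    show "AE x in surface_measure F. ?m0 / sqrt (?m1 * ?e1) \<le> Zm \<epsilon>t \<mu>t T F x \<and> Zm \<epsilon>t \<mu>t T F x \<le> ?m1 / sqrt (?m0 * ?e0)"
      using trace_spd[OF \<epsilon>(1,2) T \<epsilon>(3)[OF T(1)]] trace_spd[OF \<mu>(1,2) T \<mu>(3)[OF T(1)]]
    proof eventually_elim
      case (elim x)
      note e = effective_bounds[OF elim(1) \<epsilon>(2) n] and m = effective_bounds[OF elim(2) \<mu>(2) n]
      have "0 < ?e0" "0 < ?m0" using \<epsilon> \<mu> hi by auto
      from impedance_bounds[OF this(1) e this(2) m] show ?case
        unfolding Zm_def Let_def by blast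
    qed
  qed
qed

lemma effective_measurable:
  assumes "g \<in> borel_measurable M" shows "(\<lambda>x. effective (g x) n) \<in> borel_measurable M"
proof -
  have "(\<lambda>x. n \<bullet> (g x *v n)) \<in> borel_measurable M"
    using measurable_compose[OF assms borel_measurable_continuous_onI[OF continuous_form]] .
  moreover have [measurable]: "(\<lambda>x. g x $ i $ j) \<in> borel_measurable M" for i j
    using measurable_compose[OF assms borel_measurable_continuous_onI[OF continuous_mat_entry]] .
  have "(\<lambda>x. det (g x)) \<in> borel_measurable M"
    unfolding det_3 by measurable
  ultimately show ?thesis unfolding effective_def by measurable
qed

lemma Zm_measurable:
  assumes "is_trace T \<epsilon> (\<epsilon>t T)" "is_trace T \<mu> (\<mu>t T)" "F \<in> facets T"
  shows "Zm \<epsilon>t \<mu>t T F \<in> borel_measurable (surface_measure F)"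
proof -
  have "\<epsilon>t T \<in> borel_measurable (surface_measure F)" "\<mu>t T \<in> borel_measurable (surface_measure F)"
    using assms unfolding is_trace_def by blast+
  from this[THEN effective_measurable, of "outward_normal T F"]
  show ?thesis unfolding Zm_def Let_def by measurable
qed

text \<open>Being a supremum of essential lower bounds, \<^const>\<open>min_over_faces\<close> is finite because facets
  have positive area, and it is itself an essential lower bound because countably many of the bounds
  approximate it.\<close>

lemma min_over_faces_bound:
  assumes f: "\<And>T F. T \<in> \<T> \<Longrightarrow> F \<in> facets T \<Longrightarrow> AE x in surface_measure F. lo \<le> f T F x \<and> f T F x \<le> hi"
  shows "lo \<le> min_over_faces \<T> f"
    and "T \<in> \<T> \<Longrightarrow> F \<in> facets T \<Longrightarrow> AE x in surface_measure F. min_over_faces \<T> f \<le> f T F x"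
proof -
  let ?S = "{z. \<forall>T\<in>\<T>. \<forall>F\<in>facets T. AE x in surface_measure F. z \<le> f T F x}"
  have S: "min_over_faces \<T> f = Sup ?S" by (simp add: min_over_faces_def)
  have lo: "lo \<in> ?S" using f by (auto elim: eventually_mono)
  obtain T0 F0 where T0: "T0 \<in> \<T>" "F0 \<in> facets T0"
  proof -
    obtain T0 where T0: "T0 \<in> \<T>" using mesh_nonempty by blast
    then obtain a b c d where "T0 = convex hull {a, b, c, d}" "tet a b c d" using simplex_tetE simplices by blast
    then have "convex hull {b, c, d} \<in> facets T0" using facets_tet by simp
    then show thesis using that T0 by blast
  qed
  have bdd: "z \<le> hi" if z: "z \<in> ?S" for z
  proof (rule ccontr)
    assume "\<not> z \<le> hi"
    moreover have "AE x in surface_measure F0. z \<le> f T0 F0 x" using z T0 by blast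
    then have "AE x in surface_measure F0. z \<le> hi" using f[OF T0] by eventually_elim linarith
    ultimately have "AE x in surface_measure F0. False" by (auto elim: eventually_mono)
    then have "emeasure (surface_measure F0) (space (surface_measure F0)) = 0"
      by (simp add: ae_filter_eq_bot_iff[symmetric] eventually_False)
    moreover have "space (surface_measure F0) = UNIV"
      using sets_eq_imp_space_eq[OF facet_measure(1)[OF T0]] by simp
    ultimately show False using facet_measure(4)[OF T0] by (simp add: measure_def)
  qed
  then have "bdd_above ?S" by (intro bdd_aboveI) auto
  then show "lo \<le> min_over_faces \<T> f" unfolding S using lo by (rule cSup_upper[rotated])
  assume T: "T \<in> \<T>" "F \<in> facets T"
  have "AE x in surface_measure F. Sup ?S - 1 / real (Suc n) \<le> f T F x" for n
  proof -
    have "Sup ?S - 1 / real (Suc n) < Sup ?S" by simp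
    then obtain z where z: "z \<in> ?S" "Sup ?S - 1 / real (Suc n) < z"
      using lo \<open>bdd_above ?S\<close> by (subst (asm) less_cSup_iff) auto
    then have "AE x in surface_measure F. z \<le> f T F x" using T by blast
    then show ?thesis using z(2) by (auto elim: eventually_mono)
  qed
  then have "AE x in surface_measure F. \<forall>n. Sup ?S - 1 / real (Suc n) \<le> f T F x"
    by (simp add: AE_all_countable)
  then show "AE x in surface_measure F. min_over_faces \<T> f \<le> f T F x"
  proof eventually_elim
    case (elim x)
    have "(\<lambda>n. Sup ?S - 1 / real (Suc n)) \<longlonglongrightarrow> Sup ?S - 0"
      by (intro tendsto_intros LIMSEQ_Suc lim_1_over_n)
    then show ?case unfolding S using elim by (intro LIMSEQ_le_const2[of _ "Sup ?S"]) auto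
  qed
qed

end

section \<open>Polynomial vector fields on an element\<close>

lemma poly_space_mult:
  assumes p: "p \<in> poly_space N" and q: "q \<in> poly_space M"
  shows "(\<lambda>x. p x * q x) \<in> poly_space (N + M)"
  using p
proof (induction rule: poly_space_induct)
  case zero
  show ?case by (simp add: poly_space_zero)
next
  case (add c e r)
  obtain i j k where e: "e = (i, j, k)" by (cases e)
  have "(\<lambda>x. monomial e x * q x) \<in> poly_space (N + M)"
    using q
  proof (induction rule: poly_space_induct)
    case zero
    show ?case by (simp add: poly_space_zero)
  next
    case (add c' e' r')
    obtain i' j' k' where e': "e' = (i', j', k')" by (cases e')
    have "(\<lambda>x. c' * monomial (i + i', j + j', k + k') x + monomial e x * r' x) \<in> poly_space (N + M)"
      using add \<open>e \<in> exponents N\<close>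
      by (intro poly_space_add poly_space_scale poly_space_monomial) (auto simp: e e')
    also have "(\<lambda>x. c' * monomial (i + i', j + j', k + k') x + monomial e x * r' x)
        = (\<lambda>x. monomial e x * (c' * monomial e' x + r' x))"
      by (simp add: fun_eq_iff e e' monomial_def power_add algebra_simps)
    finally show ?case .
  qed
  from poly_space_add[OF poly_space_scale[OF this, of c] add(3)]
  show ?case by (simp add: algebra_simps)
qed

lemma partial_mult:
  fixes p q :: "real^3 \<Rightarrow> real"
  assumes "p differentiable (at x)" "q differentiable (at x)"
  shows "partial k (\<lambda>x. p x * q x) x = partial k p x * q x + p x * partial k q x"
proof -
  have "((\<lambda>x. p x * q x) has_derivative
      (\<lambda>h. p x * frechet_derivative q (at x) h + frechet_derivative p (at x) h * q x)) (at x)"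
    using assms unfolding frechet_derivative_works by (intro has_derivative_mult)
  from partial_has_derivative[OF this] show ?thesis by (simp add: partial_def)
qed

lemma partial_sum:
  fixes p :: "'i \<Rightarrow> real^3 \<Rightarrow> real"
  assumes "finite I" "\<And>i. i \<in> I \<Longrightarrow> p i differentiable (at x)"
  shows "partial k (\<lambda>x. \<Sum>i\<in>I. p i x) x = (\<Sum>i\<in>I. partial k (p i) x)"
proof -
  have "((\<lambda>x. \<Sum>i\<in>I. p i x) has_derivative (\<lambda>h. \<Sum>i\<in>I. frechet_derivative (p i) (at x) h)) (at x)"
    using assms unfolding frechet_derivative_works by (intro has_derivative_sum)
  from partial_has_derivative[OF this] show ?thesis by (simp add: partial_def)
qed

lemma poly_space_sum:
  assumes "finite I" "\<And>i. i \<in> I \<Longrightarrow> p i \<in> poly_space N"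
  shows "(\<lambda>x. \<Sum>i\<in>I. p i x) \<in> poly_space N"
  using assms by (induction I) (auto intro: poly_space_zero poly_space_add)

lemma curl_components:
  assumes "v \<in> poly_space3 N"
  shows "curl v x $ 1 = partial 2 (\<lambda>x. v x $ 3) x - partial 3 (\<lambda>x. v x $ 2) x"
    "curl v x $ 2 = partial 3 (\<lambda>x. v x $ 1) x - partial 1 (\<lambda>x. v x $ 3) x"
    "curl v x $ 3 = partial 1 (\<lambda>x. v x $ 2) x - partial 2 (\<lambda>x. v x $ 1) x"
  using poly_space3_differentiable[OF assms, of x]
  by (simp_all add: curl_def partial_component)

lemma curl_poly_space3:
  assumes "v \<in> poly_space3 N" shows "curl v \<in> poly_space3 N"
proof -
  have "(\<lambda>x. curl v x $ i) \<in> poly_space N" for i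
    using exhaust_3[of i] poly_space3_component[OF assms]
    by (auto simp: curl_components[OF assms] intro!: poly_space_diff partial_poly_space)
  then show ?thesis by (simp add: poly_space3_def)
qed

lemma power2_norm_sum: "(norm (v::real^'n))\<^sup>2 = (\<Sum>i\<in>UNIV. (v $ i)\<^sup>2)"
  unfolding power2_norm_eq_inner inner_vec_def by (simp add: power2_eq_square)

context mesh begin

lemma element_integrable:
  fixes f :: "real^3 \<Rightarrow> real"
  assumes "T \<in> \<T>" "continuous_on UNIV f"
  shows "set_integrable lebesgue T f"
proof -
  have "integrable lborel (\<lambda>x. indicator T x *\<^sub>R f x)"
    using borel_integrable_compact[OF mesh_compact[OF assms(1)] continuous_on_subset[OF assms(2)]] by simp
  then show ?thesis
    unfolding set_integrable_def using integrable_completion[OF borel_measurable_integrable] by blast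
qed

lemma facet_integrable:
  fixes f :: "real^3 \<Rightarrow> real"
  assumes T: "T \<in> \<T>" "F \<in> facets T" and f: "continuous_on UNIV f"
    and w: "w \<in> borel_measurable (surface_measure F)" "AE x in surface_measure F. \<bar>w x\<bar> \<le> B"
  shows "integrable (surface_measure F) (\<lambda>x. w x * f x)"
proof -
  interpret finite_measure "surface_measure F" by (rule facet_measure(2)[OF T])
  have "F \<subseteq> T" using T by (simp add: facets_def facet_of_imp_subset)
  have "compact (f ` T)" using mesh_compact[OF T(1)] f by (meson compact_continuous_image continuous_on_subset subset_UNIV)
  then obtain K where K: "\<And>x. x \<in> T \<Longrightarrow> \<bar>f x\<bar> \<le> K"
    using compact_imp_bounded bounded_real by (metis imageI)
  have fm: "f \<in> borel_measurable (surface_measure F)"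
    using borel_measurable_continuous_onI[OF f] measurable_cong_sets[OF facet_measure(1)[OF T] refl] by blast
  show ?thesis
  proof (rule integrable_const_bound)
    show "AE x in surface_measure F. norm (w x * f x) \<le> B * K"
      using w(2) facet_measure(3)[OF T]
    proof eventually_elim
      case (elim x)
      have "\<bar>f x\<bar> \<le> K" using K elim \<open>F \<subseteq> T\<close> by blast
      then show ?case using elim by (simp add: abs_mult mult_mono)
    qed
    show "(\<lambda>x. w x * f x) \<in> borel_measurable (surface_measure F)" using w(1) fm by measurable
  qed
qed

lemma facet_integrable_continuous:
  fixes f :: "real^3 \<Rightarrow> real"
  assumes "T \<in> \<T>" "F \<in> facets T" "continuous_on UNIV f"
  shows "integrable (surface_measure F) f"
  using facet_integrable[OF assms, of "\<lambda>_. 1" 1] by simp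

lemma element_integral_linear:
  fixes f g :: "real^3 \<Rightarrow> real"
  assumes "T \<in> \<T>" "continuous_on UNIV f" "continuous_on UNIV g"
  shows "(LINT x:T|lebesgue. f x + g x) = (LINT x:T|lebesgue. f x) + (LINT x:T|lebesgue. g x)"
    "(LINT x:T|lebesgue. f x - g x) = (LINT x:T|lebesgue. f x) - (LINT x:T|lebesgue. g x)"
  using element_integrable[OF assms(1,2)] element_integrable[OF assms(1,3)] by simp_all

lemma element_integral_sum:
  fixes f :: "'i \<Rightarrow> real^3 \<Rightarrow> real"
  assumes "T \<in> \<T>" "\<And>i. continuous_on UNIV (f i)" "finite I"
  shows "(LINT x:T|lebesgue. \<Sum>i\<in>I. f i x) = (\<Sum>i\<in>I. LINT x:T|lebesgue. f i x)"
  using element_integrable[OF assms(1,2)]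
  unfolding set_lebesgue_integral_def set_integrable_def
  by (simp add: sum_distrib_left)

lemma element_integral_mono:
  fixes f g :: "real^3 \<Rightarrow> real"
  assumes "T \<in> \<T>" "continuous_on UNIV f" "continuous_on UNIV g" "\<And>x. f x \<le> g x"
  shows "(LINT x:T|lebesgue. f x) \<le> (LINT x:T|lebesgue. g x)"
  using element_integrable[OF assms(1,2)] element_integrable[OF assms(1,3)] assms(4)
  by (intro set_integral_mono) auto

lemma divergence_poly:
  assumes T: "T \<in> \<T>" and G: "G \<in> poly_space3 N"
  shows "(LINT x:T|lebesgue. \<Sum>k\<in>UNIV. partial k (\<lambda>x. G x $ k) x)
    = (\<Sum>F\<in>facets T. LINT x|surface_measure F. outward_normal T F \<bullet> G x)"
proof -
  note Gk = poly_space3_component[OF G]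
  have k: "(LINT x:T|lebesgue. partial k (\<lambda>x. G x $ k) x)
      = (\<Sum>F\<in>facets T. LINT x|surface_measure F. outward_normal T F $ k * G x $ k)" for k
  proof -
    have der: "((\<lambda>x. G x $ k) has_derivative frechet_derivative (\<lambda>x. G x $ k) (at x)) (at x)" for x
      using poly_space_differentiable[OF Gk] frechet_derivative_works by blast
    have eq: "frechet_derivative (\<lambda>x. G x $ k) (at x) v = (\<Sum>i\<in>UNIV. v $ i * partial i (\<lambda>x. G x $ k) x)" for x v
    proof -
      have "v = (\<Sum>i\<in>UNIV. v $ i *\<^sub>R axis i 1)" by (simp add: basis_expansion flip: scalar_mult_eq_scaleR)
      then have "frechet_derivative (\<lambda>x. G x $ k) (at x) v
          = frechet_derivative (\<lambda>x. G x $ k) (at x) (\<Sum>i\<in>UNIV. v $ i *\<^sub>R axis i 1)" by simp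
      also have "\<dots> = (\<Sum>i\<in>UNIV. v $ i * partial i (\<lambda>x. G x $ k) x)"
        using has_derivative_linear[OF der[of x]] by (simp add: linear_sum linear_scale partial_def)
      finally show ?thesis .
    qed
    have "(LINT x:T|lebesgue. frechet_derivative (\<lambda>x. G x $ k) (at x) (axis k 1)) = facet_flux T (\<lambda>x. G x $ k) (axis k 1)"
      by (rule divergence_tetrahedron[OF simplices[OF T] der])
        (simp only: eq, intro continuous_intros poly_space_continuous[OF partial_poly_space[OF Gk]])
    then show ?thesis
      unfolding facet_flux_def partial_def by (simp add: inner_axis)
  qed
  have "(LINT x:T|lebesgue. \<Sum>k\<in>UNIV. partial k (\<lambda>x. G x $ k) x)
      = (\<Sum>k\<in>UNIV. LINT x:T|lebesgue. partial k (\<lambda>x. G x $ k) x)"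
    by (rule element_integral_sum[OF T poly_space_continuous[OF partial_poly_space[OF Gk]]]) simp
  also have "\<dots> = (\<Sum>F\<in>facets T. \<Sum>k\<in>UNIV. LINT x|surface_measure F. outward_normal T F $ k * G x $ k)"
    unfolding k by (rule sum.swap)
  also have "\<dots> = (\<Sum>F\<in>facets T. LINT x|surface_measure F. outward_normal T F \<bullet> G x)"
  proof (rule sum.cong[OF refl])
    fix F assume F: "F \<in> facets T"
    have "integrable (surface_measure F) (\<lambda>x. outward_normal T F $ k * G x $ k)" for k
      by (intro facet_integrable_continuous[OF T F] continuous_intros poly_space_continuous[OF Gk])
    then show "(\<Sum>k\<in>UNIV. LINT x|surface_measure F. outward_normal T F $ k * G x $ k)
        = (LINT x|surface_measure F. outward_normal T F \<bullet> G x)"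
      by (simp add: inner_vec_def flip: Bochner_Integration.integral_sum)
  qed
  finally show ?thesis .
qed

text \<open>The divergence of \<open>H \<times> u\<close> is \<open>u \<bullet> curl H - H \<bullet> curl u\<close>.\<close>

lemma curl_by_parts:
  assumes T: "T \<in> \<T>" and H: "H \<in> poly_space3 N" and u: "u \<in> poly_space3 N"
  shows "vol_inner T (curl H) u = vol_inner T (curl u) H
    + (\<Sum>F\<in>facets T. LINT x|surface_measure F. cross3 (outward_normal T F) (H x) \<bullet> u x)"
proof -
  note Hk = poly_space3_component[OF H] and uk = poly_space3_component[OF u]
  note dH = poly_space_differentiable[OF Hk] and du = poly_space_differentiable[OF uk]
  define G where "G x = cross3 (H x) (u x)" for x
  have comp: "(\<lambda>x. G x $ 1) = (\<lambda>x. H x $ 2 * u x $ 3 - u x $ 2 * H x $ 3)"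
    "(\<lambda>x. G x $ 2) = (\<lambda>x. H x $ 3 * u x $ 1 - u x $ 3 * H x $ 1)"
    "(\<lambda>x. G x $ 3) = (\<lambda>x. H x $ 1 * u x $ 2 - u x $ 1 * H x $ 2)"
    unfolding G_def cross_components by auto
  have G: "G \<in> poly_space3 (N + N)"
  proof -
    have "(\<lambda>x. G x $ i) \<in> poly_space (N + N)" for i
      using exhaust_3[of i] poly_space_mult[OF Hk uk] poly_space_mult[OF uk Hk]
      by (auto simp: comp intro!: poly_space_diff)
    then show ?thesis by (simp add: poly_space3_def)
  qed
  have div: "(\<Sum>k\<in>UNIV. partial k (\<lambda>x. G x $ k) x) = curl H x \<bullet> u x - curl u x \<bullet> H x" for x
  proof -
    have pd: "partial k (\<lambda>x. H x $ i * u x $ j - u x $ i * H x $ j) x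
      = partial k (\<lambda>x. H x $ i) x * u x $ j + H x $ i * partial k (\<lambda>x. u x $ j) x
        - (partial k (\<lambda>x. u x $ i) x * H x $ j + u x $ i * partial k (\<lambda>x. H x $ j) x)" for k i j
      using dH du by (subst partial_linear(2)) (auto simp: partial_mult intro!: derivative_intros)
    show ?thesis
      unfolding sum_3 comp pd inner_vec_def curl_components[OF H] curl_components[OF u] inner_real_def
      by algebra
  qed
  have "vol_inner T (curl H) u - vol_inner T (curl u) H = (LINT x:T|lebesgue. \<Sum>k\<in>UNIV. partial k (\<lambda>x. G x $ k) x)"
    unfolding vol_inner_def div
    by (rule element_integral_linear(2)[OF T, symmetric])
      (intro continuous_on_inner poly_space3_continuous[OF curl_poly_space3[OF H]] poly_space3_continuous[OF H]
        poly_space3_continuous[OF u] poly_space3_continuous[OF curl_poly_space3[OF u]])+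
  also have "\<dots> = (\<Sum>F\<in>facets T. LINT x|surface_measure F. outward_normal T F \<bullet> G x)"
    by (rule divergence_poly[OF T G])
  also have "\<dots> = (\<Sum>F\<in>facets T. LINT x|surface_measure F. cross3 (outward_normal T F) (H x) \<bullet> u x)"
  proof -
    have "n \<bullet> cross3 v w = cross3 n v \<bullet> w" for n v w
      by (subst inner_commute) (rule cross_triple[symmetric])
    then show ?thesis unfolding G_def by simp
  qed
  finally show ?thesis by simp
qed

lemma facet_integral_sum:
  fixes f :: "'i \<Rightarrow> real^3 \<Rightarrow> real"
  assumes T: "T \<in> \<T>" and f: "\<And>i. continuous_on UNIV (f i)" and I: "finite I"
  shows "(\<Sum>F\<in>facets T. LINT x|surface_measure F. (\<Sum>i\<in>I. f i x))
    = (\<Sum>i\<in>I. \<Sum>F\<in>facets T. LINT x|surface_measure F. f i x)"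
proof -
  have "(\<Sum>F\<in>facets T. LINT x|surface_measure F. (\<Sum>i\<in>I. f i x))
      = (\<Sum>F\<in>facets T. \<Sum>i\<in>I. LINT x|surface_measure F. f i x)"
    using facet_integrable_continuous[OF T _ f]
    by (intro sum.cong refl Bochner_Integration.integral_sum) auto
  then show ?thesis using sum.swap by simp
qed

end

lemma young_minus:
  fixes a b g :: real assumes "g > 0" shows "- (a * b) \<le> (g * a\<^sup>2 + b\<^sup>2 / g) / 2"
proof -
  have "0 \<le> (g * a + b)\<^sup>2 / g" using assms by simp
  also have "\<dots> = g * a\<^sup>2 + 2 * (a * b) + b\<^sup>2 / g"
    using assms by (simp add: field_simps power2_eq_square)
  finally show ?thesis by simp
qed

lemma young_abs:
  fixes a b g :: real assumes "g > 0" shows "\<bar>a * b\<bar> \<le> (g * a\<^sup>2 + b\<^sup>2 / g) / 2"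
  using young_minus[OF assms, of a b] young_minus[OF assms, of "-a" b] by (simp add: abs_le_iff)

text \<open>With \<open>D i j\<close> the derivative of the component \<open>j\<close> in the direction \<open>i\<close>, the left-hand side is
  the boundary integrand that is left over when the norm of the full gradient is compared with those of
  the curl and of the divergence. The parameter \<open>g\<close> will be the constant of the inverse inequality,
  for which both terms on the right admit the same bound.\<close>

lemma gradient_flux_bound:
  fixes n H :: "real^3" and D :: "3 \<Rightarrow> 3 \<Rightarrow> real"
  assumes g: "g > 0" and n: "norm n = 1"
  shows "- (\<Sum>i\<in>UNIV. n $ i * (\<Sum>j\<in>UNIV. H $ j * D j i - H $ i * D j j))
    \<le> 3 / 2 * (g * (\<Sum>j\<in>UNIV. (H $ j)\<^sup>2) + (\<Sum>i\<in>UNIV. \<Sum>j\<in>UNIV. (D i j)\<^sup>2) / g)"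
proof -
  define t where "t = (\<Sum>j\<in>UNIV. D j j)"
  define d where "d = (\<Sum>i\<in>UNIV. \<Sum>j\<in>UNIV. (D i j)\<^sup>2)"
  define h where "h = (\<Sum>j\<in>UNIV. (H $ j)\<^sup>2)"
  have n2: "(\<Sum>i\<in>UNIV. (n $ i)\<^sup>2) = 1" using n power2_norm_sum[of n] by simp
  have split: "- (\<Sum>i\<in>UNIV. n $ i * (\<Sum>j\<in>UNIV. H $ j * D j i - H $ i * D j j))
      = (\<Sum>i\<in>UNIV. \<Sum>j\<in>UNIV. - ((n $ i * H $ j) * D j i)) + (n \<bullet> H) * t"
    unfolding t_def inner_vec_def sum_3 inner_real_def by algebra
  have "(\<Sum>i\<in>UNIV. \<Sum>j\<in>UNIV. - ((n $ i * H $ j) * D j i))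
      \<le> (\<Sum>i\<in>UNIV. \<Sum>j\<in>UNIV. (g * (n $ i * H $ j)\<^sup>2 + (D j i)\<^sup>2 / g) / 2)"
    by (intro sum_mono young_minus[OF g])
  also have "\<dots> = (g * ((\<Sum>i\<in>UNIV. (n $ i)\<^sup>2) * h) + (\<Sum>i\<in>UNIV. \<Sum>j\<in>UNIV. (D j i)\<^sup>2) / g) / 2"
    unfolding h_def sum_3 by (simp add: power_mult_distrib add_divide_distrib algebra_simps)
  also have "(\<Sum>i\<in>UNIV. \<Sum>j\<in>UNIV. (D j i)\<^sup>2) = d" unfolding d_def by (rule sum.swap)
  finally have 1: "(\<Sum>i\<in>UNIV. \<Sum>j\<in>UNIV. - ((n $ i * H $ j) * D j i)) \<le> (g * h + d / g) / 2"
    using n2 by simp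
  have "(n \<bullet> H)\<^sup>2 \<le> h"
    using Cauchy_Schwarz_ineq[of n H] n unfolding h_def power2_norm_sum[symmetric]
    by (simp add: power2_norm_eq_inner[symmetric])
  moreover have "t\<^sup>2 \<le> 3 * d"
  proof -
    have "t\<^sup>2 \<le> 3 * ((D 1 1)\<^sup>2 + (D 2 2)\<^sup>2 + (D 3 3)\<^sup>2)"
      using sum_squares_ge_zero[of "D 1 1 - D 2 2" "D 1 1 - D 3 3"] zero_le_square[of "D 2 2 - D 3 3"]
      unfolding t_def sum_3 by (simp add: power2_eq_square algebra_simps)
    also have "\<dots> \<le> 3 * d" unfolding d_def sum_3 by (simp add: add_increasing add_increasing2)
    finally show ?thesis .
  qed
  moreover have "\<bar>(n \<bullet> H) * t\<bar> \<le> ((2 * g) * (n \<bullet> H)\<^sup>2 + t\<^sup>2 / (2 * g)) / 2"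
    by (rule young_abs) (use g in simp)
  ultimately have "\<bar>(n \<bullet> H) * t\<bar> \<le> ((2 * g) * h + (3 * d) / (2 * g)) / 2"
    using g by (elim order_trans) (intro divide_right_mono add_mono mult_left_mono; simp)
  also have "((2 * g) * h + (3 * d) / (2 * g)) / 2 = g * h + 3 / 4 * (d / g)"
    by (simp add: add_divide_distrib)
  finally have 2: "(n \<bullet> H) * t \<le> g * h + 3 / 4 * (d / g)" using abs_ge_self order_trans by blast
  have "0 \<le> d" unfolding d_def by (intro sum_nonneg) auto
  then have "0 \<le> d / g" using g by simp
  then show ?thesis
    unfolding split using 1 2 by (simp add: flip: d_def h_def)
qed

context mesh begin

text \<open>Pointwise, \<open>|curl H|\<close> can only be bounded by \<open>\<surd>2\<close> times the norm of the gradient, and a factor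
  \<open>\<surd>2\<close> on the constant of the inverse inequality is too much for the time step condition. Instead,
  \<open>|curl H|\<^sup>2 = |\<nabla>H|\<^sup>2 - (div H)\<^sup>2 - div G\<close> with the field \<open>G\<close> of components
  \<open>\<Sum>j. H j * D j i - H i * D j j\<close>. The flux of \<open>G\<close> is controlled by the trace inequality for the
  components of \<open>H\<close> and for their derivatives, which are polynomials as well. The factor is thus traded
  for a multiple of the trace constant \<open>\<kappa>\<close>.\<close>

lemma curl_norm_bound:
  assumes T: "T \<in> \<T>" and H: "H \<in> poly_space3 N" and g: "g > 0" and \<kappa>: "\<kappa> \<ge> 0"
    and tr: "\<And>u. u \<in> poly_space N \<Longrightarrow>
      (\<Sum>F\<in>facets T. LINT x|surface_measure F. (u x)\<^sup>2) \<le> \<kappa> * (LINT x:T|lebesgue. (u x)\<^sup>2)"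
    and inv: "\<And>u. u \<in> poly_space N \<Longrightarrow>
      (LINT x:T|lebesgue. \<Sum>i\<in>UNIV. (partial i u x)\<^sup>2) \<le> g\<^sup>2 * (LINT x:T|lebesgue. (u x)\<^sup>2)"
  shows "(LINT x:T|lebesgue. (norm (curl H x))\<^sup>2) \<le> (g\<^sup>2 + 3 * \<kappa> * g) * (LINT x:T|lebesgue. (norm (H x))\<^sup>2)"
proof -
  note Hj = poly_space3_component[OF H]
  define D where "D i j = partial i (\<lambda>x. H x $ j)" for i j
  have Dp: "D i j \<in> poly_space N" for i j unfolding D_def by (rule partial_poly_space[OF Hj])
  have Hc: "continuous_on UNIV (\<lambda>x. H x $ j)" for j by (rule poly_space_continuous[OF Hj])
  have Dc: "continuous_on UNIV (D i j)" for i j by (rule poly_space_continuous[OF Dp])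
  define G where "G x = (\<chi> i. \<Sum>j\<in>UNIV. H x $ j * D j i x - H x $ i * D j j x)" for x
  have G: "G \<in> poly_space3 (N + N)"
    unfolding poly_space3_def G_def
    by (auto intro!: poly_space_sum poly_space_diff poly_space_mult Hj Dp)
  have pd: "partial k (\<lambda>x. G x $ k) x = (\<Sum>j\<in>UNIV. (D k j x * D j k x + H x $ j * partial k (D j k) x)
      - (D k k x * D j j x + H x $ k * partial k (D j j) x))" for k x
  proof -
    have "(\<lambda>x. H x $ j * D i l x) differentiable at x" for i j l
      using poly_space_differentiable[OF Hj] poly_space_differentiable[OF Dp] by (intro derivative_intros) auto
    then show ?thesis
      unfolding G_def vec_lambda_beta
      by (subst partial_sum; (simp add: differentiable_diff)?; subst partial_linear(2); simp?)
        (simp add: partial_mult poly_space_differentiable[OF Hj] poly_space_differentiable[OF Dp] flip: D_def)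
  qed
  have com: "partial 2 (D 1 j) x = partial 1 (D 2 j) x" "partial 3 (D 1 j) x = partial 1 (D 3 j) x"
    "partial 3 (D 2 j) x = partial 2 (D 3 j) x" for j x
    unfolding D_def by (simp_all only: partial_commute[OF Hj])
  \<comment> \<open>The second derivatives that occur in the divergence of \<open>G\<close> cancel by symmetry.\<close>
  have curl2: "(norm (curl H x))\<^sup>2 = (\<Sum>i\<in>UNIV. \<Sum>j\<in>UNIV. (D i j x)\<^sup>2)
      - (\<Sum>k\<in>UNIV. partial k (\<lambda>x. G x $ k) x) - (\<Sum>j\<in>UNIV. D j j x)\<^sup>2" for x
    unfolding power2_norm_sum pd sum_3 com curl_components[OF H] D_def[symmetric] by algebra
  have Gc: "continuous_on UNIV (\<lambda>x. \<Sum>k\<in>UNIV. partial k (\<lambda>x. G x $ k) x)"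
    by (intro continuous_intros poly_space_continuous[OF partial_poly_space[OF poly_space3_component[OF G]]])
  have D2c: "continuous_on UNIV (\<lambda>x. \<Sum>i\<in>UNIV. \<Sum>j\<in>UNIV. (D i j x)\<^sup>2)"
    by (intro continuous_intros Dc)
  define h where "h = (LINT x:T|lebesgue. (norm (H x))\<^sup>2)"
  have hsum: "h = (\<Sum>j\<in>UNIV. LINT x:T|lebesgue. (H x $ j)\<^sup>2)"
    unfolding h_def power2_norm_sum by (rule element_integral_sum[OF T]) (auto intro!: continuous_intros Hc)
  have D2: "(\<Sum>i\<in>UNIV. \<Sum>j\<in>UNIV. LINT x:T|lebesgue. (D i j x)\<^sup>2) \<le> g\<^sup>2 * h"
  proof -
    have "(\<Sum>i\<in>UNIV. \<Sum>j\<in>UNIV. LINT x:T|lebesgue. (D i j x)\<^sup>2) = (\<Sum>j\<in>UNIV. \<Sum>i\<in>UNIV. LINT x:T|lebesgue. (D i j x)\<^sup>2)"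
      by (rule sum.swap)
    also have "\<dots> = (\<Sum>j\<in>UNIV. LINT x:T|lebesgue. \<Sum>i\<in>UNIV. (partial i (\<lambda>x. H x $ j) x)\<^sup>2)"
      unfolding D_def[symmetric]
      by (intro sum.cong refl element_integral_sum[OF T, symmetric] continuous_intros Dc) simp
    also have "\<dots> \<le> (\<Sum>j\<in>UNIV. g\<^sup>2 * (LINT x:T|lebesgue. (H x $ j)\<^sup>2))"
      by (intro sum_mono inv Hj)
    finally show ?thesis by (simp add: hsum sum_distrib_left)
  qed
  have D2': "(LINT x:T|lebesgue. \<Sum>i\<in>UNIV. \<Sum>j\<in>UNIV. (D i j x)\<^sup>2) = (\<Sum>i\<in>UNIV. \<Sum>j\<in>UNIV. LINT x:T|lebesgue. (D i j x)\<^sup>2)"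
    by (subst element_integral_sum[OF T], (intro continuous_intros Dc finite)+,
        intro sum.cong refl element_integral_sum[OF T] continuous_intros Dc finite)
  have flux: "- (\<Sum>F\<in>facets T. LINT x|surface_measure F. outward_normal T F \<bullet> G x) \<le> 3 * \<kappa> * g * h"
  proof -
    let ?B = "\<lambda>x. 3 / 2 * (g * (\<Sum>j\<in>UNIV. (H x $ j)\<^sup>2) + (\<Sum>i\<in>UNIV. \<Sum>j\<in>UNIV. (D i j x)\<^sup>2) / g)"
    have "- (\<Sum>F\<in>facets T. LINT x|surface_measure F. outward_normal T F \<bullet> G x)
        = (\<Sum>F\<in>facets T. LINT x|surface_measure F. - (outward_normal T F \<bullet> G x))"
      by (simp add: sum_negf)
    also have "\<dots> \<le> (\<Sum>F\<in>facets T. LINT x|surface_measure F. ?B x)"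
    proof (intro sum_mono integral_mono)
      fix F x assume F: "F \<in> facets T"
      show "integrable (surface_measure F) (\<lambda>x. - (outward_normal T F \<bullet> G x))"
        by (intro facet_integrable_continuous[OF T F] continuous_intros poly_space3_continuous[OF G])
      show "integrable (surface_measure F) ?B"
        using g by (intro facet_integrable_continuous[OF T F] continuous_intros Hc Dc) auto
      show "- (outward_normal T F \<bullet> G x) \<le> ?B x"
        using gradient_flux_bound[OF g facet_of_normal(1)[OF simplices[OF T] F], of "H x" "\<lambda>i j. D i j x"]
        by (simp add: inner_vec_def G_def)
    qed
    also have "\<dots> = 3 / 2 * (g * (\<Sum>j\<in>UNIV. \<Sum>F\<in>facets T. LINT x|surface_measure F. (H x $ j)\<^sup>2)
        + (\<Sum>i\<in>UNIV. \<Sum>j\<in>UNIV. \<Sum>F\<in>facets T. LINT x|surface_measure F. (D i j x)\<^sup>2) / g)"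
    proof -
      have "(\<Sum>F\<in>facets T. LINT x|surface_measure F. ?B x) = (\<Sum>F\<in>facets T. 3 / 2 *
          (g * (LINT x|surface_measure F. (\<Sum>j\<in>UNIV. (H x $ j)\<^sup>2))
           + (LINT x|surface_measure F. (\<Sum>i\<in>UNIV. \<Sum>j\<in>UNIV. (D i j x)\<^sup>2)) / g))"
      proof (rule sum.cong[OF refl])
        fix F assume F: "F \<in> facets T"
        have "integrable (surface_measure F) (\<lambda>x. \<Sum>j\<in>UNIV. (H x $ j)\<^sup>2)"
          "integrable (surface_measure F) (\<lambda>x. \<Sum>i\<in>UNIV. \<Sum>j\<in>UNIV. (D i j x)\<^sup>2)"
          by (intro facet_integrable_continuous[OF T F] continuous_intros Hc Dc)+
        then show "(LINT x|surface_measure F. ?B x) = 3 / 2 *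
          (g * (LINT x|surface_measure F. (\<Sum>j\<in>UNIV. (H x $ j)\<^sup>2))
           + (LINT x|surface_measure F. (\<Sum>i\<in>UNIV. \<Sum>j\<in>UNIV. (D i j x)\<^sup>2)) / g)"
          by (simp del: Bochner_Integration.integral_sum)
      qed
      also have "\<dots> = 3 / 2 * (g * (\<Sum>F\<in>facets T. LINT x|surface_measure F. (\<Sum>j\<in>UNIV. (H x $ j)\<^sup>2))
           + (\<Sum>F\<in>facets T. LINT x|surface_measure F. (\<Sum>i\<in>UNIV. \<Sum>j\<in>UNIV. (D i j x)\<^sup>2)) / g)"
        by (simp add: sum.distrib sum_distrib_left sum_divide_distrib distrib_left)
      also have "(\<Sum>F\<in>facets T. LINT x|surface_measure F. (\<Sum>j\<in>UNIV. (H x $ j)\<^sup>2))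
          = (\<Sum>j\<in>UNIV. \<Sum>F\<in>facets T. LINT x|surface_measure F. (H x $ j)\<^sup>2)"
        by (rule facet_integral_sum[OF T]) (intro continuous_intros Hc finite)+
      also have "(\<Sum>F\<in>facets T. LINT x|surface_measure F. (\<Sum>i\<in>UNIV. \<Sum>j\<in>UNIV. (D i j x)\<^sup>2))
          = (\<Sum>i\<in>UNIV. \<Sum>j\<in>UNIV. \<Sum>F\<in>facets T. LINT x|surface_measure F. (D i j x)\<^sup>2)"
        by (subst facet_integral_sum[OF T], (intro continuous_intros Dc finite)+,
          intro sum.cong refl facet_integral_sum[OF T] continuous_intros Dc finite)
      finally show ?thesis .
    qed
    also have "\<dots> \<le> 3 / 2 * (g * (\<Sum>j\<in>UNIV. \<kappa> * (LINT x:T|lebesgue. (H x $ j)\<^sup>2))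
        + (\<Sum>i\<in>UNIV. \<Sum>j\<in>UNIV. \<kappa> * (LINT x:T|lebesgue. (D i j x)\<^sup>2)) / g)"
      using g by (intro mult_left_mono add_mono divide_right_mono sum_mono tr Hj Dp) auto
    also have "\<dots> = 3 / 2 * \<kappa> * (g * h + (\<Sum>i\<in>UNIV. \<Sum>j\<in>UNIV. LINT x:T|lebesgue. (D i j x)\<^sup>2) / g)"
      unfolding hsum sum_distrib_left[symmetric] by (simp add: algebra_simps)
    also have "\<dots> \<le> 3 / 2 * \<kappa> * (g * h + (g\<^sup>2 * h) / g)"
      using g \<kappa> by (intro mult_left_mono add_left_mono divide_right_mono D2) auto
    also have "\<dots> = 3 * \<kappa> * g * h" using g by (simp add: power2_eq_square)
    finally show ?thesis .
  qed
  have "(LINT x:T|lebesgue. (norm (curl H x))\<^sup>2)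
      \<le> (LINT x:T|lebesgue. (\<Sum>i\<in>UNIV. \<Sum>j\<in>UNIV. (D i j x)\<^sup>2) - (\<Sum>k\<in>UNIV. partial k (\<lambda>x. G x $ k) x))"
    by (rule element_integral_mono[OF T])
      (auto simp: curl2 intro!: continuous_intros Dc continuous_on_sum
        poly_space_continuous[OF partial_poly_space[OF poly_space3_component[OF G]]])
  also have "\<dots> = (LINT x:T|lebesgue. \<Sum>i\<in>UNIV. \<Sum>j\<in>UNIV. (D i j x)\<^sup>2)
      - (LINT x:T|lebesgue. \<Sum>k\<in>UNIV. partial k (\<lambda>x. G x $ k) x)"
    by (rule element_integral_linear(2)[OF T D2c Gc])
  also have "\<dots> \<le> g\<^sup>2 * h + 3 * \<kappa> * g * h"
    unfolding divergence_poly[OF T G] D2' using D2 flux by linarith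
  finally show ?thesis unfolding h_def by (simp add: algebra_simps)
qed

lemma curl_inner_bound:
  assumes T: "T \<in> \<T>" and H: "H \<in> poly_space3 N" and E: "E \<in> poly_space3 N" and g: "g > 0" and \<kappa>: "\<kappa> \<ge> 0"
    and tr: "\<And>u. u \<in> poly_space N \<Longrightarrow>
      (\<Sum>F\<in>facets T. LINT x|surface_measure F. (u x)\<^sup>2) \<le> \<kappa> * (LINT x:T|lebesgue. (u x)\<^sup>2)"
    and inv: "\<And>u. u \<in> poly_space N \<Longrightarrow>
      (LINT x:T|lebesgue. \<Sum>i\<in>UNIV. (partial i u x)\<^sup>2) \<le> g\<^sup>2 * (LINT x:T|lebesgue. (u x)\<^sup>2)"
  shows "\<bar>vol_inner T (curl H) E\<bar> \<le> (g / 2 + 3 / 4 * \<kappa>)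
    * ((LINT x:T|lebesgue. (norm (H x))\<^sup>2) + (LINT x:T|lebesgue. (norm (E x))\<^sup>2))"
proof -
  \<comment> \<open>Completing the square: \<open>g\<^sup>2 + 3 \<kappa> g \<le> s\<^sup>2\<close>.\<close>
  define s where "s = g + 3 / 2 * \<kappa>"
  have s: "s > 0" using g \<kappa> by (simp add: s_def)
  define h where "h = (LINT x:T|lebesgue. (norm (H x))\<^sup>2)"
  define c where "c = (LINT x:T|lebesgue. (norm (curl H x))\<^sup>2)"
  define e where "e = (LINT x:T|lebesgue. (norm (E x))\<^sup>2)"
  have h0: "0 \<le> h" unfolding h_def set_lebesgue_integral_def by simp
  have "c \<le> (g\<^sup>2 + 3 * \<kappa> * g) * h"
    unfolding c_def h_def by (rule curl_norm_bound[OF T H g \<kappa> tr inv])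
  also have "\<dots> \<le> s\<^sup>2 * h"
    by (intro mult_right_mono h0) (simp add: s_def power2_eq_square algebra_simps)
  finally have c: "c \<le> s\<^sup>2 * h" .
  have cont: "continuous_on UNIV (\<lambda>x. (norm (curl H x))\<^sup>2)" "continuous_on UNIV (\<lambda>x. (norm (E x))\<^sup>2)"
    "continuous_on UNIV (\<lambda>x. curl H x \<bullet> E x)"
    by (intro continuous_intros poly_space3_continuous[OF E] poly_space3_continuous[OF curl_poly_space3[OF H]])+
  have pt: "\<bar>curl H x \<bullet> E x\<bar> \<le> (norm (curl H x))\<^sup>2 / (2 * s) + s / 2 * (norm (E x))\<^sup>2" for x
  proof -
    have "\<bar>curl H x \<bullet> E x\<bar> \<le> \<bar>norm (E x) * norm (curl H x)\<bar>"
      using Cauchy_Schwarz_ineq2[of "curl H x" "E x"] by (simp add: mult.commute)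
    also have "\<dots> \<le> (s * (norm (E x))\<^sup>2 + (norm (curl H x))\<^sup>2 / s) / 2" by (rule young_abs[OF s])
    finally show ?thesis by (simp add: add_divide_distrib)
  qed
  have B: "(LINT x:T|lebesgue. (norm (curl H x))\<^sup>2 / (2 * s) + s / 2 * (norm (E x))\<^sup>2) = c / (2 * s) + s / 2 * e"
  proof -
    have "(LINT x:T|lebesgue. (norm (curl H x))\<^sup>2 / (2 * s) + s / 2 * (norm (E x))\<^sup>2)
       = (LINT x:T|lebesgue. (norm (curl H x))\<^sup>2 / (2 * s)) + (LINT x:T|lebesgue. s / 2 * (norm (E x))\<^sup>2)"
      using s by (intro element_integral_linear(1)[OF T] continuous_intros cont) auto
    then show ?thesis unfolding c_def e_def by simp
  qed
  have "\<bar>vol_inner T (curl H) E\<bar> \<le> (LINT x:T|lebesgue. (norm (curl H x))\<^sup>2 / (2 * s) + s / 2 * (norm (E x))\<^sup>2)"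
  proof (rule abs_leI)
    show "vol_inner T (curl H) E \<le> (LINT x:T|lebesgue. (norm (curl H x))\<^sup>2 / (2 * s) + s / 2 * (norm (E x))\<^sup>2)"
      unfolding vol_inner_def using s pt
      by (intro element_integral_mono[OF T] continuous_intros cont) (auto intro: order_trans[OF abs_ge_self])
    have "- vol_inner T (curl H) E = (LINT x:T|lebesgue. - (curl H x \<bullet> E x))"
      unfolding vol_inner_def set_lebesgue_integral_def by simp
    also have "\<dots> \<le> (LINT x:T|lebesgue. (norm (curl H x))\<^sup>2 / (2 * s) + s / 2 * (norm (E x))\<^sup>2)"
      using s pt
      by (intro element_integral_mono[OF T] continuous_intros cont) (auto intro: order_trans[OF abs_ge_minus_self])
    finally show "- vol_inner T (curl H) E \<le> (LINT x:T|lebesgue. (norm (curl H x))\<^sup>2 / (2 * s) + s / 2 * (norm (E x))\<^sup>2)" .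
  qed
  also have "\<dots> \<le> (s\<^sup>2 * h) / (2 * s) + s / 2 * e"
    unfolding B using c s by (intro add_right_mono divide_right_mono) auto
  also have "\<dots> = s / 2 * (h + e)" using s by (simp add: power2_eq_square algebra_simps)
  finally show ?thesis by (simp add: s_def h_def e_def add_divide_distrib)
qed

end

section \<open>Sums over facets\<close>

context mesh begin

definition interior_facets :: "((real^3) set \<times> (real^3) set) set" where
  "interior_facets = {(T, F). T \<in> \<T> \<and> F \<in> facets T \<and> \<not> F \<subseteq> frontier \<Omega>}"

definition boundary_facets :: "((real^3) set \<times> (real^3) set) set" where
  "boundary_facets = {(T, F). T \<in> \<T> \<and> F \<in> facets T \<and> F \<subseteq> frontier \<Omega>}"

text \<open>Facets are listed together with an element that they bound, so that interior facets are visited from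
  both sides.\<close>

definition facet_sum ::
  "((real^3) set \<times> (real^3) set) set \<Rightarrow> ((real^3) set \<Rightarrow> (real^3) set \<Rightarrow> real^3 \<Rightarrow> real) \<Rightarrow> real" where
  "facet_sum A \<phi> = (\<Sum>(T, F)\<in>A. LINT x|surface_measure F. \<phi> T F x)"

abbreviation all_facets where "all_facets \<equiv> Sigma \<T> facets"

abbreviation nb where "nb \<equiv> neighbour \<T>"

lemma finite_facet_sets: "finite all_facets" "finite interior_facets" "finite boundary_facets"
  and facet_partition: "all_facets = interior_facets \<union> boundary_facets" "interior_facets \<inter> boundary_facets = {}"
proof -
  show fin: "finite all_facets" using finite_mesh finite_facets by auto
  show eq: "all_facets = interior_facets \<union> boundary_facets"
    by (auto simp: interior_facets_def boundary_facets_def)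
  show "interior_facets \<inter> boundary_facets = {}"
    by (auto simp: interior_facets_def boundary_facets_def)
  show "finite interior_facets" "finite boundary_facets" using fin unfolding eq by auto
qed

lemma facet_sum_all:
  "facet_sum all_facets \<phi> = (\<Sum>T\<in>\<T>. \<Sum>F\<in>facets T. LINT x|surface_measure F. \<phi> T F x)"
  unfolding facet_sum_def using finite_mesh finite_facets by (subst sum.Sigma) auto

lemma facet_sum_split: "facet_sum all_facets \<phi> = facet_sum interior_facets \<phi> + facet_sum boundary_facets \<phi>"
  unfolding facet_sum_def facet_partition(1)
  by (rule sum.union_disjoint) (use finite_facet_sets facet_partition in auto)

text \<open>Passing to the other side of the facet is an involution on the interior facets.\<close>

lemma facet_sum_swap: "facet_sum interior_facets \<phi> = facet_sum interior_facets (\<lambda>T F. \<phi> (nb T F) F)"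
proof -
  let ?s = "\<lambda>(T, F). (nb T F, F)"
  have s: "?s p \<in> interior_facets" "?s (?s p) = p" if p: "p \<in> interior_facets" for p
  proof -
    obtain T F where TF: "p = (T, F)" "T \<in> \<T>" "F \<in> facets T" "\<not> F \<subseteq> frontier \<Omega>"
      using p unfolding interior_facets_def by blast
    note n = neighbour[OF TF(2-4)]
    show "?s p \<in> interior_facets" unfolding TF(1) interior_facets_def using n(1,3) TF(4) by simp
    show "?s (?s p) = p" unfolding TF(1) using n(5) by simp
  qed
  have "bij_betw ?s interior_facets interior_facets"
    by (rule bij_betw_byWitness[where f' = ?s]) (use s in blast)+
  from sum.reindex_bij_betw[OF this, of "\<lambda>(T, F). LINT x|surface_measure F. \<phi> T F x"]
  show ?thesis unfolding facet_sum_def by (simp add: case_prod_unfold)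
qed

text \<open>The condition under which \<open>facet_sum\<close> is additive and monotone in the integrand.\<close>

definition admissible :: "((real^3) set \<Rightarrow> (real^3) set \<Rightarrow> real^3 \<Rightarrow> real) \<Rightarrow> bool" where
  "admissible \<phi> \<longleftrightarrow> (\<forall>(T, F)\<in>all_facets. integrable (surface_measure F) (\<phi> T F))"

lemma facet_sum_add:
  assumes "admissible \<phi>" "admissible \<psi>" "A \<subseteq> all_facets"
  shows "facet_sum A (\<lambda>T F x. \<phi> T F x + \<psi> T F x) = facet_sum A \<phi> + facet_sum A \<psi>"
  unfolding facet_sum_def sum.distrib[symmetric]
proof (rule sum.cong[OF refl], clarify)
  fix T F assume "(T, F) \<in> A"
  then have "integrable (surface_measure F) (\<phi> T F)" "integrable (surface_measure F) (\<psi> T F)"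
    using assms unfolding admissible_def by blast+
  then show "(LINT x|surface_measure F. \<phi> T F x + \<psi> T F x)
      = (LINT x|surface_measure F. \<phi> T F x) + (LINT x|surface_measure F. \<psi> T F x)"
    by (rule Bochner_Integration.integral_add)
qed

lemma facet_sum_cmult: "facet_sum A (\<lambda>T F x. c * \<phi> T F x) = c * facet_sum A \<phi>"
  unfolding facet_sum_def by (simp add: sum_distrib_left case_prod_unfold)

lemma facet_sum_mono:
  assumes "admissible \<phi>" "admissible \<psi>" "A \<subseteq> all_facets"
    and le: "\<And>T F. (T, F) \<in> A \<Longrightarrow> AE x in surface_measure F. \<phi> T F x \<le> \<psi> T F x"
  shows "facet_sum A \<phi> \<le> facet_sum A \<psi>"
  unfolding facet_sum_def
proof (rule sum_mono, clarify)
  fix T F assume TF: "(T, F) \<in> A"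
  then have "integrable (surface_measure F) (\<phi> T F)" "integrable (surface_measure F) (\<psi> T F)"
    using assms unfolding admissible_def by blast+
  then show "(LINT x|surface_measure F. \<phi> T F x) \<le> (LINT x|surface_measure F. \<psi> T F x)"
    using le[OF TF] by (rule integral_mono_AE)
qed

lemma facet_sum_cong:
  assumes "admissible \<phi>" "admissible \<psi>" "A \<subseteq> all_facets"
    and "\<And>T F. (T, F) \<in> A \<Longrightarrow> AE x in surface_measure F. \<phi> T F x = \<psi> T F x"
  shows "facet_sum A \<phi> = facet_sum A \<psi>"
  by (intro antisym facet_sum_mono assms(1-3)) (auto dest!: assms(4) elim: eventually_mono)

lemma admissible_add:
  assumes "admissible \<phi>" "admissible \<psi>" shows "admissible (\<lambda>T F x. \<phi> T F x + \<psi> T F x)"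
  using assms unfolding admissible_def by auto

lemma admissible_cmult:
  assumes "admissible \<phi>" shows "admissible (\<lambda>T F x. c * \<phi> T F x)"
  using assms unfolding admissible_def by auto

subsection \<open>Weights, broken polynomial fields and jumps\<close>

text \<open>The impedances come from traces of the coefficients and are therefore only measurable and
  essentially bounded, whereas polynomial fields are continuous.\<close>

definition weight :: "((real^3) set \<Rightarrow> (real^3) set \<Rightarrow> real^3 \<Rightarrow> real) \<Rightarrow> bool" where
  "weight w \<longleftrightarrow> (\<forall>(T, F)\<in>all_facets. w T F \<in> borel_measurable (surface_measure F) \<and>
     (\<exists>B. AE x in surface_measure F. \<bar>w T F x\<bar> \<le> B))"

lemma admissible_weight:
  assumes w: "weight w" and q: "\<And>T F. (T, F) \<in> all_facets \<Longrightarrow> continuous_on UNIV (q T F)"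
  shows "admissible (\<lambda>T F x. w T F x * q T F x)"
  unfolding admissible_def
proof clarify
  fix T F assume T: "T \<in> \<T>" "F \<in> facets T"
  then obtain B where "w T F \<in> borel_measurable (surface_measure F)" "AE x in surface_measure F. \<bar>w T F x\<bar> \<le> B"
    using w unfolding weight_def by blast
  then show "integrable (surface_measure F) (\<lambda>x. w T F x * q T F x)"
    using facet_integrable[OF T q] T by blast
qed

lemma admissible_continuous:
  assumes "\<And>T F. (T, F) \<in> all_facets \<Longrightarrow> continuous_on UNIV (q T F)"
  shows "admissible q"
  using facet_integrable_continuous assms unfolding admissible_def by blast

definition broken :: "nat \<Rightarrow> ((real^3) set \<Rightarrow> real^3 \<Rightarrow> real^3) \<Rightarrow> bool" where
  "broken N X \<longleftrightarrow> (\<forall>T\<in>\<T>. X T \<in> poly_space3 N)"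

lemma broken_add: "broken N X \<Longrightarrow> broken N Y \<Longrightarrow> broken N (\<lambda>T x. X T x + Y T x)"
  by (simp add: broken_def poly_space3_add)

lemma broken_continuous: "broken N X \<Longrightarrow> T \<in> \<T> \<Longrightarrow> continuous_on S (X T)"
  by (auto simp: broken_def intro: poly_space3_continuous)

text \<open>The factor \<open>c\<close> encodes the boundary condition. Values \<open>0\<close>, \<open>1\<close> and \<open>2\<close> occur in the scheme.\<close>

definition jmp :: "real \<Rightarrow> ((real^3) set \<Rightarrow> real^3 \<Rightarrow> real^3) \<Rightarrow> (real^3) set \<Rightarrow> (real^3) set \<Rightarrow> real^3 \<Rightarrow> real^3" where
  "jmp c X T F x = (if F \<subseteq> frontier \<Omega> then c *\<^sub>R X T x else X T x - X (nb T F) x)"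

lemma neighbour_in: "(T, F) \<in> all_facets \<Longrightarrow> \<not> F \<subseteq> frontier \<Omega> \<Longrightarrow> nb T F \<in> \<T>"
  using neighbour(1) by auto

lemma jmp_continuous:
  assumes X: "broken N X" and T: "(T, F) \<in> all_facets"
  shows "continuous_on UNIV (jmp c X T F)"
  unfolding jmp_def using T neighbour_in[OF T]
  by (cases "F \<subseteq> frontier \<Omega>") (auto intro!: continuous_intros broken_continuous[OF X])

definition tang :: "(real^3) set \<Rightarrow> (real^3) set \<Rightarrow> real^3 \<Rightarrow> real^3" where
  "tang T F v = cross3 (outward_normal T F) v"

lemma tang_continuous:
  fixes f :: "real^3 \<Rightarrow> real^3"
  shows "continuous_on S f \<Longrightarrow> continuous_on S (\<lambda>x. tang T F (f x))"
  unfolding tang_def by (rule continuous_on_cross[OF continuous_on_const])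

lemma tang_linear:
  "tang T F (u + v) = tang T F u + tang T F v" "tang T F (u - v) = tang T F u - tang T F v"
  "tang T F (c *\<^sub>R u) = c *\<^sub>R tang T F u"
  unfolding tang_def by (simp_all add: cross_add_right cross_mult_right Cross3.right_diff_distrib)

lemma tang_skew: "tang T F u \<bullet> v = - (tang T F v \<bullet> u)"
  unfolding tang_def inner_vec_def sum_3 cross_components inner_real_def by algebra

lemma tang_neighbour:
  assumes "(T, F) \<in> interior_facets" shows "tang (nb T F) F v = - tang T F v"
proof -
  have "T \<in> \<T>" "F \<in> facets T" "\<not> F \<subseteq> frontier \<Omega>" using assms unfolding interior_facets_def by blast+
  from neighbour(4)[OF this] show ?thesis by (simp add: tang_def)
qed

lemma tang_norm:
  assumes "(T, F) \<in> all_facets" shows "norm (tang T F v) \<le> norm v"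
proof -
  have T: "T \<in> \<T>" "F \<in> facets T" using assms by blast+
  have "norm (outward_normal T F) = 1" by (rule facet_of_normal(1)[OF simplices[OF T(1)] T(2)])
  then have "(norm (tang T F v))\<^sup>2 + (outward_normal T F \<bullet> v)\<^sup>2 = (norm v)\<^sup>2"
    using norm_cross_dot[of "outward_normal T F" v] by (simp add: tang_def)
  moreover have "0 \<le> (outward_normal T F \<bullet> v)\<^sup>2" by simp
  ultimately have "(norm (tang T F v))\<^sup>2 \<le> (norm v)\<^sup>2" by linarith
  then show ?thesis by (rule power2_le_imp_le) simp
qed

subsection \<open>The penalty forms\<close>

text \<open>The part of the flux that is multiplied by \<open>\<alpha>\<close>, tested with \<open>Y\<close>.\<close>

definition pen where
  "pen w c X Y = facet_sum all_facets (\<lambda>T F x. w T F x * (tang T F (jmp c X T F x) \<bullet> tang T F (Y T x)))"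

text \<open>An interior facet occurs twice in the sum, with the two restrictions of \<open>Y\<close>. Together they give
  one jump of \<open>Y\<close>, which is then shared equally between the two occurrences.\<close>

definition pen_factor :: "real \<Rightarrow> (real^3) set \<Rightarrow> real" where
  "pen_factor c F = (if F \<subseteq> frontier \<Omega> then c else 1 / 2)"

lemma pen_symmetric_form:
  assumes w: "weight w" and X: "broken N X" and Y: "broken N Y"
    and wsym: "\<And>T F x. (T, F) \<in> interior_facets \<Longrightarrow> w (nb T F) F x = w T F x"
  shows "pen w c X Y = facet_sum all_facets (\<lambda>T F x. w T F x *
    (pen_factor c F * (tang T F (jmp 1 X T F x) \<bullet> tang T F (jmp 1 Y T F x))))"
proof -
  let ?\<phi> = "\<lambda>T F x. w T F x * (tang T F (jmp c X T F x) \<bullet> tang T F (Y T x))"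
  let ?\<psi> = "\<lambda>T F x. w T F x * (pen_factor c F * (tang T F (jmp 1 X T F x) \<bullet> tang T F (jmp 1 Y T F x)))"
  have sub: "interior_facets \<subseteq> all_facets" "boundary_facets \<subseteq> all_facets" using facet_partition by auto
  have a\<phi>: "admissible ?\<phi>"
    by (intro admissible_weight[OF w] continuous_on_inner tang_continuous jmp_continuous[OF X] broken_continuous[OF Y]) auto
  have a\<psi>: "admissible ?\<psi>"
    by (intro admissible_weight[OF w] continuous_on_mult continuous_on_const continuous_on_inner tang_continuous
        jmp_continuous[OF X] jmp_continuous[OF Y])
  define \<theta> where "\<theta> T F x = w T F x * (if F \<subseteq> frontier \<Omega> then 0 else tang T F (jmp 1 X T F x) \<bullet> tang T F (Y (nb T F) x))" for T F x
  have a\<theta>: "admissible \<theta>"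
    unfolding \<theta>_def
  proof (intro admissible_weight[OF w])
    fix T F assume T: "(T, F) \<in> all_facets"
    show "continuous_on UNIV (\<lambda>x. if F \<subseteq> frontier \<Omega> then 0 else tang T F (jmp 1 X T F x) \<bullet> tang T F (Y (nb T F) x))"
      using neighbour_in[OF T]
      by (cases "F \<subseteq> frontier \<Omega>") (auto intro!: continuous_on_inner tang_continuous jmp_continuous[OF X T] broken_continuous[OF Y])
  qed
  have swap: "facet_sum interior_facets ?\<phi> = facet_sum interior_facets (\<lambda>T F x. (-1) * \<theta> T F x)"
  proof -
    have "facet_sum interior_facets ?\<phi> = facet_sum interior_facets (\<lambda>T F. ?\<phi> (nb T F) F)"
      by (rule facet_sum_swap)
    also have "\<dots> = facet_sum interior_facets (\<lambda>T F x. (-1) * \<theta> T F x)"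
      unfolding facet_sum_def
    proof (rule sum.cong[OF refl], clarify)
      fix T F assume TF: "(T, F) \<in> interior_facets"
      then have i: "\<not> F \<subseteq> frontier \<Omega>" "nb (nb T F) F = T"
        using neighbour(5) by (auto simp: interior_facets_def)
      have "?\<phi> (nb T F) F x = (-1) * \<theta> T F x" for x
        using i by (simp add: \<theta>_def wsym[OF TF] tang_neighbour[OF TF] jmp_def tang_linear inner_diff_left algebra_simps)
      then show "(LINT x|surface_measure F. ?\<phi> (nb T F) F x) = (LINT x|surface_measure F. (-1) * \<theta> T F x)"
        by (simp only:)
    qed
    finally show ?thesis .
  qed
  have "2 * facet_sum interior_facets ?\<phi> = facet_sum interior_facets (\<lambda>T F x. ?\<phi> T F x + (-1) * \<theta> T F x)"
    using facet_sum_add[OF a\<phi> admissible_cmult[OF a\<theta>] sub(1), of "-1"] swap by simp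
  also have "\<dots> = facet_sum interior_facets (\<lambda>T F x. 2 * ?\<psi> T F x)"
    by (intro facet_sum_cong admissible_add admissible_cmult a\<phi> a\<theta> a\<psi> sub always_eventually allI)
      (auto simp: interior_facets_def \<theta>_def jmp_def pen_factor_def tang_linear inner_diff_right algebra_simps)
  finally have "facet_sum interior_facets ?\<phi> = facet_sum interior_facets ?\<psi>"
    by (simp add: facet_sum_cmult)
  moreover have "facet_sum boundary_facets ?\<phi> = facet_sum boundary_facets ?\<psi>"
    by (intro facet_sum_cong a\<phi> a\<psi> sub always_eventually allI)
      (auto simp: boundary_facets_def jmp_def pen_factor_def tang_linear)
  ultimately show ?thesis unfolding pen_def facet_sum_split by simp
qed

context
  fixes w and N :: nat and c :: real
  assumes w: "weight w" and c: "0 \<le> c"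
    and wsym: "\<And>T F x. (T, F) \<in> interior_facets \<Longrightarrow> w (nb T F) F x = w T F x"
    and nonneg: "\<And>T F. (T, F) \<in> all_facets \<Longrightarrow> AE x in surface_measure F. 0 \<le> w T F x"
begin

lemma pen_admissible:
  assumes X: "broken N X" and Y: "broken N Y"
  shows "admissible (\<lambda>T F x. w T F x * (pen_factor c F * (tang T F (jmp 1 X T F x) \<bullet> tang T F (jmp 1 Y T F x))))"
  by (intro admissible_weight[OF w] continuous_on_mult continuous_on_const continuous_on_inner tang_continuous
        jmp_continuous[OF X] jmp_continuous[OF Y])

lemma pen_eq:
  assumes "broken N X" "broken N Y"
  shows "pen w c X Y = facet_sum all_facets (\<lambda>T F x. w T F x *
    (pen_factor c F * (tang T F (jmp 1 X T F x) \<bullet> tang T F (jmp 1 Y T F x))))"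
  by (rule pen_symmetric_form[OF w assms wsym])

lemma pen_nonneg:
  assumes X: "broken N X" shows "0 \<le> pen w c X X"
proof -
  have "facet_sum all_facets (\<lambda>T F x. 0 * (w T F x * (pen_factor c F * (tang T F (jmp 1 X T F x) \<bullet> tang T F (jmp 1 X T F x)))))
      \<le> pen w c X X"
    unfolding pen_eq[OF X X]
  proof (intro facet_sum_mono admissible_cmult pen_admissible X order_refl)
    fix T F assume "(T, F) \<in> all_facets"
    from nonneg[OF this] show "AE x in surface_measure F. 0 * (w T F x * (pen_factor c F * (tang T F (jmp 1 X T F x) \<bullet> tang T F (jmp 1 X T F x))))
       \<le> w T F x * (pen_factor c F * (tang T F (jmp 1 X T F x) \<bullet> tang T F (jmp 1 X T F x)))"
      by eventually_elim (simp add: pen_factor_def c)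
  qed
  then show ?thesis unfolding facet_sum_cmult by simp
qed

text \<open>This is \<open>|a|\<^sup>2 - |b|\<^sup>2 \<le> |a + b|\<^sup>2 + |a|\<^sup>2 - |b|\<^sup>2 = 2 a \<bullet> (a + b)\<close> for the symmetric form \<open>pen\<close>. The scheme
  evaluates the jumps at the old time \<open>X\<close> only, so the penalty terms need not dissipate energy in a step,
  but they dissipate it up to an increment of the form itself.\<close>

lemma pen_monotone:
  assumes X: "broken N X" and Y: "broken N Y"
  shows "pen w c X X - pen w c Y Y \<le> 2 * pen w c X (\<lambda>T x. Y T x + X T x)"
proof -
  let ?q = "\<lambda>X Y T F x. w T F x * (pen_factor c F * (tang T F (jmp 1 X T F x) \<bullet> tang T F (jmp 1 Y T F x)))"
  let ?Z = "\<lambda>T x. Y T x + X T x"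
  have Z: "broken N ?Z" by (rule broken_add[OF Y X])
  note ad = pen_admissible
  have "facet_sum all_facets (?q X X) + (-1) * facet_sum all_facets (?q Y Y)
      = facet_sum all_facets (\<lambda>T F x. ?q X X T F x + (-1) * ?q Y Y T F x)"
    by (subst facet_sum_add[OF ad[OF X X] admissible_cmult[OF ad[OF Y Y]] order_refl]) (simp only: facet_sum_cmult)
  also have "\<dots> \<le> facet_sum all_facets (\<lambda>T F x. 2 * ?q X ?Z T F x)"
  proof (intro facet_sum_mono admissible_add admissible_cmult ad X Y Z order_refl)
    fix T F assume "(T, F) \<in> all_facets"
    from nonneg[OF this] show "AE x in surface_measure F. ?q X X T F x + (-1) * ?q Y Y T F x \<le> 2 * ?q X ?Z T F x"
    proof eventually_elim
      case (elim x)
      define a b where "a = tang T F (jmp 1 X T F x)" and "b = tang T F (jmp 1 Y T F x)"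
      have "jmp 1 ?Z T F x = jmp 1 Y T F x + jmp 1 X T F x" by (simp add: jmp_def)
      then have ab: "tang T F (jmp 1 ?Z T F x) = b + a"
        by (simp add: a_def b_def tang_linear)
      have "0 \<le> (a + b) \<bullet> (a + b)" by simp
      then have "a \<bullet> a - b \<bullet> b \<le> 2 * (a \<bullet> (b + a))" by (simp add: inner_simps inner_commute)
      then have "w T F x * pen_factor c F * (a \<bullet> a - b \<bullet> b) \<le> w T F x * pen_factor c F * (2 * (a \<bullet> (b + a)))"
        using elim c by (intro mult_left_mono) (auto simp: pen_factor_def)
      then show ?case unfolding ab by (simp add: algebra_simps flip: a_def b_def)
    qed
  qed
  also have "\<dots> = 2 * facet_sum all_facets (?q X ?Z)" by (rule facet_sum_cmult)
  finally show ?thesis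
    unfolding pen_eq[OF X X] pen_eq[OF Y Y] pen_eq[OF X Z] by simp
qed

text \<open>The squared jump is at most twice the sum of the squared values on both sides. This factor and the
  double occurrence of interior facets are absorbed by the factor \<open>1 / 2\<close> on the left and the one in
  the symmetric form.\<close>

lemma pen_bound:
  assumes X: "broken N X"
    and i: "\<And>T F. (T, F) \<in> interior_facets \<Longrightarrow> AE x in surface_measure F. w T F x \<le> K"
    and b: "\<And>T F. (T, F) \<in> boundary_facets \<Longrightarrow> AE x in surface_measure F. w T F x * c / 2 \<le> K"
  shows "pen w c X X / 2 \<le> K * facet_sum all_facets (\<lambda>T F x. (norm (X T x))\<^sup>2)"
proof -
  let ?q = "\<lambda>T F x. w T F x * (pen_factor c F * (tang T F (jmp 1 X T F x) \<bullet> tang T F (jmp 1 X T F x)))"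
  let ?h = "\<lambda>T F x. 1 / 2 * ?q T F x"
  let ?n = "\<lambda>T F x. (norm (X T x))\<^sup>2"
  define n' where "n' T F x = (if F \<subseteq> frontier \<Omega> then 0 else (norm (X (nb T F) x))\<^sup>2)" for T F x
  have sub: "interior_facets \<subseteq> all_facets" "boundary_facets \<subseteq> all_facets" using facet_partition by auto
  have ah: "admissible ?h" by (intro admissible_cmult pen_admissible X)
  have an: "admissible ?n" by (intro admissible_continuous continuous_intros broken_continuous[OF X]) auto
  have an': "admissible n'"
  proof (rule admissible_continuous)
    fix T F assume T: "(T, F) \<in> all_facets"
    show "continuous_on UNIV (n' T F)"
      unfolding n'_def using neighbour_in[OF T]
      by (cases "F \<subseteq> frontier \<Omega>") (auto intro!: continuous_intros broken_continuous[OF X])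
  qed
  have "facet_sum interior_facets ?h \<le> facet_sum interior_facets (\<lambda>T F x. K / 2 * ?n T F x + K / 2 * n' T F x)"
  proof (intro facet_sum_mono ah admissible_add admissible_cmult an an' sub)
    fix T F assume TF: "(T, F) \<in> interior_facets"
    then have TF': "(T, F) \<in> all_facets" "\<not> F \<subseteq> frontier \<Omega>" by (auto simp: interior_facets_def)
    from i[OF TF] nonneg[OF TF'(1)]
    show "AE x in surface_measure F. ?h T F x \<le> K / 2 * ?n T F x + K / 2 * n' T F x"
    proof eventually_elim
      case (elim x)
      define u v where "u = X T x" and "v = X (nb T F) x"
      have "tang T F (u - v) \<bullet> tang T F (u - v) \<le> (norm (u - v))\<^sup>2"
        using tang_norm[OF TF'(1), of "u - v"] by (simp add: power_mono flip: power2_norm_eq_inner)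
      also have "\<dots> \<le> (norm (u - v))\<^sup>2 + (norm (u + v))\<^sup>2" by simp
      also have "\<dots> = 2 * ((norm u)\<^sup>2 + (norm v)\<^sup>2)"
        by (simp add: power2_norm_eq_inner inner_simps inner_commute)
      finally have "w T F x * (tang T F (u - v) \<bullet> tang T F (u - v)) \<le> K * (2 * ((norm u)\<^sup>2 + (norm v)\<^sup>2))"
        using elim by (intro mult_mono) auto
      then show ?case using TF'(2) by (simp add: pen_factor_def jmp_def n'_def u_def v_def algebra_simps)
    qed
  qed
  also have "\<dots> = K / 2 * facet_sum interior_facets ?n + K / 2 * facet_sum interior_facets n'"
    by (subst facet_sum_add[OF admissible_cmult[OF an] admissible_cmult[OF an'] sub(1)]) (simp only: facet_sum_cmult)
  also have "facet_sum interior_facets n' = facet_sum interior_facets ?n"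
  proof -
    have "facet_sum interior_facets ?n = facet_sum interior_facets (\<lambda>T F. ?n (nb T F) F)"
      by (rule facet_sum_swap)
    also have "\<dots> = facet_sum interior_facets n'"
      unfolding facet_sum_def
    proof (rule sum.cong[OF refl], clarify)
      fix T F assume "(T, F) \<in> interior_facets"
      then have "n' T F = ?n (nb T F)  F" by (simp add: n'_def fun_eq_iff interior_facets_def)
      then show "(LINT x|surface_measure F. ?n (nb T F) F x) = (LINT x|surface_measure F. n' T F x)" by simp
    qed
    finally show ?thesis ..
  qed
  finally have 1: "facet_sum interior_facets ?h \<le> K * facet_sum interior_facets ?n" by simp
  have "facet_sum boundary_facets ?h \<le> facet_sum boundary_facets (\<lambda>T F x. K * ?n T F x)"
  proof (intro facet_sum_mono ah admissible_cmult an sub)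
    fix T F assume TF: "(T, F) \<in> boundary_facets"
    then have TF': "(T, F) \<in> all_facets" "F \<subseteq> frontier \<Omega>" by (auto simp: boundary_facets_def)
    from b[OF TF] nonneg[OF TF'(1)]
    show "AE x in surface_measure F. ?h T F x \<le> K * ?n T F x"
    proof eventually_elim
      case (elim x)
      have le: "tang T F (X T x) \<bullet> tang T F (X T x) \<le> (norm (X T x))\<^sup>2"
        using tang_norm[OF TF'(1), of "X T x"] by (simp add: power_mono flip: power2_norm_eq_inner)
      have "(w T F x * c / 2) * (tang T F (X T x) \<bullet> tang T F (X T x)) \<le> K * (norm (X T x))\<^sup>2"
      proof (rule mult_mono)
        have "0 \<le> w T F x * c / 2" using elim(2) c by simp
        then show "0 \<le> K" using elim(1) by linarith
      qed (use elim le in auto)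
      then show ?case using TF'(2) by (simp add: pen_factor_def jmp_def algebra_simps)
    qed
  qed
  then have "facet_sum boundary_facets ?h \<le> K * facet_sum boundary_facets ?n" by (simp only: facet_sum_cmult)
  moreover have "pen w c X X / 2 = facet_sum interior_facets ?h + facet_sum boundary_facets ?h"
    unfolding pen_eq[OF X X] facet_sum_split facet_sum_cmult by simp
  ultimately show ?thesis using 1 unfolding facet_sum_split by (simp add: distrib_left)
qed

end

subsection \<open>The discrete curl\<close>

text \<open>The curl together with the centred part of the flux, tested with \<open>Y\<close>.\<close>

definition dcurl where
  "dcurl w c X Y = (\<Sum>T\<in>\<T>. vol_inner T (curl (X T)) (Y T))
     - facet_sum all_facets (\<lambda>T F x. w T F x * (tang T F (jmp c X T F x) \<bullet> Y T x))"

lemma dcurl_admissible: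
  assumes w: "weight w" and X: "broken N X" and Y: "broken N Y"
  shows "admissible (\<lambda>T F x. w T F x * (tang T F (jmp c X T F x) \<bullet> Y T x))"
  by (intro admissible_weight[OF w] continuous_on_inner tang_continuous jmp_continuous[OF X] broken_continuous[OF Y]) auto

lemma dcurl_add:
  assumes w: "weight w" and X: "broken N X" and Y: "broken N Y" and Z: "broken N Z"
  shows "dcurl w c X (\<lambda>T x. Y T x + Z T x) = dcurl w c X Y + dcurl w c X Z"
proof -
  have "vol_inner T (curl (X T)) (\<lambda>x. Y T x + Z T x) = vol_inner T (curl (X T)) (Y T) + vol_inner T (curl (X T)) (Z T)"
    if T: "T \<in> \<T>" for T
  proof -
    have XT: "X T \<in> poly_space3 N" using X T by (simp add: broken_def)
    show ?thesis
      unfolding vol_inner_def inner_add_right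
      by (intro element_integral_linear(1)[OF T] continuous_on_inner poly_space3_continuous[OF curl_poly_space3[OF XT]]
          broken_continuous[OF Y T] broken_continuous[OF Z T])
  qed
  then have 1: "(\<Sum>T\<in>\<T>. vol_inner T (curl (X T)) (\<lambda>x. Y T x + Z T x))
      = (\<Sum>T\<in>\<T>. vol_inner T (curl (X T)) (Y T)) + (\<Sum>T\<in>\<T>. vol_inner T (curl (X T)) (Z T))"
    by (simp add: sum.distrib)
  have 2: "facet_sum all_facets (\<lambda>T F x. w T F x * (tang T F (jmp c X T F x) \<bullet> (Y T x + Z T x)))
      = facet_sum all_facets (\<lambda>T F x. w T F x * (tang T F (jmp c X T F x) \<bullet> Y T x))
        + facet_sum all_facets (\<lambda>T F x. w T F x * (tang T F (jmp c X T F x) \<bullet> Z T x))"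
    by (subst facet_sum_add[OF dcurl_admissible[OF w X Y] dcurl_admissible[OF w X Z] order_refl, symmetric])
      (simp add: inner_add_right distrib_left)
  show ?thesis unfolding dcurl_def 1 2 by simp
qed

lemma facet_sum_zero: "facet_sum A (\<lambda>T F x. 0) = 0"
  by (simp add: facet_sum_def case_prod_unfold)

text \<open>Integrating the curl by parts on every element leaves the boundary integrals of
  \<open>(n \<times> X) \<bullet> Y\<close>. On an interior facet with weight \<open>w\<close>, and weight \<open>1 - w\<close> seen from the other side, they
  cancel in pairs against the two weighted jump terms, and on the boundary they cancel because the two
  factors add up to \<open>2\<close>. This is why the scheme averages with impedances in one equation and with
  admittances in the other one.\<close>

lemma dcurl_adjoint:
  assumes w: "weight w" and w': "weight w'" and X: "broken N X" and Y: "broken N Y" and c: "c + c' = 2"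
    and i: "\<And>T F. (T, F) \<in> interior_facets \<Longrightarrow> AE x in surface_measure F.
      w T F x + w' T F x = 1 \<and> w (nb T F) F x = w' T F x \<and> w' (nb T F) F x = w T F x"
    and b: "\<And>T F. (T, F) \<in> boundary_facets \<Longrightarrow> AE x in surface_measure F. w T F x = 1 / 2 \<and> w' T F x = 1 / 2"
  shows "dcurl w c X Y = dcurl w' c' Y X"
proof -
  define p where "p T F x = tang T F (X T x) \<bullet> Y T x" for T F x
  define q where "q T F x = w T F x * (tang T F (jmp c X T F x) \<bullet> Y T x)" for T F x
  define r where "r T F x = w' T F x * (tang T F (jmp c' Y T F x) \<bullet> X T x)" for T F x
  have ap: "admissible p"
    unfolding p_def by (intro admissible_continuous continuous_on_inner tang_continuous broken_continuous[OF X] broken_continuous[OF Y]) auto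
  have aq: "admissible q" unfolding q_def by (rule dcurl_admissible[OF w X Y])
  have ar: "admissible r" unfolding r_def by (rule dcurl_admissible[OF w' Y X])
  define s where "s T F x = p T F x + (-1) * q T F x + r T F x" for T F x
  have as: "admissible s" unfolding s_def by (intro admissible_add admissible_cmult ap aq ar)
  have "dcurl w c X Y - dcurl w' c' Y X
      = (\<Sum>T\<in>\<T>. vol_inner T (curl (X T)) (Y T) - vol_inner T (curl (Y T)) (X T))
        - facet_sum all_facets q + facet_sum all_facets r"
    unfolding dcurl_def q_def r_def by (simp add: sum_subtractf)
  also have "(\<Sum>T\<in>\<T>. vol_inner T (curl (X T)) (Y T) - vol_inner T (curl (Y T)) (X T)) = facet_sum all_facets p"
    unfolding facet_sum_all
  proof (rule sum.cong[OF refl])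
    fix T assume T: "T \<in> \<T>"
    have "X T \<in> poly_space3 N" "Y T \<in> poly_space3 N" using X Y T by (auto simp: broken_def)
    from curl_by_parts[OF T this]
    show "vol_inner T (curl (X T)) (Y T) - vol_inner T (curl (Y T)) (X T) = (\<Sum>F\<in>facets T. LINT x|surface_measure F. p T F x)"
      by (simp add: p_def tang_def)
  qed
  also have "facet_sum all_facets p - facet_sum all_facets q + facet_sum all_facets r = facet_sum all_facets s"
    unfolding s_def
    by (subst facet_sum_add[OF admissible_add[OF ap admissible_cmult[OF aq]] ar order_refl],
        subst facet_sum_add[OF ap admissible_cmult[OF aq] order_refl], subst facet_sum_cmult) simp
  also have "\<dots> = 0"
  proof -
    have sub: "interior_facets \<subseteq> all_facets" "boundary_facets \<subseteq> all_facets" using facet_partition by auto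
    have "facet_sum boundary_facets s = facet_sum boundary_facets (\<lambda>T F x. 0)"
    proof (rule facet_sum_cong[OF as _ sub(2)])
      show "admissible (\<lambda>T F x. 0)" by (simp add: admissible_def case_prod_unfold)
      fix T F assume TF: "(T, F) \<in> boundary_facets"
      then have F: "F \<subseteq> frontier \<Omega>" by (simp add: boundary_facets_def)
      from b[OF TF] show "AE x in surface_measure F. s T F x = 0"
      proof eventually_elim
        case (elim x)
        have "s T F x = (1 - (c + c') / 2) * (tang T F (X T x) \<bullet> Y T x)"
          using F unfolding s_def p_def q_def r_def jmp_def conjunct1[OF elim] conjunct2[OF elim]
          by (simp add: tang_linear tang_skew[of T F "Y T x" "X T x"] algebra_simps add_divide_distrib)
        then show ?case using c by simp
      qed
    qed
    then have bd: "facet_sum boundary_facets s = 0" by (simp add: facet_sum_zero)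
    have "facet_sum interior_facets s = facet_sum interior_facets (\<lambda>T F. s (nb T F) F)" by (rule facet_sum_swap)
    also have "\<dots> = facet_sum interior_facets (\<lambda>T F x. (-1) * s T F x)"
      unfolding facet_sum_def
    proof (rule sum.cong[OF refl], clarify)
      fix T F assume TF: "(T, F) \<in> interior_facets"
      then have T: "T \<in> \<T>" "F \<in> facets T" "\<not> F \<subseteq> frontier \<Omega>" unfolding interior_facets_def by blast+
      note n = neighbour[OF T]
      have ae: "AE x in surface_measure F. s (nb T F) F x = (-1) * s T F x"
        using i[OF TF]
      proof eventually_elim
        case (elim x)
        define a a' b b' where "a = X T x" and "a' = X (nb T F) x" and "b = Y T x" and "b' = Y (nb T F) x"
        have w': "w' T F x = 1 - w T F x" using elim by simp
        have s1: "s T F x = tang T F a \<bullet> b - w T F x * (tang T F (a - a') \<bullet> b) + (1 - w T F x) * (tang T F (b - b') \<bullet> a)"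
          using T(3) by (simp add: s_def p_def q_def r_def jmp_def w' a_def a'_def b_def b'_def)
        have s2: "s (nb T F) F x = - (tang T F a' \<bullet> b') - (1 - w T F x) * (- (tang T F (a' - a) \<bullet> b')) + w T F x * (- (tang T F (b' - b) \<bullet> a'))"
          using T(3) elim n(5) by (simp add: s_def p_def q_def r_def jmp_def w' tang_neighbour[OF TF] a_def a'_def b_def b'_def)
        have sk: "tang T F b \<bullet> a = - (tang T F a \<bullet> b)" "tang T F b' \<bullet> a = - (tang T F a \<bullet> b')"
          "tang T F b \<bullet> a' = - (tang T F a' \<bullet> b)" "tang T F b' \<bullet> a' = - (tang T F a' \<bullet> b')"
          by (rule tang_skew)+
        show ?case unfolding s1 s2 tang_linear inner_diff_left sk by algebra
      qed
      have "integrable (surface_measure F) (s T F)" "integrable (surface_measure F) (s (nb T F) F)"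
        using as T n unfolding admissible_def by blast+
      then show "(LINT x|surface_measure F. s (nb T F) F x) = (LINT x|surface_measure F. (-1) * s T F x)"
        by (intro integral_cong_AE ae) (auto dest: borel_measurable_integrable)
    qed
    also have "\<dots> = - facet_sum interior_facets s" unfolding facet_sum_cmult by simp
    finally show ?thesis unfolding facet_sum_split bd by simp
  qed
  finally show ?thesis by simp
qed

subsection \<open>Bounds in terms of the norms on the elements\<close>

definition broken_norm2 :: "((real^3) set \<Rightarrow> real^3 \<Rightarrow> real^3) \<Rightarrow> real" where
  "broken_norm2 X = (\<Sum>T\<in>\<T>. LINT x:T|lebesgue. (norm (X T x))\<^sup>2)"

lemma broken_norm2_nonneg: "0 \<le> broken_norm2 X"
  unfolding broken_norm2_def set_lebesgue_integral_def by (intro sum_nonneg) simp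

context
  fixes N :: nat and \<kappa> g :: real
  assumes \<kappa>: "0 \<le> \<kappa>" and g: "0 < g"
    and tr: "\<And>T u. T \<in> \<T> \<Longrightarrow> u \<in> poly_space N \<Longrightarrow>
      (\<Sum>F\<in>facets T. LINT x|surface_measure F. (u x)\<^sup>2) \<le> \<kappa> * (LINT x:T|lebesgue. (u x)\<^sup>2)"
    and inv: "\<And>T u. T \<in> \<T> \<Longrightarrow> u \<in> poly_space N \<Longrightarrow>
      (LINT x:T|lebesgue. \<Sum>i\<in>UNIV. (partial i u x)\<^sup>2) \<le> g\<^sup>2 * (LINT x:T|lebesgue. (u x)\<^sup>2)"
begin

lemma facet_norm_bound:
  assumes X: "broken N X"
  shows "facet_sum all_facets (\<lambda>T F x. (norm (X T x))\<^sup>2) \<le> \<kappa> * broken_norm2 X"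
  unfolding facet_sum_all broken_norm2_def sum_distrib_left
proof (rule sum_mono)
  fix T assume T: "T \<in> \<T>"
  have Xj: "(\<lambda>x. X T x $ j) \<in> poly_space N" for j
    using X T by (auto simp: broken_def intro: poly_space3_component)
  have c: "continuous_on UNIV (\<lambda>x. (X T x $ j)\<^sup>2)" for j
    by (intro continuous_intros poly_space_continuous[OF Xj])
  have "(\<Sum>F\<in>facets T. LINT x|surface_measure F. (norm (X T x))\<^sup>2)
      = (\<Sum>j\<in>UNIV. \<Sum>F\<in>facets T. LINT x|surface_measure F. (X T x $ j)\<^sup>2)"
    unfolding power2_norm_sum by (rule facet_integral_sum[OF T c finite])
  also have "\<dots> \<le> (\<Sum>j\<in>UNIV. \<kappa> * (LINT x:T|lebesgue. (X T x $ j)\<^sup>2))"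
    by (intro sum_mono tr T Xj)
  also have "\<dots> = \<kappa> * (LINT x:T|lebesgue. (norm (X T x))\<^sup>2)"
    unfolding power2_norm_sum by (subst element_integral_sum[OF T c finite]) (simp add: sum_distrib_left)
  finally show "(\<Sum>F\<in>facets T. LINT x|surface_measure F. (norm (X T x))\<^sup>2) \<le> \<kappa> * (LINT x:T|lebesgue. (norm (X T x))\<^sup>2)" .
qed

text \<open>By the inequality of Young a jump costs half the squared norm of each one-sided value and the squared
  norm of \<open>Y\<close>. The value of the neighbour is charged to the boundary of the neighbour. The sign \<open>s\<close>
  gives both bounds at once.\<close>

lemma dcurl_facet_bound:
  assumes w: "weight w" and X: "broken N X" and Y: "broken N Y" and c: "0 \<le> c" "c \<le> 2" and s: "\<bar>s\<bar> \<le> 1"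
    and i: "\<And>T F. (T, F) \<in> interior_facets \<Longrightarrow> AE x in surface_measure F. 0 \<le> w T F x \<and> w T F x \<le> 1"
    and b: "\<And>T F. (T, F) \<in> boundary_facets \<Longrightarrow> AE x in surface_measure F. w T F x = 1 / 2"
  shows "s * facet_sum all_facets (\<lambda>T F x. w T F x * (tang T F (jmp c X T F x) \<bullet> Y T x))
    \<le> \<kappa> * (broken_norm2 X + broken_norm2 Y)"
proof -
  let ?q = "\<lambda>T F x. s * (w T F x * (tang T F (jmp c X T F x) \<bullet> Y T x))"
  let ?x = "\<lambda>T F x. (norm (X T x))\<^sup>2" and ?y = "\<lambda>T F x. (norm (Y T x))\<^sup>2"
  define x' where "x' T F x = (if F \<subseteq> frontier \<Omega> then 0 else (norm (X (nb T F) x))\<^sup>2)" for T F x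
  have sub: "interior_facets \<subseteq> all_facets" "boundary_facets \<subseteq> all_facets" using facet_partition by auto
  have aq: "admissible ?q" by (intro admissible_cmult dcurl_admissible[OF w X Y])
  have ax: "admissible ?x" by (intro admissible_continuous continuous_intros broken_continuous[OF X]) auto
  have ay: "admissible ?y" by (intro admissible_continuous continuous_intros broken_continuous[OF Y]) auto
  have ax': "admissible x'"
  proof (rule admissible_continuous)
    fix T F assume T: "(T, F) \<in> all_facets"
    show "continuous_on UNIV (x' T F)"
      unfolding x'_def using neighbour_in[OF T]
      by (cases "F \<subseteq> frontier \<Omega>") (auto intro!: continuous_intros broken_continuous[OF X])
  qed
  have pt: "s * (r * (tang T F v \<bullet> u)) \<le> norm v * norm u" if "0 \<le> r" "r \<le> 1" "(T, F) \<in> all_facets" for r T F u v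
  proof -
    have "\<bar>tang T F v \<bullet> u\<bar> \<le> norm (tang T F v) * norm u" by (rule Cauchy_Schwarz_ineq2)
    also have "\<dots> \<le> norm v * norm u" by (intro mult_right_mono tang_norm that) simp
    finally have t: "\<bar>tang T F v \<bullet> u\<bar> \<le> norm v * norm u" .
    have "s * (r * (tang T F v \<bullet> u)) \<le> \<bar>s\<bar> * (\<bar>r\<bar> * \<bar>tang T F v \<bullet> u\<bar>)"
      by (metis abs_ge_self abs_mult)
    also have "\<dots> \<le> 1 * (1 * (norm v * norm u))"
      using s that t by (intro mult_mono) auto
    finally show ?thesis by simp
  qed
  have yo: "a * e \<le> a\<^sup>2 / 2 + e\<^sup>2 / 2" for a e :: real
    using sum_squares_bound[of a e] by simp
  have "facet_sum interior_facets ?q \<le> facet_sum interior_facets (\<lambda>T F x. (1 / 2 * ?x T F x + 1 / 2 * x' T F x) + ?y T F x)"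
  proof (intro facet_sum_mono aq admissible_add admissible_cmult ax ay ax' sub)
    fix T F assume TF: "(T, F) \<in> interior_facets"
    then have TF': "(T, F) \<in> all_facets" "\<not> F \<subseteq> frontier \<Omega>" by (auto simp: interior_facets_def)
    from i[OF TF] show "AE x in surface_measure F. ?q T F x \<le> (1 / 2 * ?x T F x + 1 / 2 * x' T F x) + ?y T F x"
    proof eventually_elim
      case (elim x)
      have "?q T F x \<le> norm (X T x - X (nb T F) x) * norm (Y T x)"
        using pt[of "w T F x", OF _ _ TF'(1)] elim TF'(2) by (simp add: jmp_def)
      also have "\<dots> \<le> (norm (X T x) + norm (X (nb T F) x)) * norm (Y T x)"
        by (intro mult_right_mono norm_triangle_ineq4) simp
      also have "\<dots> \<le> 1 / 2 * (norm (X T x))\<^sup>2 + 1 / 2 * (norm (X (nb T F) x))\<^sup>2 + (norm (Y T x))\<^sup>2"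
        using yo[of "norm (X T x)" "norm (Y T x)"] yo[of "norm (X (nb T F) x)" "norm (Y T x)"] by (simp add: distrib_right)
      finally show ?case using TF'(2) by (simp add: x'_def)
    qed
  qed
  also have "\<dots> = 1 / 2 * facet_sum interior_facets ?x + 1 / 2 * facet_sum interior_facets x' + facet_sum interior_facets ?y"
    by (subst facet_sum_add[OF admissible_add[OF admissible_cmult[OF ax] admissible_cmult[OF ax']] ay sub(1)],
        subst facet_sum_add[OF admissible_cmult[OF ax] admissible_cmult[OF ax'] sub(1)]) (simp only: facet_sum_cmult)
  also have "facet_sum interior_facets x' = facet_sum interior_facets ?x"
  proof -
    have "facet_sum interior_facets ?x = facet_sum interior_facets (\<lambda>T F. ?x (nb T F) F)"
      by (rule facet_sum_swap)
    also have "\<dots> = facet_sum interior_facets x'"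
      unfolding facet_sum_def
    proof (rule sum.cong[OF refl], clarify)
      fix T F assume "(T, F) \<in> interior_facets"
      then have "x' T F = ?x (nb T F) F" by (simp add: x'_def fun_eq_iff interior_facets_def)
      then show "(LINT x|surface_measure F. ?x (nb T F) F x) = (LINT x|surface_measure F. x' T F x)" by simp
    qed
    finally show ?thesis ..
  qed
  finally have 1: "facet_sum interior_facets ?q \<le> facet_sum interior_facets ?x + facet_sum interior_facets ?y" by simp
  have "facet_sum boundary_facets ?q \<le> facet_sum boundary_facets (\<lambda>T F x. ?x T F x + ?y T F x)"
  proof (intro facet_sum_mono aq admissible_add ax ay sub)
    fix T F assume TF: "(T, F) \<in> boundary_facets"
    then have TF': "(T, F) \<in> all_facets" "F \<subseteq> frontier \<Omega>" by (auto simp: boundary_facets_def)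
    from b[OF TF] show "AE x in surface_measure F. ?q T F x \<le> ?x T F x + ?y T F x"
    proof eventually_elim
      case (elim x)
      have "?q T F x = s * ((c / 2) * (tang T F (X T x) \<bullet> Y T x))"
        using elim TF'(2) by (simp add: jmp_def tang_linear)
      also have "\<dots> \<le> norm (X T x) * norm (Y T x)" using pt[of "c / 2", OF _ _ TF'(1)] c by simp
      also have "\<dots> \<le> ?x T F x + ?y T F x"
        using yo[of "norm (X T x)" "norm (Y T x)"] zero_le_power2[of "norm (X T x)"] zero_le_power2[of "norm (Y T x)"] by linarith
      finally show ?case .
    qed
  qed
  also have "\<dots> = facet_sum boundary_facets ?x + facet_sum boundary_facets ?y"
    by (rule facet_sum_add[OF ax ay sub(2)])
  finally have 2: "facet_sum boundary_facets ?q \<le> facet_sum boundary_facets ?x + facet_sum boundary_facets ?y" .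
  have "s * facet_sum all_facets (\<lambda>T F x. w T F x * (tang T F (jmp c X T F x) \<bullet> Y T x)) = facet_sum all_facets ?q"
    by (simp only: facet_sum_cmult)
  also have "\<dots> \<le> facet_sum all_facets ?x + facet_sum all_facets ?y"
    using 1 2 by (simp add: facet_sum_split)
  also have "\<dots> \<le> \<kappa> * broken_norm2 X + \<kappa> * broken_norm2 Y"
    by (intro add_mono facet_norm_bound X Y)
  finally show ?thesis by (simp add: distrib_left)
qed

text \<open>The trace constant enters with the factor \<open>3 / 4\<close> from the volume terms and with the factor \<open>1\<close> from
  the jumps. The constant \<open>3\<close> leaves room for both.\<close>

lemma dcurl_bound:
  assumes w: "weight w" and X: "broken N X" and Y: "broken N Y" and c: "0 \<le> c" "c \<le> 2"
    and i: "\<And>T F. (T, F) \<in> interior_facets \<Longrightarrow> AE x in surface_measure F. 0 \<le> w T F x \<and> w T F x \<le> 1"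
    and b: "\<And>T F. (T, F) \<in> boundary_facets \<Longrightarrow> AE x in surface_measure F. w T F x = 1 / 2"
  shows "\<bar>dcurl w c X Y\<bar> \<le> (g / 2 + 3 * \<kappa>) * (broken_norm2 X + broken_norm2 Y)"
proof -
  let ?f = "facet_sum all_facets (\<lambda>T F x. w T F x * (tang T F (jmp c X T F x) \<bullet> Y T x))"
  let ?v = "\<Sum>T\<in>\<T>. vol_inner T (curl (X T)) (Y T)"
  have f: "\<bar>?f\<bar> \<le> \<kappa> * (broken_norm2 X + broken_norm2 Y)"
    using dcurl_facet_bound[OF w X Y c _ i b, of 1] dcurl_facet_bound[OF w X Y c _ i b, of "-1"] by (simp add: abs_le_iff)
  have "\<bar>?v\<bar> \<le> (\<Sum>T\<in>\<T>. \<bar>vol_inner T (curl (X T)) (Y T)\<bar>)" by (rule sum_abs)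
  also have "\<dots> \<le> (\<Sum>T\<in>\<T>. (g / 2 + 3 / 4 * \<kappa>) *
      ((LINT x:T|lebesgue. (norm (X T x))\<^sup>2) + (LINT x:T|lebesgue. (norm (Y T x))\<^sup>2)))"
  proof (rule sum_mono)
    fix T assume T: "T \<in> \<T>"
    have "X T \<in> poly_space3 N" "Y T \<in> poly_space3 N" using X Y T by (auto simp: broken_def)
    then show "\<bar>vol_inner T (curl (X T)) (Y T)\<bar> \<le> (g / 2 + 3 / 4 * \<kappa>) *
      ((LINT x:T|lebesgue. (norm (X T x))\<^sup>2) + (LINT x:T|lebesgue. (norm (Y T x))\<^sup>2))"
      by (rule curl_inner_bound[OF T _ _ g \<kappa> tr[OF T] inv[OF T]])
  qed
  also have "\<dots> = (g / 2 + 3 / 4 * \<kappa>) * (broken_norm2 X + broken_norm2 Y)"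
    unfolding broken_norm2_def by (simp only: sum_distrib_left[symmetric] sum.distrib)
  finally have v: "\<bar>?v\<bar> \<le> (g / 2 + 3 / 4 * \<kappa>) * (broken_norm2 X + broken_norm2 Y)" .
  have "\<bar>dcurl w c X Y\<bar> \<le> \<bar>?v\<bar> + \<bar>?f\<bar>" unfolding dcurl_def by (rule abs_triangle_ineq4)
  also have "\<dots> \<le> (g / 2 + 3 / 4 * \<kappa> + \<kappa>) * (broken_norm2 X + broken_norm2 Y)"
    using v f by (simp add: distrib_right)
  also have "\<dots> \<le> (g / 2 + 3 * \<kappa>) * (broken_norm2 X + broken_norm2 Y)"
    using \<kappa> by (intro mult_right_mono add_nonneg_nonneg broken_norm2_nonneg) auto
  finally show ?thesis .
qed

end

end

section \<open>Mass forms and norms\<close>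

context mesh begin

lemma spd_form_integrable:
  assumes T: "T \<in> \<T>" and A: "A \<in> borel_measurable lebesgue" "\<And>x. A x \<in> spd lo hi" and lo: "lo > 0"
    and f: "continuous_on UNIV f" and u: "continuous_on UNIV u"
  shows "(\<lambda>x. u x \<bullet> (A x *v f x)) \<in> borel_measurable lebesgue"
    "set_integrable lebesgue T (\<lambda>x. u x \<bullet> (A x *v f x))"
proof -
  have [measurable]: "(\<lambda>x. A x $ i $ j) \<in> borel_measurable lebesgue" for i j
    using measurable_compose[OF A(1) borel_measurable_continuous_onI[OF continuous_mat_entry]] .
  have comp: "(\<lambda>x. h x $ i) \<in> borel_measurable lebesgue" if "continuous_on UNIV h" for h :: "real^3 \<Rightarrow> real^3" and i
    using that by (intro measurable_completion) (simp add: borel_measurable_continuous_onI continuous_on_component)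
  note [measurable] = comp[OF f] comp[OF u]
  show meas: "(\<lambda>x. u x \<bullet> (A x *v f x)) \<in> borel_measurable lebesgue"
    unfolding matrix_form_3 by measurable
  have cont: "continuous_on UNIV (\<lambda>x. hi * ((norm (u x))\<^sup>2 + (norm (f x))\<^sup>2) / 2)"
    by (intro continuous_intros f u) simp
  show "set_integrable lebesgue T (\<lambda>x. u x \<bullet> (A x *v f x))"
    unfolding set_integrable_def
  proof (rule Bochner_Integration.integrable_bound[OF element_integrable[OF T cont, unfolded set_integrable_def]])
    show "(\<lambda>x. indicator T x *\<^sub>R (u x \<bullet> (A x *v f x))) \<in> borel_measurable lebesgue"
      using meas mesh_sets(2)[OF T] by measurable
    have "\<bar>u x \<bullet> (A x *v f x)\<bar> \<le> hi * ((norm (u x))\<^sup>2 + (norm (f x))\<^sup>2) / 2" for x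
      using spd_bilinear_bound[OF A(2)] lo by simp
    then show "AE x in lebesgue. norm (indicator T x *\<^sub>R (u x \<bullet> (A x *v f x)))
        \<le> norm (indicator T x *\<^sub>R (hi * ((norm (u x))\<^sup>2 + (norm (f x))\<^sup>2) / 2))"
      by (intro always_eventually allI) (auto simp: indicator_def intro: order_trans[OF _ abs_ge_self])
  qed
qed

lemma vol_inner_representative:
  assumes T: "T \<in> \<T>" and A': "A' \<in> borel_measurable lebesgue" "\<And>x. A' x \<in> spd lo hi"
      "AE x in lebesgue. x \<in> closure \<Omega> \<longrightarrow> A x = A' x" and lo: "lo > 0"
    and f: "continuous_on UNIV f" and u: "continuous_on UNIV u"
  shows "vol_inner T (\<lambda>x. A x *v f x) u = (LINT x:T|lebesgue. u x \<bullet> (A' x *v f x))"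
  unfolding vol_inner_def set_lebesgue_integral_def
proof (rule lebesgue_cong_AE(1)[symmetric])
  show "(\<lambda>x. indicator T x *\<^sub>R (u x \<bullet> (A' x *v f x))) \<in> borel_measurable lebesgue"
    using spd_form_integrable(1)[OF T A'(1,2) lo f u] mesh_sets(2)[OF T] by measurable
  have "T \<subseteq> closure \<Omega>" using T Union_mesh by blast
  then show "AE x in lebesgue. indicator T x *\<^sub>R (u x \<bullet> (A' x *v f x)) = indicator T x *\<^sub>R ((A x *v f x) \<bullet> u x)"
    using A'(3) by (elim eventually_mono) (auto simp: indicator_def inner_commute)
qed

definition mass :: "(real^3 \<Rightarrow> real^3^3) \<Rightarrow> ((real^3) set \<Rightarrow> real^3 \<Rightarrow> real^3) \<Rightarrow> real" where
  "mass A X = (\<Sum>T\<in>\<T>. vol_inner T (\<lambda>x. A x *v X T x) (X T))"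

lemma mass_bounds:
  assumes A: "coefficient \<Omega> A lo hi" "lo > 0" and X: "broken N X"
  shows "lo * broken_norm2 X \<le> mass A X" "mass A X \<le> hi * broken_norm2 X"
proof -
  obtain A' where A': "A' \<in> borel_measurable lebesgue" "\<And>x. A' x \<in> spd lo hi"
    "AE x in lebesgue. x \<in> closure \<Omega> \<longrightarrow> A x = A' x"
    using coefficient_representative[OF A(1)] by blast
  have "lo * (LINT x:T|lebesgue. (norm (X T x))\<^sup>2) \<le> vol_inner T (\<lambda>x. A x *v X T x) (X T) \<and>
      vol_inner T (\<lambda>x. A x *v X T x) (X T) \<le> hi * (LINT x:T|lebesgue. (norm (X T x))\<^sup>2)" if T: "T \<in> \<T>" for T
  proof -
    have c: "continuous_on UNIV (X T)" by (rule broken_continuous[OF X T])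
    have i: "set_integrable lebesgue T (\<lambda>x. a * (norm (X T x))\<^sup>2)" for a
      by (intro element_integrable[OF T] continuous_intros c)
    have q: "lo * (norm (X T x))\<^sup>2 \<le> X T x \<bullet> (A' x *v X T x)" "X T x \<bullet> (A' x *v X T x) \<le> hi * (norm (X T x))\<^sup>2" for x
      using A'(2)[of x] unfolding spd_def by blast+
    note j = spd_form_integrable(2)[OF T A'(1,2) A(2) c c]
    have "(LINT x:T|lebesgue. lo * (norm (X T x))\<^sup>2) \<le> (LINT x:T|lebesgue. X T x \<bullet> (A' x *v X T x))"
      "(LINT x:T|lebesgue. X T x \<bullet> (A' x *v X T x)) \<le> (LINT x:T|lebesgue. hi * (norm (X T x))\<^sup>2)"
      by (rule set_integral_mono[OF i j], rule q(1)) (rule set_integral_mono[OF j i], rule q(2))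
    then show ?thesis
      unfolding vol_inner_representative[OF T A' A(2) c c] by simp
  qed
  then show "lo * broken_norm2 X \<le> mass A X" "mass A X \<le> hi * broken_norm2 X"
    unfolding mass_def broken_norm2_def sum_distrib_left by (auto intro!: sum_mono)
qed

text \<open>By symmetry of the coefficient the mixed terms of the increment tested with the sum cancel.\<close>

lemma mass_increment:
  assumes A: "coefficient \<Omega> A lo hi" "lo > 0" and X: "broken N X" and Y: "broken N Y"
  shows "(\<Sum>T\<in>\<T>. vol_inner T (\<lambda>x. A x *v ((X T x - Y T x) /\<^sub>R dt)) (\<lambda>x. X T x + Y T x))
    = (mass A X - mass A Y) / dt"
proof -
  obtain A' where A': "A' \<in> borel_measurable lebesgue" "\<And>x. A' x \<in> spd lo hi"
    "AE x in lebesgue. x \<in> closure \<Omega> \<longrightarrow> A x = A' x"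
    using coefficient_representative[OF A(1)] by blast
  have "vol_inner T (\<lambda>x. A x *v ((X T x - Y T x) /\<^sub>R dt)) (\<lambda>x. X T x + Y T x)
      = (vol_inner T (\<lambda>x. A x *v X T x) (X T) - vol_inner T (\<lambda>x. A x *v Y T x) (Y T)) / dt" if T: "T \<in> \<T>" for T
  proof -
    have c: "continuous_on UNIV (X T)" "continuous_on UNIV (Y T)" by (rule broken_continuous[OF X T] broken_continuous[OF Y T])+
    have c1: "continuous_on UNIV (\<lambda>x. (X T x - Y T x) /\<^sub>R dt)" "continuous_on UNIV (\<lambda>x. X T x + Y T x)"
      by (intro continuous_intros c)+
    note j = spd_form_integrable(2)[OF T A'(1,2) A(2)]
    have eq: "(X T x + Y T x) \<bullet> (A' x *v ((X T x - Y T x) /\<^sub>R dt))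
        = (X T x \<bullet> (A' x *v X T x) - Y T x \<bullet> (A' x *v Y T x)) / dt" for x
    proof -
      have "A' x *v ((X T x - Y T x) /\<^sub>R dt) = (A' x *v X T x - A' x *v Y T x) /\<^sub>R dt"
        using matrix_vector_mul_linear[of "A' x"] by (simp add: linear_scale linear_diff)
      then show ?thesis
        using spd_symmetric[OF A'(2)[of x], of "X T x" "Y T x"]
        by (simp add: inner_simps divide_inverse algebra_simps)
    qed
    show ?thesis
      unfolding vol_inner_representative[OF T A' A(2) c1] vol_inner_representative[OF T A' A(2) c(1) c(1)]
        vol_inner_representative[OF T A' A(2) c(2) c(2)] eq
      using j[OF c(1) c(1)] j[OF c(2) c(2)] by simp
  qed
  then show ?thesis unfolding mass_def by (simp add: sum_subtractf sum_divide_distrib diff_divide_distrib)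
qed

lemma broken_piece:
  assumes "v \<in> dg_space \<T> N" shows "broken N (piece N v)"
  unfolding broken_def using piece(1)[OF assms] simplex_nonempty_interior mesh_sets(2) by blast

text \<open>The elements overlap in null sets and cover the domain up to its frontier, which is a null set.\<close>

lemma L2_norm_broken:
  assumes v: "v \<in> dg_space \<T> N"
  shows "(L2_norm \<Omega> v)\<^sup>2 = broken_norm2 (piece N v)"
proof -
  let ?p = "\<lambda>T x. (norm (piece N v T x))\<^sup>2" and ?v = "\<lambda>x. (norm (v x))\<^sup>2"
  have T: "set_integrable lebesgue T ?v" "(LINT x:T|lebesgue. ?v x) = (LINT x:T|lebesgue. ?p T x)" if T: "T \<in> \<T>" for T
  proof -
    have i: "set_integrable lebesgue T (?p T)"
      by (intro element_integrable[OF T] continuous_intros broken_continuous[OF broken_piece[OF v] T])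
    have "AE x in lebesgue. x \<in> T \<longrightarrow> v x = piece N v T x"
      using piece(2)[OF v T simplex_nonempty_interior[OF T] mesh_sets(2)[OF T]] mesh_sets(2)[OF T]
      by (simp add: AE_restrict_space_iff)
    then have ae: "AE x in lebesgue. indicator T x *\<^sub>R ?p T x = indicator T x *\<^sub>R ?v x"
      by eventually_elim (auto simp: indicator_def)
    have m: "(\<lambda>x. indicator T x *\<^sub>R ?p T x) \<in> borel_measurable lebesgue"
      using i unfolding set_integrable_def by (rule borel_measurable_integrable)
    show "set_integrable lebesgue T ?v" "(LINT x:T|lebesgue. ?v x) = (LINT x:T|lebesgue. ?p T x)"
      using lebesgue_cong_AE[OF m ae] i unfolding set_integrable_def set_lebesgue_integral_def by simp_all
  qed
  have U: "set_integrable lebesgue (\<Union>T\<in>\<T>. T) ?v" by (rule set_integrable_UN[OF finite_mesh]) (use T in auto)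
  have "(LINT x:(\<Union>T\<in>\<T>. T)|lebesgue. ?v x) = (\<Sum>T\<in>\<T>. LINT x:T|lebesgue. ?v x)"
  proof (rule set_integral_finite_UN_AE[OF finite_mesh])
    fix T T' assume TT: "T \<in> \<T>" "T' \<in> \<T>"
    show "AE x in lebesgue. x \<in> T \<and> x \<in> T' \<longrightarrow> T = T'"
    proof (cases "T = T'")
      case False
      then have "T \<inter> T' \<in> null_sets lebesgue" using negligible_Int[OF TT] by (simp add: negligible_iff_null_sets)
      then have "AE x in lebesgue. x \<notin> T \<inter> T'" by (rule AE_not_in)
      then show ?thesis by eventually_elim blast
    qed simp
  qed (use T in auto)
  also have "\<dots> = broken_norm2 (piece N v)" unfolding broken_norm2_def by (intro sum.cong refl T)
  finally have 1: "(LINT x:(\<Union>T\<in>\<T>. T)|lebesgue. ?v x) = broken_norm2 (piece N v)" .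
  have "frontier \<Omega> \<in> null_sets lebesgue" using negligible_frontier by (simp add: negligible_iff_null_sets)
  then have fr: "AE x in lebesgue. x \<notin> frontier \<Omega>" by (rule AE_not_in)
  have eqU: "(\<Union>T\<in>\<T>. T) = closure \<Omega>" using Union_mesh by simp
  have op: "open \<Omega>" using domain by (simp add: polyhedral_domain_def)
  have "AE x in lebesgue. indicator (\<Union>T\<in>\<T>. T) x *\<^sub>R ?v x = indicator \<Omega> x *\<^sub>R ?v x"
    using fr
  proof eventually_elim
    case (elim x)
    then have "x \<in> closure \<Omega> \<longleftrightarrow> x \<in> \<Omega>" using op closure_subset[of \<Omega>] by (auto simp: frontier_def interior_open)
    then show ?case unfolding eqU by (simp add: indicator_def)
  qed
  from lebesgue_cong_AE(1)[OF borel_measurable_integrable[OF U[unfolded set_integrable_def]] this]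
  have 2: "(LINT x:\<Omega>|lebesgue. ?v x) = broken_norm2 (piece N v)" using 1 unfolding set_lebesgue_integral_def by simp
  then show ?thesis unfolding L2_norm_def 2 by (simp add: broken_norm2_nonneg)
qed

section \<open>Weights of the numerical flux\<close>

text \<open>Both fluxes have the same structure if \<open>Z\<close> stands for the impedance in one and for the
  admittance in the other one: \<open>avg\<close> is the averaging weight of the jump in the centred part and \<open>pwt\<close>
  is the weight of the penalty term, where \<open>a\<close> is the flux parameter on each facet.\<close>

definition opposite where
  "opposite Z T F x = (if F \<subseteq> frontier \<Omega> then Z T F x else Z (nb T F) F x :: real)"

definition avg where
  "avg Z T F x = opposite Z T F x / (opposite Z T F x + Z T F x)"

definition pwt where
  "pwt a Z T F x = a F / (opposite Z T F x + Z T F x)"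

definition impedance where
  "impedance Z lo hi \<longleftrightarrow> 0 < lo \<and> (\<forall>T\<in>\<T>. \<forall>F\<in>facets T. Z T F \<in> borel_measurable (surface_measure F) \<and>
     (AE x in surface_measure F. lo \<le> Z T F x \<and> Z T F x \<le> (hi::real)))"

context
  fixes Z :: "(real^3) set \<Rightarrow> (real^3) set \<Rightarrow> real^3 \<Rightarrow> real" and lo hi :: real
  assumes imp: "impedance Z lo hi"
begin

lemma meas: "T \<in> \<T> \<Longrightarrow> F \<in> facets T \<Longrightarrow> Z T F \<in> borel_measurable (surface_measure F)"
  and bounds: "T \<in> \<T> \<Longrightarrow> F \<in> facets T \<Longrightarrow> AE x in surface_measure F. lo \<le> Z T F x \<and> Z T F x \<le> hi"
  and lo: "lo > 0"
  using imp unfolding impedance_def by blast+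

lemma opposite_props:
  assumes T: "T \<in> \<T>" "F \<in> facets T"
  shows "opposite Z T F \<in> borel_measurable (surface_measure F)"
    "AE x in surface_measure F. lo \<le> opposite Z T F x \<and> opposite Z T F x \<le> hi"
proof -
  have "opposite Z T F = Z T F \<and> F \<subseteq> frontier \<Omega> \<or> opposite Z T F = Z (nb T F) F \<and> \<not> F \<subseteq> frontier \<Omega>"
    by (auto simp: opposite_def fun_eq_iff)
  then show "opposite Z T F \<in> borel_measurable (surface_measure F)"
    "AE x in surface_measure F. lo \<le> opposite Z T F x \<and> opposite Z T F x \<le> hi"
    using meas[OF T] bounds[OF T] meas[OF neighbour(1,3)[OF T]] bounds[OF neighbour(1,3)[OF T]]
    by (elim disjE conjE; simp)+
qed

lemma avg_weight: "weight (avg Z)"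
  unfolding weight_def
proof clarify
  fix T F assume T: "T \<in> \<T>" "F \<in> facets T"
  have "avg Z T F \<in> borel_measurable (surface_measure F)"
    using meas[OF T] opposite_props(1)[OF T] unfolding avg_def by measurable
  moreover have "AE x in surface_measure F. \<bar>avg Z T F x\<bar> \<le> 1"
    using bounds[OF T] opposite_props(2)[OF T] by eventually_elim (use lo in \<open>auto simp: avg_def\<close>)
  ultimately show "avg Z T F \<in> borel_measurable (surface_measure F) \<and> (\<exists>B. AE x in surface_measure F. \<bar>avg Z T F x\<bar> \<le> B)"
    by blast
qed

lemma avg_bounds:
  assumes T: "T \<in> \<T>" "F \<in> facets T"
  shows "AE x in surface_measure F. 0 \<le> avg Z T F x \<and> avg Z T F x \<le> 1"
  using bounds[OF T] opposite_props(2)[OF T] by eventually_elim (use lo in \<open>auto simp: avg_def\<close>)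

lemma avg_boundary:
  assumes "(T, F) \<in> boundary_facets"
  shows "AE x in surface_measure F. avg Z T F x = 1 / 2"
proof -
  have T: "T \<in> \<T>" "F \<in> facets T" "F \<subseteq> frontier \<Omega>" using assms unfolding boundary_facets_def by blast+
  show ?thesis using bounds[OF T(1,2)] by eventually_elim (use lo T(3) in \<open>auto simp: avg_def opposite_def\<close>)
qed

lemma opposite_neighbour:
  assumes "(T, F) \<in> interior_facets"
  shows "opposite Z (nb T F) F x = Z T F x" "opposite Z T F x = Z (nb T F) F x"
proof -
  have T: "T \<in> \<T>" "F \<in> facets T" "\<not> F \<subseteq> frontier \<Omega>" using assms unfolding interior_facets_def by blast+
  show "opposite Z (nb T F) F x = Z T F x" "opposite Z T F x = Z (nb T F) F x"
    unfolding opposite_def neighbour(5)[OF T] using T(3) by simp_all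
qed

lemma avg_complement:
  assumes "T \<in> \<T>" "F \<in> facets T"
  shows "AE x in surface_measure F. avg (\<lambda>T F x. 1 / Z T F x) T F x = Z T F x / (opposite Z T F x + Z T F x)
    \<and> avg Z T F x + Z T F x / (opposite Z T F x + Z T F x) = 1"
  using bounds[OF assms] opposite_props(2)[OF assms]
proof eventually_elim
  case (elim x)
  define p q where "p = opposite Z T F x" and "q = Z T F x"
  have pq: "p > 0" "q > 0" using elim lo by (auto simp: p_def q_def)
  have o: "opposite (\<lambda>T F x. 1 / Z T F x) T F x = 1 / p" by (simp add: opposite_def p_def)
  have "1 / p / (1 / p + 1 / q) = q / (p + q)" "p / (p + q) + q / (p + q) = 1"
    using pq by (simp_all add: divide_simps)
  then show ?case unfolding avg_def o p_def[symmetric] q_def[symmetric] by simp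
qed

lemma pwt_weight: "weight (pwt a Z)"
  unfolding weight_def
proof clarify
  fix T F assume T: "T \<in> \<T>" "F \<in> facets T"
  have "pwt a Z T F \<in> borel_measurable (surface_measure F)"
    using meas[OF T] opposite_props(1)[OF T] unfolding pwt_def by measurable
  moreover have "AE x in surface_measure F. \<bar>pwt a Z T F x\<bar> \<le> \<bar>a F\<bar> / (2 * lo)"
    using bounds[OF T] opposite_props(2)[OF T]
  proof eventually_elim
    case (elim x)
    have "\<bar>pwt a Z T F x\<bar> = \<bar>a F\<bar> / (opposite Z T F x + Z T F x)" using elim lo by (simp add: pwt_def)
    also have "\<dots> \<le> \<bar>a F\<bar> / (2 * lo)" by (rule frac_le) (use elim lo in auto)
    finally show ?case .
  qed
  ultimately show "pwt a Z T F \<in> borel_measurable (surface_measure F) \<and> (\<exists>B. AE x in surface_measure F. \<bar>pwt a Z T F x\<bar> \<le> B)"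
    by blast
qed

lemma pwt_neighbour:
  assumes "(T, F) \<in> interior_facets" shows "pwt a Z (nb T F) F x = pwt a Z T F x"
  unfolding pwt_def opposite_neighbour[OF assms] by (simp add: add.commute)

lemma pwt_bounds:
  assumes T: "T \<in> \<T>" "F \<in> facets T" and a: "0 \<le> a F"
  shows "AE x in surface_measure F. 0 \<le> pwt a Z T F x \<and> pwt a Z T F x \<le> a F / (2 * min_over_faces \<T> Z)"
proof -
  have m: "AE x in surface_measure F. min_over_faces \<T> Z \<le> Z T' F x" if "T' \<in> \<T>" "F \<in> facets T'" for T'
    by (rule min_over_faces_bound(2)[where f = Z, OF bounds that])
  have pos: "lo \<le> min_over_faces \<T> Z" by (rule min_over_faces_bound(1)[where f = Z, OF bounds])
  have "AE x in surface_measure F. min_over_faces \<T> Z \<le> opposite Z T F x"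
    using m[OF T] m[OF neighbour(1,3)[OF T]] by (cases "F \<subseteq> frontier \<Omega>") (simp_all add: opposite_def)
  with m[OF T] show ?thesis
  proof eventually_elim
    case (elim x)
    then show ?case
      unfolding pwt_def using pos lo a by (intro conjI frac_le divide_nonneg_nonneg) auto
  qed
qed

end

end

section \<open>The energy of the scheme\<close>

text \<open>On the outer boundary the jumps of the fields are these multiples of the values inside.\<close>

definition bc_factor_E :: "boundary_condition \<Rightarrow> real" where
  "bc_factor_E bc = (case bc of PEC \<Rightarrow> 2 | PMC \<Rightarrow> 0 | Silver_Mueller \<Rightarrow> 1)"

definition bc_factor_H :: "boundary_condition \<Rightarrow> real" where
  "bc_factor_H bc = (case bc of PEC \<Rightarrow> 0 | PMC \<Rightarrow> 2 | Silver_Mueller \<Rightarrow> 1)"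

lemma bc_factors: "bc_factor_H bc + bc_factor_E bc = 2" "0 \<le> bc_factor_E bc" "0 \<le> bc_factor_H bc"
  by (cases bc; simp add: bc_factor_E_def bc_factor_H_def)+

context mesh begin

lemma jump_jmp:
  "jump_E bc \<Omega> \<T> X T F x = jmp (bc_factor_E bc) X T F x"
  "jump_H bc \<Omega> \<T> X T F x = jmp (bc_factor_H bc) X T F x"
  by (cases bc; simp add: jump_E_def jump_H_def jmp_def bc_factor_E_def bc_factor_H_def)+

lemma impedance_opposite:
  "Zp \<Omega> \<T> \<epsilon>t \<mu>t T F x = opposite (Zm \<epsilon>t \<mu>t) T F x" "Yp \<Omega> \<T> \<epsilon>t \<mu>t T F x = opposite (Ym \<epsilon>t \<mu>t) T F x"
  by (simp_all add: Zp_def Yp_def opposite_def Ym_def)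

lemma flux_inner:
  "flux_E bc \<Omega> \<T> \<epsilon>t \<mu>t \<alpha> E H T F x \<bullet> u
    = avg (Zm \<epsilon>t \<mu>t) T F x * (tang T F (jmp (bc_factor_H bc) H T F x) \<bullet> u)
      + pwt (flux_param bc \<Omega> \<alpha>) (Zm \<epsilon>t \<mu>t) T F x * (tang T F (jmp (bc_factor_E bc) E T F x) \<bullet> tang T F u)"
  "flux_H bc \<Omega> \<T> \<epsilon>t \<mu>t \<alpha> E H T F x \<bullet> u
    = avg (Ym \<epsilon>t \<mu>t) T F x * (tang T F (jmp (bc_factor_E bc) E T F x) \<bullet> u)
      + (-1) * (pwt (flux_param bc \<Omega> \<alpha>) (Ym \<epsilon>t \<mu>t) T F x * (tang T F (jmp (bc_factor_H bc) H T F x) \<bullet> tang T F u))"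
proof -
  have "tang T F (tang T F v) \<bullet> u = - (tang T F v \<bullet> tang T F u)" for v
    using tang_skew[of T F "tang T F v" u] by (simp add: inner_commute)
  then show "flux_E bc \<Omega> \<T> \<epsilon>t \<mu>t \<alpha> E H T F x \<bullet> u
    = avg (Zm \<epsilon>t \<mu>t) T F x * (tang T F (jmp (bc_factor_H bc) H T F x) \<bullet> u)
      + pwt (flux_param bc \<Omega> \<alpha>) (Zm \<epsilon>t \<mu>t) T F x * (tang T F (jmp (bc_factor_E bc) E T F x) \<bullet> tang T F u)"
    "flux_H bc \<Omega> \<T> \<epsilon>t \<mu>t \<alpha> E H T F x \<bullet> u
    = avg (Ym \<epsilon>t \<mu>t) T F x * (tang T F (jmp (bc_factor_E bc) E T F x) \<bullet> u)
      + (-1) * (pwt (flux_param bc \<Omega> \<alpha>) (Ym \<epsilon>t \<mu>t) T F x * (tang T F (jmp (bc_factor_H bc) H T F x) \<bullet> tang T F u))"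
    unfolding flux_E_def flux_H_def Let_def impedance_opposite jump_jmp avg_def pwt_def tang_def[symmetric]
    by (simp_all add: tang_linear inner_diff_left inner_add_left diff_divide_distrib add_divide_distrib)
qed

context
  fixes \<epsilon> \<mu> :: "real^3 \<Rightarrow> real^3^3" and \<epsilon>t \<mu>t :: "(real^3) set \<Rightarrow> real^3 \<Rightarrow> real^3^3"
    and \<epsilon>lo \<epsilon>hi \<mu>lo \<mu>hi \<alpha> \<Delta>t zlo zhi :: real and N :: nat and bc :: boundary_condition
  assumes \<epsilon>: "coefficient \<Omega> \<epsilon> \<epsilon>lo \<epsilon>hi" "\<epsilon>lo > 0" and \<mu>: "coefficient \<Omega> \<mu> \<mu>lo \<mu>hi" "\<mu>lo > 0"
    and \<alpha>: "0 \<le> \<alpha>" and dt: "\<Delta>t > 0"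
    and ZI: "impedance (Zm \<epsilon>t \<mu>t) zlo zhi"
begin

abbreviation "cE \<equiv> bc_factor_E bc"
abbreviation "cH \<equiv> bc_factor_H bc"
abbreviation "wE \<equiv> avg (Zm \<epsilon>t \<mu>t)"
abbreviation "wH \<equiv> avg (Ym \<epsilon>t \<mu>t)"
abbreviation "penE \<equiv> pen (pwt (flux_param bc \<Omega> \<alpha>) (Zm \<epsilon>t \<mu>t)) cE"
abbreviation "penH \<equiv> pen (pwt (flux_param bc \<Omega> \<alpha>) (Ym \<epsilon>t \<mu>t)) cH"

lemma YI: "impedance (Ym \<epsilon>t \<mu>t) (1 / max zlo zhi) (1 / zlo)"
  unfolding impedance_def
proof (intro conjI ballI)
  have zlo: "zlo > 0" by (rule lo[OF ZI])
  then show "0 < 1 / max zlo zhi" by simp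
  fix T F assume T: "T \<in> \<T>" "F \<in> facets T"
  show "Ym \<epsilon>t \<mu>t T F \<in> borel_measurable (surface_measure F)"
    using meas[OF ZI T] unfolding Ym_def by measurable
  show "AE x in surface_measure F. 1 / max zlo zhi \<le> Ym \<epsilon>t \<mu>t T F x \<and> Ym \<epsilon>t \<mu>t T F x \<le> 1 / zlo"
    using bounds[OF ZI T] by eventually_elim (use zlo in \<open>auto simp: Ym_def intro!: frac_le\<close>)
qed

lemma flux_param_nonneg: "0 \<le> flux_param bc \<Omega> \<alpha> F"
  using \<alpha> by (simp add: flux_param_def)

lemmas wE_props = avg_weight[OF ZI] avg_bounds[OF ZI] avg_boundary[OF ZI]

lemmas wH_props = avg_weight[OF YI] avg_bounds[OF YI] avg_boundary[OF YI]

lemmas pwE = pwt_weight[OF ZI] pwt_neighbour[OF ZI] pwt_bounds[where a = "flux_param bc \<Omega> \<alpha>", OF ZI _ _ flux_param_nonneg]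

lemmas pwH = pwt_weight[OF YI] pwt_neighbour[OF YI] pwt_bounds[where a = "flux_param bc \<Omega> \<alpha>", OF YI _ _ flux_param_nonneg]

text \<open>The averaging weights \<open>Z\<^sup>+ / (Z\<^sup>+ + Z\<^sup>-)\<close> and
  \<open>Y\<^sup>+ / (Y\<^sup>+ + Y\<^sup>-) = Z\<^sup>- / (Z\<^sup>+ + Z\<^sup>-)\<close> add up to \<open>1\<close> and are exchanged by passing to the other side.\<close>

lemma weights_complement:
  assumes TF: "(T, F) \<in> interior_facets"
  shows "AE x in surface_measure F. wE T F x + wH T F x = 1 \<and> wE (nb T F) F x = wH T F x \<and> wH (nb T F) F x = wE T F x"
proof -
  have T: "T \<in> \<T>" "F \<in> facets T" "\<not> F \<subseteq> frontier \<Omega>" using TF unfolding interior_facets_def by blast+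
  note n = neighbour[OF T]
  have Y: "Ym \<epsilon>t \<mu>t = (\<lambda>T F x. 1 / Zm \<epsilon>t \<mu>t T F x)" by (simp add: fun_eq_iff Ym_def)
  note o = opposite_neighbour[OF ZI TF]
  note c = avg_complement[OF ZI, folded Y]
  from c[OF T(1,2)] c[OF n(1,3)] show ?thesis
  proof eventually_elim
    case (elim x)
    have "wE (nb T F) F x = Zm \<epsilon>t \<mu>t T F x / (opposite (Zm \<epsilon>t \<mu>t) T F x + Zm \<epsilon>t \<mu>t T F x)"
      unfolding avg_def o by (simp add: add.commute)
    moreover have "Zm \<epsilon>t \<mu>t (nb T F) F x / (opposite (Zm \<epsilon>t \<mu>t) (nb T F) F x + Zm \<epsilon>t \<mu>t (nb T F) F x) = wE T F x"
      unfolding avg_def o by (simp add: add.commute)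
    ultimately show ?case using elim by simp
  qed
qed

lemma dcurl_EH:
  assumes "broken N E" "broken N H"
  shows "dcurl wE cH H E = dcurl wH cE E H"
proof (rule dcurl_adjoint[OF wE_props(1) wH_props(1) assms(2,1) bc_factors(1)])
  show "AE x in surface_measure F. wE T F x = 1 / 2 \<and> wH T F x = 1 / 2" if "(T, F) \<in> boundary_facets" for T F
    using wE_props(3)[OF that] wH_props(3)[OF that] by simp
qed (rule weights_complement)

text \<open>The two equations of the scheme are tested with the sums of the old and the new fields.\<close>

lemma step_identities:
  assumes E: "E \<in> dg_space \<T> N" and H: "H \<in> dg_space \<T> N" and E': "E' \<in> dg_space \<T> N" and H': "H' \<in> dg_space \<T> N"
    and step: "leapfrog_step bc \<Omega> \<T> \<epsilon> \<mu> \<epsilon>t \<mu>t \<alpha> N \<Delta>t E H E' H'"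
  defines "u \<equiv> \<lambda>T x. piece N E' T x + piece N E T x" and "w \<equiv> \<lambda>T x. piece N H' T x + piece N H T x"
  shows "(mass \<epsilon> (piece N E') - mass \<epsilon> (piece N E)) / \<Delta>t = dcurl wE cH (piece N H) u - penE (piece N E) u"
    "(mass \<mu> (piece N H') - mass \<mu> (piece N H)) / \<Delta>t = - dcurl wH cE (piece N E') w - penH (piece N H) w"
proof -
  note b = broken_piece[OF E] broken_piece[OF H] broken_piece[OF E'] broken_piece[OF H']
  have u: "broken N u" and w: "broken N w" unfolding u_def w_def by (intro broken_add b)+
  have uT: "u T \<in> poly_space3 N" "w T \<in> poly_space3 N" if "T \<in> \<T>" for T using u w that by (auto simp: broken_def)
  have ap: "admissible (\<lambda>T F x. v T F x * (tang T F (jmp c X T F x) \<bullet> tang T F (Y T x)))"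
    if "weight v" "broken N X" "broken N Y" for v c X Y
    by (intro admissible_weight[OF that(1)] continuous_on_inner tang_continuous jmp_continuous[OF that(2)] broken_continuous[OF that(3)]) auto
  have "(mass \<epsilon> (piece N E') - mass \<epsilon> (piece N E)) / \<Delta>t
      = (\<Sum>T\<in>\<T>. vol_inner T (\<lambda>x. \<epsilon> x *v ((piece N E' T x - piece N E T x) /\<^sub>R \<Delta>t)) (u T))"
    unfolding u_def by (rule mass_increment[OF \<epsilon> b(3,1), symmetric])
  also have "\<dots> = (\<Sum>T\<in>\<T>. vol_inner T (curl (piece N H T)) (u T)
      - bdry_inner T (flux_E bc \<Omega> \<T> \<epsilon>t \<mu>t \<alpha> (piece N E) (piece N H) T) (u T))"
    using step uT unfolding leapfrog_step_def by (intro sum.cong refl) blast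
  also have "\<dots> = (\<Sum>T\<in>\<T>. vol_inner T (curl (piece N H T)) (u T))
      - facet_sum all_facets (\<lambda>T F x. wE T F x * (tang T F (jmp cH (piece N H) T F x) \<bullet> u T x)
        + pwt (flux_param bc \<Omega> \<alpha>) (Zm \<epsilon>t \<mu>t) T F x * (tang T F (jmp cE (piece N E) T F x) \<bullet> tang T F (u T x)))"
    unfolding bdry_inner_def facet_sum_all flux_inner by (rule sum_subtractf)
  also have "\<dots> = dcurl wE cH (piece N H) u - penE (piece N E) u"
    unfolding dcurl_def pen_def
    by (subst facet_sum_add[OF dcurl_admissible[OF wE_props(1) b(2) u] ap[OF pwE(1) b(1) u] order_refl]) auto
  finally show "(mass \<epsilon> (piece N E') - mass \<epsilon> (piece N E)) / \<Delta>t = dcurl wE cH (piece N H) u - penE (piece N E) u" .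
  have "(mass \<mu> (piece N H') - mass \<mu> (piece N H)) / \<Delta>t
      = (\<Sum>T\<in>\<T>. vol_inner T (\<lambda>x. \<mu> x *v ((piece N H' T x - piece N H T x) /\<^sub>R \<Delta>t)) (w T))"
    unfolding w_def by (rule mass_increment[OF \<mu> b(4,2), symmetric])
  also have "\<dots> = (\<Sum>T\<in>\<T>. - vol_inner T (curl (piece N E' T)) (w T)
      + bdry_inner T (flux_H bc \<Omega> \<T> \<epsilon>t \<mu>t \<alpha> (piece N E') (piece N H) T) (w T))"
    using step uT unfolding leapfrog_step_def by (intro sum.cong refl) blast
  also have "\<dots> = - (\<Sum>T\<in>\<T>. vol_inner T (curl (piece N E' T)) (w T))
      + facet_sum all_facets (\<lambda>T F x. wH T F x * (tang T F (jmp cE (piece N E') T F x) \<bullet> w T x)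
        + (-1) * (pwt (flux_param bc \<Omega> \<alpha>) (Ym \<epsilon>t \<mu>t) T F x * (tang T F (jmp cH (piece N H) T F x) \<bullet> tang T F (w T x))))"
    unfolding bdry_inner_def facet_sum_all flux_inner by (simp only: sum.distrib sum_negf)
  also have "\<dots> = - dcurl wH cE (piece N E') w - penH (piece N H) w"
    unfolding dcurl_def pen_def
    by (subst facet_sum_add[OF dcurl_admissible[OF wH_props(1) b(3) w] admissible_cmult[OF ap[OF pwH(1) b(2) w]] order_refl],
        subst facet_sum_cmult) simp
  finally show "(mass \<mu> (piece N H') - mass \<mu> (piece N H)) / \<Delta>t = - dcurl wH cE (piece N E') w - penH (piece N H) w" .
qed

text \<open>The two fields live at times that differ by half a step, and the term with the discrete curl
  compensates for this. The subtracted penalty terms have exactly those increments which a step with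
  explicit penalty terms fails to dissipate.\<close>

definition energy where
  "energy E H = mass \<epsilon> E + mass \<mu> H + \<Delta>t * dcurl wE cH H E - \<Delta>t / 2 * (penE E E + penH H H)"

text \<open>In the notation of the proof, the electric half step contributes \<open>dE' + dE\<close> and, by adjointness, the
  magnetic one contributes \<open>- (dH + dE')\<close>. The common term cancels and the rest is the increment of the
  discrete curl term of the energy.\<close>

lemma energy_decreasing:
  assumes E: "E \<in> dg_space \<T> N" and H: "H \<in> dg_space \<T> N" and E': "E' \<in> dg_space \<T> N" and H': "H' \<in> dg_space \<T> N"
    and step: "leapfrog_step bc \<Omega> \<T> \<epsilon> \<mu> \<epsilon>t \<mu>t \<alpha> N \<Delta>t E H E' H'"
  shows "energy (piece N E') (piece N H') \<le> energy (piece N E) (piece N H)"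
proof -
  note b = broken_piece[OF E] broken_piece[OF H] broken_piece[OF E'] broken_piece[OF H']
  note s = step_identities[OF E H E' H' step]
  define dE dE' dH where "dE = dcurl wE cH (piece N H) (piece N E)" and "dE' = dcurl wE cH (piece N H) (piece N E')"
    and "dH = dcurl wE cH (piece N H') (piece N E')"
  define pE pH where "pE = penE (piece N E) (\<lambda>T x. piece N E' T x + piece N E T x)"
    and "pH = penH (piece N H) (\<lambda>T x. piece N H' T x + piece N H T x)"
  have 1: "(mass \<epsilon> (piece N E') - mass \<epsilon> (piece N E)) / \<Delta>t = dE' + dE - pE"
    unfolding s(1) dcurl_add[OF wE_props(1) b(2,3,1)] dE_def dE'_def pE_def ..
  have 2: "(mass \<mu> (piece N H') - mass \<mu> (piece N H)) / \<Delta>t = - (dH + dE') - pH"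
    unfolding s(2) dcurl_add[OF wH_props(1) b(3,4,2)] dH_def dE'_def pH_def
      dcurl_EH[OF b(3,2)] dcurl_EH[OF b(3,4)] ..
  have "penE (piece N E) (piece N E) - penE (piece N E') (piece N E') \<le> 2 * pE"
    unfolding pE_def
    by (rule pen_monotone[OF pwE(1) bc_factors(2) _ _ b(1,3)])
      (use pwE(2) pwE(3) in \<open>auto elim: eventually_mono\<close>)
  moreover have "penH (piece N H) (piece N H) - penH (piece N H') (piece N H') \<le> 2 * pH"
    unfolding pH_def
    by (rule pen_monotone[OF pwH(1) bc_factors(3) _ _ b(2,4)])
      (use pwH(2) pwH(3) in \<open>auto elim: eventually_mono\<close>)
  ultimately have "\<Delta>t / 2 * (penE (piece N E) (piece N E) - penE (piece N E') (piece N E')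
      + (penH (piece N H) (piece N H) - penH (piece N H') (piece N H'))) \<le> \<Delta>t / 2 * (2 * pE + 2 * pH)"
    using dt by (intro mult_left_mono add_mono) auto
  moreover have "mass \<epsilon> (piece N E') = mass \<epsilon> (piece N E) + \<Delta>t * (dE' + dE - pE)"
    "mass \<mu> (piece N H') = mass \<mu> (piece N H) + \<Delta>t * (- (dH + dE') - pH)"
    using 1 2 dt by (simp_all add: field_simps)
  ultimately show ?thesis
    unfolding energy_def dE_def[symmetric] dH_def[symmetric] by (simp add: algebra_simps)
qed

context
  fixes \<kappa> g KE KH :: real
  assumes \<kappa>: "0 \<le> \<kappa>" and g: "0 < g"
    and tr: "\<And>T u. T \<in> \<T> \<Longrightarrow> u \<in> poly_space N \<Longrightarrow>
      (\<Sum>F\<in>facets T. LINT x|surface_measure F. (u x)\<^sup>2) \<le> \<kappa> * (LINT x:T|lebesgue. (u x)\<^sup>2)"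
    and inv: "\<And>T u. T \<in> \<T> \<Longrightarrow> u \<in> poly_space N \<Longrightarrow>
      (LINT x:T|lebesgue. \<Sum>i\<in>UNIV. (partial i u x)\<^sup>2) \<le> g\<^sup>2 * (LINT x:T|lebesgue. (u x)\<^sup>2)"
    and KE: "\<alpha> / (2 * min_over_faces \<T> (Zm \<epsilon>t \<mu>t)) \<le> KE"
      "\<And>F. F \<subseteq> frontier \<Omega> \<Longrightarrow> flux_param bc \<Omega> \<alpha> F / (2 * min_over_faces \<T> (Zm \<epsilon>t \<mu>t)) * cE / 2 \<le> KE"
    and KH: "\<alpha> / (2 * min_over_faces \<T> (Ym \<epsilon>t \<mu>t)) \<le> KH"
      "\<And>F. F \<subseteq> frontier \<Omega> \<Longrightarrow> flux_param bc \<Omega> \<alpha> F / (2 * min_over_faces \<T> (Ym \<epsilon>t \<mu>t)) * cH / 2 \<le> KH"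
begin

lemma energy_bounds:
  assumes E: "broken N E" and H: "broken N H" and KE0: "0 \<le> KE" and KH0: "0 \<le> KH"
  shows "(\<epsilon>lo - \<Delta>t * (g / 2 + \<kappa> * (3 + KE))) * broken_norm2 E + (\<mu>lo - \<Delta>t * (g / 2 + \<kappa> * (3 + KH))) * broken_norm2 H \<le> energy E H"
    and "energy E H \<le> (\<epsilon>hi + \<Delta>t * (g / 2 + 3 * \<kappa>)) * broken_norm2 E + (\<mu>hi + \<Delta>t * (g / 2 + 3 * \<kappa>)) * broken_norm2 H"
proof -
  let ?e = "broken_norm2 E" and ?h = "broken_norm2 H"
  have d: "\<bar>dcurl wE cH H E\<bar> \<le> (g / 2 + 3 * \<kappa>) * (?h + ?e)"
  proof (rule dcurl_bound[OF \<kappa> g tr inv wE_props(1) H E bc_factors(3)])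
    show "cH \<le> 2" using bc_factors[of bc] by linarith
  qed (use wE_props(2,3) in \<open>auto simp: interior_facets_def\<close>)
  have param: "flux_param bc \<Omega> \<alpha> F = \<alpha>" if "(T, F) \<in> interior_facets" for T F
    using that by (simp add: flux_param_def interior_facets_def)
  have "penE E E / 2 \<le> KE * facet_sum all_facets (\<lambda>T F x. (norm (E T x))\<^sup>2)"
  proof (rule pen_bound[OF pwE(1) bc_factors(2) _ _ E])
    fix T F assume TF: "(T, F) \<in> all_facets"
    then have T: "T \<in> \<T>" "F \<in> facets T" by blast+
    show "AE x in surface_measure F. 0 \<le> pwt (flux_param bc \<Omega> \<alpha>) (Zm \<epsilon>t \<mu>t) T F x"
      using pwE(3)[OF T] by (auto elim: eventually_mono)
  next
    fix T F assume TF: "(T, F) \<in> interior_facets"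
    then have T: "T \<in> \<T>" "F \<in> facets T" unfolding interior_facets_def by blast+
    show "AE x in surface_measure F. pwt (flux_param bc \<Omega> \<alpha>) (Zm \<epsilon>t \<mu>t) T F x \<le> KE"
      using pwE(3)[OF T] KE(1) unfolding param[OF TF] by (auto elim: eventually_mono)
  next
    fix T F assume TF: "(T, F) \<in> boundary_facets"
    then have T: "T \<in> \<T>" "F \<in> facets T" "F \<subseteq> frontier \<Omega>" unfolding boundary_facets_def by blast+
    show "AE x in surface_measure F. pwt (flux_param bc \<Omega> \<alpha>) (Zm \<epsilon>t \<mu>t) T F x * cE / 2 \<le> KE"
      using pwE(3)[OF T(1,2)]
    proof eventually_elim
      case (elim x)
      then have "pwt (flux_param bc \<Omega> \<alpha>) (Zm \<epsilon>t \<mu>t) T F x * cE / 2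
          \<le> flux_param bc \<Omega> \<alpha> F / (2 * min_over_faces \<T> (Zm \<epsilon>t \<mu>t)) * cE / 2"
        using bc_factors(2) by (intro divide_right_mono mult_right_mono) auto
      then show ?case using KE(2)[OF T(3)] by linarith
    qed
  qed (rule pwE(2))
  also have "\<dots> \<le> KE * (\<kappa> * ?e)" by (intro mult_left_mono facet_norm_bound[OF \<kappa> g tr inv E] KE0)
  finally have pE: "penE E E / 2 \<le> KE * (\<kappa> * ?e)" .
  have "penH H H / 2 \<le> KH * facet_sum all_facets (\<lambda>T F x. (norm (H T x))\<^sup>2)"
  proof (rule pen_bound[OF pwH(1) bc_factors(3) _ _ H])
    fix T F assume TF: "(T, F) \<in> all_facets"
    then have T: "T \<in> \<T>" "F \<in> facets T" by blast+
    show "AE x in surface_measure F. 0 \<le> pwt (flux_param bc \<Omega> \<alpha>) (Ym \<epsilon>t \<mu>t) T F x"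
      using pwH(3)[OF T] by (auto elim: eventually_mono)
  next
    fix T F assume TF: "(T, F) \<in> interior_facets"
    then have T: "T \<in> \<T>" "F \<in> facets T" unfolding interior_facets_def by blast+
    show "AE x in surface_measure F. pwt (flux_param bc \<Omega> \<alpha>) (Ym \<epsilon>t \<mu>t) T F x \<le> KH"
      using pwH(3)[OF T] KH(1) unfolding param[OF TF] by (auto elim: eventually_mono)
  next
    fix T F assume TF: "(T, F) \<in> boundary_facets"
    then have T: "T \<in> \<T>" "F \<in> facets T" "F \<subseteq> frontier \<Omega>" unfolding boundary_facets_def by blast+
    show "AE x in surface_measure F. pwt (flux_param bc \<Omega> \<alpha>) (Ym \<epsilon>t \<mu>t) T F x * cH / 2 \<le> KH"
      using pwH(3)[OF T(1,2)]
    proof eventually_elim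
      case (elim x)
      then have "pwt (flux_param bc \<Omega> \<alpha>) (Ym \<epsilon>t \<mu>t) T F x * cH / 2
          \<le> flux_param bc \<Omega> \<alpha> F / (2 * min_over_faces \<T> (Ym \<epsilon>t \<mu>t)) * cH / 2"
        using bc_factors(3) by (intro divide_right_mono mult_right_mono) auto
      then show ?case using KH(2)[OF T(3)] by linarith
    qed
  qed (rule pwH(2))
  also have "\<dots> \<le> KH * (\<kappa> * ?h)" by (intro mult_left_mono facet_norm_bound[OF \<kappa> g tr inv H] KH0)
  finally have pH: "penH H H / 2 \<le> KH * (\<kappa> * ?h)" .
  have pE0: "0 \<le> penE E E"
    by (rule pen_nonneg[OF pwE(1) bc_factors(2) _ _ E])
      (use pwE(2) pwE(3) in \<open>auto elim: eventually_mono\<close>)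
  have pH0: "0 \<le> penH H H"
    by (rule pen_nonneg[OF pwH(1) bc_factors(3) _ _ H])
      (use pwH(2) pwH(3) in \<open>auto elim: eventually_mono\<close>)
  note m = mass_bounds[OF \<epsilon> E] mass_bounds[OF \<mu> H]
  have "\<Delta>t * (- ((g / 2 + 3 * \<kappa>) * (?h + ?e)) - KE * (\<kappa> * ?e) - KH * (\<kappa> * ?h))
      \<le> \<Delta>t * (dcurl wE cH H E - penE E E / 2 - penH H H / 2)"
    using d pE pH dt by (intro mult_left_mono) (auto simp: abs_le_iff)
  then show "(\<epsilon>lo - \<Delta>t * (g / 2 + \<kappa> * (3 + KE))) * ?e + (\<mu>lo - \<Delta>t * (g / 2 + \<kappa> * (3 + KH))) * ?h \<le> energy E H"
    using m(1,3) unfolding energy_def by (simp add: algebra_simps)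
  have "\<Delta>t * (dcurl wE cH H E - penE E E / 2 - penH H H / 2) \<le> \<Delta>t * ((g / 2 + 3 * \<kappa>) * (?h + ?e))"
    using d pE0 pH0 dt by (intro mult_left_mono) (auto simp: abs_le_iff)
  then show "energy E H \<le> (\<epsilon>hi + \<Delta>t * (g / 2 + 3 * \<kappa>)) * ?e + (\<mu>hi + \<Delta>t * (g / 2 + 3 * \<kappa>)) * ?h"
    using m(2,4) unfolding energy_def by (simp add: algebra_simps)
qed

end

end

end

section \<open>Trace and inverse inequalities, squared\<close>

context mesh begin

lemma diameter_pos:
  assumes "T \<in> \<T>" shows "0 < diameter T"
proof -
  obtain a b c d where T: "T = convex hull {a, b, c, d}" and t: "tet a b c d"
    using simplex_tetE[OF simplices[OF assms]] by blast
  have "a \<in> T" "b \<in> T" unfolding T by (auto intro: hull_inc)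
  then have "dist a b \<le> diameter T"
    by (rule diameter_bounded_bound[OF compact_imp_bounded[OF mesh_compact[OF assms]]])
  moreover have "0 < dist a b" using tet_distinct(1)[OF t] by simp
  ultimately show ?thesis by linarith
qed

lemma element_integral_nonneg: "0 \<le> (LINT x:T|lebesgue. (u x :: real)\<^sup>2)"
  unfolding set_lebesgue_integral_def by simp

text \<open>Squared norms can be summed over the elements. The diameter is replaced by a common lower bound
  \<open>h\<close>, since the forms of the energy couple different elements.\<close>

lemma trace_inequality_squared:
  fixes u :: "real^3 \<Rightarrow> real"
  assumes T: "T \<in> \<T>" and C: "0 \<le> C" and A: "0 \<le> A" and h: "0 < h" "h \<le> diameter T"
    and le: "L2_norm_bdry T u \<le> C * sqrt A * diameter T powr (- 1 / 2) * L2_norm T u"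
  shows "(\<Sum>F\<in>facets T. LINT x|surface_measure F. (u x)\<^sup>2) \<le> (C\<^sup>2 * A / h) * (LINT x:T|lebesgue. (u x)\<^sup>2)"
proof -
  let ?b = "\<Sum>F\<in>facets T. LINT x|surface_measure F. (u x)\<^sup>2" and ?v = "LINT x:T|lebesgue. (u x)\<^sup>2"
  have d: "0 < diameter T" by (rule diameter_pos[OF T])
  have b0: "0 \<le> ?b" by (intro sum_nonneg integral_nonneg_AE) auto
  have v0: "0 \<le> ?v" by (rule element_integral_nonneg)
  have "sqrt ?b \<le> C * sqrt A * diameter T powr (- 1 / 2) * sqrt ?v"
    using le unfolding L2_norm_bdry_def L2_norm_def by simp
  then have "(sqrt ?b)\<^sup>2 \<le> (C * sqrt A * diameter T powr (- 1 / 2) * sqrt ?v)\<^sup>2"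
    by (rule power_mono) (simp add: b0)
  also have "\<dots> = C\<^sup>2 * A * (diameter T powr (- 1 / 2))\<^sup>2 * ?v"
    using A v0 by (simp add: power_mult_distrib)
  also have "(diameter T powr (- 1 / 2))\<^sup>2 = 1 / diameter T"
    using d
    unfolding power2_eq_square by (subst powr_add[symmetric]) (simp add: powr_neg_one)
  finally have "?b \<le> C\<^sup>2 * A * (1 / diameter T) * ?v" using b0 by simp
  also have "\<dots> \<le> C\<^sup>2 * A * (1 / h) * ?v"
    using h A v0 d by (intro mult_right_mono mult_left_mono frac_le) auto
  finally show ?thesis by simp
qed

lemma inverse_inequality_squared:
  assumes T: "T \<in> \<T>" and u: "u \<in> poly_space N" and C: "0 \<le> C" and h: "0 < h" "h \<le> diameter T"
    and le: "H1_norm T u \<le> C * inverse (diameter T) * L2_norm T u"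
  shows "(LINT x:T|lebesgue. (u x)\<^sup>2) + (LINT x:T|lebesgue. \<Sum>i\<in>UNIV. (partial i u x)\<^sup>2)
    \<le> (C / h)\<^sup>2 * (LINT x:T|lebesgue. (u x)\<^sup>2)"
proof -
  let ?v = "LINT x:T|lebesgue. (u x)\<^sup>2" and ?d = "LINT x:T|lebesgue. \<Sum>i\<in>UNIV. (partial i u x)\<^sup>2"
  have d: "0 < diameter T" by (rule diameter_pos[OF T])
  have v0: "0 \<le> ?v" by (rule element_integral_nonneg)
  have d0: "0 \<le> ?d" unfolding set_lebesgue_integral_def
    by (intro integral_nonneg_AE always_eventually allI) (simp add: sum_nonneg)
  have sum: "(LINT x:T|lebesgue. (u x)\<^sup>2 + (\<Sum>i\<in>UNIV. (partial i u x)\<^sup>2)) = ?v + ?d"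
    by (intro element_integral_linear(1)[OF T] continuous_intros poly_space_continuous[OF u]
        poly_space_continuous[OF partial_poly_space[OF u]])
  have "sqrt (?v + ?d) \<le> C * inverse (diameter T) * sqrt ?v"
    using le unfolding H1_norm_def L2_norm_def sum by simp
  then have "(sqrt (?v + ?d))\<^sup>2 \<le> (C * inverse (diameter T) * sqrt ?v)\<^sup>2"
    by (rule power_mono) (use v0 d0 in simp)
  then have "?v + ?d \<le> (C / diameter T)\<^sup>2 * ?v"
    using v0 d0 by (simp add: power_mult_distrib divide_inverse)
  also have "\<dots> \<le> (C / h)\<^sup>2 * ?v"
    using h C v0 d by (intro mult_right_mono power_mono frac_le) auto
  finally show ?thesis .
qed

end

section \<open>Stability\<close>

text \<open>The parameters \<open>\<beta>\<close> of the time step condition bound the boundary contributions of the penalty terms: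
  the flux parameter times half the boundary factor is \<open>\<alpha>\<close>, \<open>0\<close> or \<open>1 / 2\<close>.\<close>

lemma bc_parameters:
  fixes \<alpha> \<beta>1 \<beta>2 \<beta>3 :: real
  assumes \<beta>: "(\<beta>1, \<beta>2, \<beta>3) =
           (case bc of PEC \<Rightarrow> (\<alpha>, 0, 0) | PMC \<Rightarrow> (0, 1, \<alpha>) | Silver_Mueller \<Rightarrow> (1/2, 1/2, 1))"
    and \<alpha>: "0 \<le> \<alpha>"
  shows "0 \<le> \<beta>1" "0 \<le> \<beta>2" "0 \<le> \<beta>3"
    "F \<subseteq> frontier \<Omega> \<Longrightarrow> flux_param bc \<Omega> \<alpha> F * bc_factor_E bc / 2 \<le> \<alpha> + \<beta>1"
    "F \<subseteq> frontier \<Omega> \<Longrightarrow> flux_param bc \<Omega> \<alpha> F * bc_factor_H bc / 2 \<le> \<alpha> + \<beta>3"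
proof -
  have eq: "\<beta>1 = (case bc of PEC \<Rightarrow> \<alpha> | PMC \<Rightarrow> 0 | Silver_Mueller \<Rightarrow> 1/2)"
    "\<beta>2 = (case bc of PEC \<Rightarrow> 0 | PMC \<Rightarrow> 1 | Silver_Mueller \<Rightarrow> 1/2)"
    "\<beta>3 = (case bc of PEC \<Rightarrow> 0 | PMC \<Rightarrow> \<alpha> | Silver_Mueller \<Rightarrow> 1)"
    using \<beta> by (cases bc; simp)+
  show "0 \<le> \<beta>1" "0 \<le> \<beta>2" "0 \<le> \<beta>3" unfolding eq using \<alpha> by (simp_all split: boundary_condition.split)
  assume F: "F \<subseteq> frontier \<Omega>"
  have fp: "flux_param bc \<Omega> \<alpha> F = (if bc = Silver_Mueller then 1 else \<alpha>)" using F by (simp only: flux_param_def simp_thms)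
  show "flux_param bc \<Omega> \<alpha> F * bc_factor_E bc / 2 \<le> \<alpha> + \<beta>1"
    unfolding eq fp bc_factor_E_def using \<alpha> by (cases bc) simp_all
  show "flux_param bc \<Omega> \<alpha> F * bc_factor_H bc / 2 \<le> \<alpha> + \<beta>3"
    unfolding eq fp bc_factor_H_def using \<alpha> by (cases bc) simp_all
qed

theorem theorem6p1:
  fixes \<Omega> :: "(real^3) set" and \<T> :: "(real^3) set set"
    and \<epsilon> \<mu> :: "real^3 \<Rightarrow> real^3^3"
    and \<epsilon>t \<mu>t :: "(real^3) set \<Rightarrow> real^3 \<Rightarrow> real^3^3"
    and \<epsilon>lo \<epsilon>hi \<mu>lo \<mu>hi \<tau> C\<tau> Cinv \<alpha> \<Delta>t \<beta>1 \<beta>2 \<beta>3 CE CH :: real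
    and N :: nat and bc :: boundary_condition
  assumes "polyhedral_domain \<Omega>" and "bounded \<Omega>"
    and "\<epsilon>lo > 0" and "\<epsilon>hi > 0" and "\<mu>lo > 0" and "\<mu>hi > 0"
    and "coefficient \<Omega> \<epsilon> \<epsilon>lo \<epsilon>hi" and "coefficient \<Omega> \<mu> \<mu>lo \<mu>hi"
    and "tetrahedral_mesh \<Omega> \<T>"
    and "\<tau> > 0" and "\<And>T. T \<in> \<T> \<Longrightarrow> diameter T / inball_diameter T \<le> \<tau>"
    and "\<And>T. T \<in> \<T> \<Longrightarrow> is_trace T \<epsilon> (\<epsilon>t T)" and "\<And>T. T \<in> \<T> \<Longrightarrow> is_trace T \<mu> (\<mu>t T)"
    and "C\<tau> > 0"
    and "\<And>T u. T \<in> \<T> \<Longrightarrow> u \<in> poly_space N \<Longrightarrow>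
           L2_norm_bdry T u
             \<le> C\<tau> * sqrt ((real N + 1) * (real N + 3)) * diameter T powr (- 1 / 2) * L2_norm T u"
    and "Cinv > 0"
    and "\<And>T u. T \<in> \<T> \<Longrightarrow> u \<in> poly_space N \<Longrightarrow>
           H1_norm T u \<le> Cinv * (real N)\<^sup>2 * inverse (diameter T) * L2_norm T u"
    and "0 \<le> \<alpha>" and "\<alpha> \<le> 1" and "\<Delta>t > 0"
    and "(\<beta>1, \<beta>2, \<beta>3) =
           (case bc of PEC \<Rightarrow> (\<alpha>, 0, 0) | PMC \<Rightarrow> (0, 1, \<alpha>) | Silver_Mueller \<Rightarrow> (1/2, 1/2, 1))"
    and "CE = 1/2 * Cinv * (real N)\<^sup>2 + C\<tau>\<^sup>2 * (real N + 1) * (real N + 3) *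
                (3 + \<beta>2 / 2 + (\<alpha> + \<beta>1) / (2 * min_over_faces \<T> (Zm \<epsilon>t \<mu>t)))"
    and "CH = 1/2 * Cinv * (real N)\<^sup>2 + C\<tau>\<^sup>2 * (real N + 1) * (real N + 3) *
                (3 + \<beta>2 / 2 + (\<alpha> + \<beta>3) / (2 * min_over_faces \<T> (Ym \<epsilon>t \<mu>t)))"
    and "\<Delta>t < min \<epsilon>lo \<mu>lo / max CE CH * Min (diameter ` \<T>)"
  shows "\<exists>C>0. \<forall>M\<ge>1. \<forall>E H :: nat \<Rightarrow> real^3 \<Rightarrow> real^3.
           (\<comment> \<open>\<open>H m\<close> is the magnetic field at time level \<open>m + 1/2\<close>\<close>
            (\<forall>m\<le>M. E m \<in> dg_space \<T> N \<and> H m \<in> dg_space \<T> N) \<and>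
            (\<forall>m<M. leapfrog_step bc \<Omega> \<T> \<epsilon> \<mu> \<epsilon>t \<mu>t \<alpha> N \<Delta>t (E m) (H m) (E (Suc m)) (H (Suc m))))
           \<longrightarrow> (L2_norm \<Omega> (E M))\<^sup>2 + (L2_norm \<Omega> (H M))\<^sup>2
                \<le> C * ((L2_norm \<Omega> (E 0))\<^sup>2 + (L2_norm \<Omega> (H 0))\<^sup>2)"
proof -
  interpret mesh \<Omega> \<T> by unfold_locales fact+
  note \<epsilon> = \<open>coefficient \<Omega> \<epsilon> \<epsilon>lo \<epsilon>hi\<close> \<open>\<epsilon>lo > 0\<close> and \<mu> = \<open>coefficient \<Omega> \<mu> \<mu>lo \<mu>hi\<close> \<open>\<mu>lo > 0\<close>
    and \<epsilon>t = \<open>\<And>T. T \<in> \<T> \<Longrightarrow> is_trace T \<epsilon> (\<epsilon>t T)\<close> and \<mu>t = \<open>\<And>T. T \<in> \<T> \<Longrightarrow> is_trace T \<mu> (\<mu>t T)\<close>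
    and \<alpha> = \<open>0 \<le> \<alpha>\<close> and dt = \<open>\<Delta>t > 0\<close>
  note \<beta> = bc_parameters[OF \<open>(\<beta>1, \<beta>2, \<beta>3) = _\<close> \<alpha>]
  have "\<exists>zlo zhi. 0 < zlo \<and> (\<forall>T\<in>\<T>. \<forall>F\<in>facets T.
      AE x in surface_measure F. zlo \<le> Zm \<epsilon>t \<mu>t T F x \<and> Zm \<epsilon>t \<mu>t T F x \<le> zhi)"
  proof (rule Zm_bounds[where \<epsilon>t = \<epsilon>t and \<mu>t = \<mu>t, OF \<epsilon> \<epsilon>t \<mu> \<mu>t \<open>\<epsilon>hi > 0\<close> \<open>\<mu>hi > 0\<close>])
    fix zlo zhi :: real
    assume 1: "0 < zlo" and 2: "\<And>T F. T \<in> \<T> \<Longrightarrow> F \<in> facets T \<Longrightarrow>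
      AE x in surface_measure F. zlo \<le> Zm \<epsilon>t \<mu>t T F x \<and> Zm \<epsilon>t \<mu>t T F x \<le> zhi"
    show ?thesis by (rule exI[of _ zlo], rule exI[of _ zhi], intro conjI ballI 1 2)
  qed
  then obtain zlo zhi where z1: "0 < zlo" and z2: "\<forall>T\<in>\<T>. \<forall>F\<in>facets T.
      AE x in surface_measure F. zlo \<le> Zm \<epsilon>t \<mu>t T F x \<and> Zm \<epsilon>t \<mu>t T F x \<le> zhi"
    by (elim exE conjE)
  have ZI: "impedance (Zm \<epsilon>t \<mu>t) zlo zhi"
    unfolding impedance_def
  proof (intro conjI ballI z1)
    fix T F assume T: "T \<in> \<T>" "F \<in> facets T"
    show "Zm \<epsilon>t \<mu>t T F \<in> borel_measurable (surface_measure F)"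
      by (rule Zm_measurable[of T \<epsilon> \<epsilon>t \<mu> \<mu>t, OF \<epsilon>t[OF T(1)] \<mu>t[OF T(1)] T(2)])
    show "AE x in surface_measure F. zlo \<le> Zm \<epsilon>t \<mu>t T F x \<and> Zm \<epsilon>t \<mu>t T F x \<le> zhi"
      using z2 T by blast
  qed
  note YI = YI[OF \<epsilon> \<mu> \<alpha> dt ZI]
  define mZ mY where "mZ = min_over_faces \<T> (Zm \<epsilon>t \<mu>t)" and "mY = min_over_faces \<T> (Ym \<epsilon>t \<mu>t)"
  have "zlo \<le> mZ"
    unfolding mZ_def by (rule min_over_faces_bound(1)[where f = "Zm \<epsilon>t \<mu>t", OF bounds[OF ZI]])
  then have mZ: "0 < mZ" using z1 by linarith
  have "1 / max zlo zhi \<le> mY"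
    unfolding mY_def by (rule min_over_faces_bound(1)[where f = "Ym \<epsilon>t \<mu>t", OF bounds[OF YI]])
  then have mY: "0 < mY" using lo[OF YI] by linarith
  define KE KH where "KE = (\<alpha> + \<beta>1) / (2 * mZ)" and "KH = (\<alpha> + \<beta>3) / (2 * mY)"
  have K0: "0 \<le> KE" "0 \<le> KH" unfolding KE_def KH_def using \<alpha> \<beta>(1,3) mZ mY by auto
  have move: "a / (2 * m) * c / 2 = (a * c / 2) / (2 * m)" for a c m :: real by simp
  have KE1: "\<alpha> / (2 * mZ) \<le> KE"
    unfolding KE_def by (rule divide_right_mono) (use \<beta>(1) mZ in simp_all)
  have KE2: "flux_param bc \<Omega> \<alpha> F / (2 * mZ) * bc_factor_E bc / 2 \<le> KE" if "F \<subseteq> frontier \<Omega>" for F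
    unfolding KE_def move by (rule divide_right_mono[OF \<beta>(4)[OF that]]) (use mZ in simp)
  have KH1: "\<alpha> / (2 * mY) \<le> KH"
    unfolding KH_def by (rule divide_right_mono) (use \<beta>(3) mY in simp_all)
  have KH2: "flux_param bc \<Omega> \<alpha> F / (2 * mY) * bc_factor_H bc / 2 \<le> KH" if "F \<subseteq> frontier \<Omega>" for F
    unfolding KH_def move by (rule divide_right_mono[OF \<beta>(5)[OF that]]) (use mY in simp)
  define h where "h = Min (diameter ` \<T>)"
  have h_le: "h \<le> diameter T" if "T \<in> \<T>" for T
    unfolding h_def using finite_mesh that by simp
  have "h \<in> diameter ` \<T>"
    unfolding h_def using finite_mesh mesh_nonempty by (intro Min_in) auto
  then have h: "0 < h" using diameter_pos by auto
  define A where "A = (real N + 1) * (real N + 3)"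
  define \<kappa> where "\<kappa> = C\<tau>\<^sup>2 * A / h"
  define g where "g = Cinv * (real N)\<^sup>2 / h"
  have A: "0 < A" by (simp add: A_def)
  have \<kappa>0: "0 < \<kappa>" using \<open>C\<tau> > 0\<close> A h by (simp add: \<kappa>_def)
  have tr: "(\<Sum>F\<in>facets T. LINT x|surface_measure F. (u x)\<^sup>2) \<le> \<kappa> * (LINT x:T|lebesgue. (u x)\<^sup>2)"
    if "T \<in> \<T>" "u \<in> poly_space N" for T u
    unfolding \<kappa>_def
    by (rule trace_inequality_squared[OF that(1) _ _ h h_le[OF that(1)]])
      (use \<open>C\<tau> > 0\<close> A assms(15)[OF that] in \<open>auto simp: A_def\<close>)
  have inv1: "(LINT x:T|lebesgue. (u x)\<^sup>2) + (LINT x:T|lebesgue. \<Sum>i\<in>UNIV. (partial i u x)\<^sup>2) \<le> g\<^sup>2 * (LINT x:T|lebesgue. (u x)\<^sup>2)"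
    if "T \<in> \<T>" "u \<in> poly_space N" for T u
    unfolding g_def
    by (rule inverse_inequality_squared[OF that _ h h_le[OF that(1)]]) (use \<open>Cinv > 0\<close> assms(17)[OF that] in auto)
  have inv: "(LINT x:T|lebesgue. \<Sum>i\<in>UNIV. (partial i u x)\<^sup>2) \<le> g\<^sup>2 * (LINT x:T|lebesgue. (u x)\<^sup>2)"
    if "T \<in> \<T>" "u \<in> poly_space N" for T u
    using inv1[OF that] element_integral_nonneg[of T u] by linarith
  \<comment> \<open>For \<open>N = 0\<close> the inverse inequality would make the norm of the constant \<open>1\<close> vanish.\<close>
  have g: "0 < g"
  proof (rule ccontr)
    assume "\<not> 0 < g"
    moreover have "0 \<le> g" using \<open>Cinv > 0\<close> h by (simp add: g_def)
    ultimately have g0: "g = 0" by simp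
    obtain T where T: "T \<in> \<T>" using mesh_nonempty by blast
    have "monomial (0, 0, 0) = (\<lambda>x. 1)" by (simp add: monomial_def)
    then have one: "(\<lambda>x. 1) \<in> poly_space N" using poly_space_monomial[of "(0, 0, 0)" N] by simp
    have "0 \<le> (LINT x:T|lebesgue. \<Sum>i\<in>UNIV. (partial i (\<lambda>x. 1) x :: real)\<^sup>2)"
      by (simp add: partial_const)
    then have "(LINT x:T|lebesgue. (1::real)\<^sup>2) \<le> 0" using inv1[OF T one] g0 by simp
    moreover have "0 < measure lebesgue T"
    proof -
      have "\<not> negligible T"
        using negligible_subset[OF _ interior_subset, of T] open_not_negligible[OF open_interior simplex_nonempty_interior[OF T]] by metis
      moreover have "T \<in> lmeasurable" using mesh_compact[OF T] by (rule lmeasurable_compact)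
      ultimately show ?thesis unfolding negligible_iff_measure by (simp add: zero_less_measure_iff)
    qed
    ultimately show False unfolding set_lebesgue_integral_def by simp
  qed
  let ?C = "max CE CH"
  define lam where "lam = min \<epsilon>lo \<mu>lo"
  have CE: "g / 2 + \<kappa> * (3 + KE) \<le> CE / h" and CH: "g / 2 + \<kappa> * (3 + KH) \<le> CH / h"
  proof -
    have hg: "h * g = Cinv * (real N)\<^sup>2" "h * \<kappa> = C\<tau>\<^sup>2 * A" using h by (simp_all add: g_def \<kappa>_def)
    have "h * (g / 2 + \<kappa> * (3 + K)) = (h * g) / 2 + (h * \<kappa>) * (3 + K)" for K by (simp add: algebra_simps)
    then have "CE = h * (g / 2 + \<kappa> * (3 + KE)) + C\<tau>\<^sup>2 * A * (\<beta>2 / 2)" "CH = h * (g / 2 + \<kappa> * (3 + KH)) + C\<tau>\<^sup>2 * A * (\<beta>2 / 2)"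
      unfolding \<open>CE = _\<close> \<open>CH = _\<close> mZ_def[symmetric] mY_def[symmetric] KE_def[symmetric] KH_def[symmetric]
      unfolding hg A_def by (simp_all add: algebra_simps)
    moreover have "0 \<le> C\<tau>\<^sup>2 * A * (\<beta>2 / 2)" using A \<beta>(2) by simp
    ultimately show "g / 2 + \<kappa> * (3 + KE) \<le> CE / h" "g / 2 + \<kappa> * (3 + KH) \<le> CH / h"
      using h by (simp_all add: pos_le_divide_eq mult.commute)
  qed
  have "0 < \<kappa> * (3 + KE)" using \<kappa>0 K0(1) by simp
  then have "0 < g / 2 + \<kappa> * (3 + KE)" using g by simp
  then have "0 < CE / h" using CE by linarith
  then have "0 < CE" using h by (simp add: zero_less_divide_iff)
  then have C0: "0 < ?C" by simp
  \<comment> \<open>The slack in the time step condition is the coercivity constant of the energy.\<close>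
  define q where "q = lam - \<Delta>t * (?C / h)"
  have q: "0 < q"
  proof -
    have "\<Delta>t < lam / ?C * h" using assms(24) by (simp add: lam_def h_def)
    then have "\<Delta>t * ?C < lam * h" using C0 by (simp add: field_simps)
    then show ?thesis using h by (simp add: q_def field_simps)
  qed
  define U where "U = (\<epsilon>hi + \<mu>hi) + \<Delta>t * (g / 2 + 3 * \<kappa>)"
  have U: "0 < U" unfolding U_def using \<open>\<epsilon>hi > 0\<close> \<open>\<mu>hi > 0\<close> dt g \<kappa>0 by (intro add_pos_pos mult_pos_pos) auto
  let ?en = "energy \<epsilon> \<mu> \<epsilon>t \<mu>t \<alpha> \<Delta>t bc"
  have energy1: "(\<epsilon>lo - \<Delta>t * (g / 2 + \<kappa> * (3 + KE))) * broken_norm2 E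
      + (\<mu>lo - \<Delta>t * (g / 2 + \<kappa> * (3 + KH))) * broken_norm2 H \<le> ?en E H" if "broken N E" "broken N H" for E H
    by (rule energy_bounds(1)[OF \<epsilon> \<mu> \<alpha> dt ZI less_imp_le[OF \<kappa>0] g tr inv KE1[unfolded mZ_def] KE2[unfolded mZ_def] KH1[unfolded mY_def] KH2[unfolded mY_def] that K0])
  have energy2: "?en E H \<le> (\<epsilon>hi + \<Delta>t * (g / 2 + 3 * \<kappa>)) * broken_norm2 E
      + (\<mu>hi + \<Delta>t * (g / 2 + 3 * \<kappa>)) * broken_norm2 H" if "broken N E" "broken N H" for E H
    by (rule energy_bounds(2)[OF \<epsilon> \<mu> \<alpha> dt ZI less_imp_le[OF \<kappa>0] g tr inv KE1[unfolded mZ_def] KE2[unfolded mZ_def] KH1[unfolded mY_def] KH2[unfolded mY_def] that K0])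
  have lower: "q * (broken_norm2 E + broken_norm2 H) \<le> ?en E H" if "broken N E" "broken N H" for E H
  proof -
    have q: "q \<le> \<epsilon>lo - \<Delta>t * (g / 2 + \<kappa> * (3 + KE))" "q \<le> \<mu>lo - \<Delta>t * (g / 2 + \<kappa> * (3 + KH))"
    proof -
      have "CE / h \<le> ?C / h" "CH / h \<le> ?C / h" using h by (auto intro: divide_right_mono)
      then have le: "g / 2 + \<kappa> * (3 + KE) \<le> ?C / h" "g / 2 + \<kappa> * (3 + KH) \<le> ?C / h" using CE CH by linarith+
      show "q \<le> \<epsilon>lo - \<Delta>t * (g / 2 + \<kappa> * (3 + KE))" "q \<le> \<mu>lo - \<Delta>t * (g / 2 + \<kappa> * (3 + KH))"
        using mult_left_mono[OF le(1) less_imp_le[OF dt]] mult_left_mono[OF le(2) less_imp_le[OF dt]]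
        unfolding q_def lam_def by linarith+
    qed
    show ?thesis
      using mult_right_mono[OF q(1) broken_norm2_nonneg[of E]] mult_right_mono[OF q(2) broken_norm2_nonneg[of H]]
        energy1[OF that] unfolding distrib_left by linarith
  qed
  have upper: "?en E H \<le> U * (broken_norm2 E + broken_norm2 H)" if "broken N E" "broken N H" for E H
  proof -
    have U: "\<epsilon>hi + \<Delta>t * (g / 2 + 3 * \<kappa>) \<le> U" "\<mu>hi + \<Delta>t * (g / 2 + 3 * \<kappa>) \<le> U"
      using \<open>\<epsilon>hi > 0\<close> \<open>\<mu>hi > 0\<close> unfolding U_def by linarith+
    show ?thesis
      using mult_right_mono[OF U(1) broken_norm2_nonneg[of E]] mult_right_mono[OF U(2) broken_norm2_nonneg[of H]]
        energy2[OF that] unfolding distrib_left by linarith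
  qed
  show ?thesis
  \<comment> \<open>The ratio of the upper and the lower constant of the energy, which depends neither on \<open>M\<close> nor on the fields.\<close>
  proof (intro exI[of _ "U / q"] conjI allI impI)
    show "0 < U / q" using U q by simp
    fix M :: nat and E H :: "nat \<Rightarrow> real^3 \<Rightarrow> real^3"
    assume run: "(\<forall>m\<le>M. E m \<in> dg_space \<T> N \<and> H m \<in> dg_space \<T> N) \<and>
      (\<forall>m<M. leapfrog_step bc \<Omega> \<T> \<epsilon> \<mu> \<epsilon>t \<mu>t \<alpha> N \<Delta>t (E m) (H m) (E (Suc m)) (H (Suc m)))"
    have dec: "?en (piece N (E m)) (piece N (H m)) \<le> ?en (piece N (E 0)) (piece N (H 0))" if "m \<le> M" for m
      using that
    proof (induction m)
      case (Suc m)
      have "?en (piece N (E (Suc m))) (piece N (H (Suc m))) \<le> ?en (piece N (E m)) (piece N (H m))"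
        by (rule energy_decreasing[OF \<epsilon> \<mu> \<alpha> dt ZI]) (use run Suc.prems in auto)
      with Suc show ?case by simp
    qed simp
    have dg: "E m \<in> dg_space \<T> N" "H m \<in> dg_space \<T> N" if "m \<le> M" for m
      using run that by blast+
    have b: "broken N (piece N (E m))" "broken N (piece N (H m))" if "m \<le> M" for m
      using dg[OF that] broken_piece by blast+
    have "q * (broken_norm2 (piece N (E M)) + broken_norm2 (piece N (H M)))
        \<le> U * (broken_norm2 (piece N (E 0)) + broken_norm2 (piece N (H 0)))"
      using lower[OF b[of M]] dec[of M] upper[OF b[of 0]] by simp
    then have "broken_norm2 (piece N (E M)) + broken_norm2 (piece N (H M))
        \<le> U / q * (broken_norm2 (piece N (E 0)) + broken_norm2 (piece N (H 0)))"
      using q by (simp add: field_simps)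
    then show "(L2_norm \<Omega> (E M))\<^sup>2 + (L2_norm \<Omega> (H M))\<^sup>2
        \<le> U / q * ((L2_norm \<Omega> (E 0))\<^sup>2 + (L2_norm \<Omega> (H 0))\<^sup>2)"
      unfolding L2_norm_broken[OF dg(1)[OF order_refl]] L2_norm_broken[OF dg(2)[OF order_refl]]
        L2_norm_broken[OF dg(1)[OF le0]] L2_norm_broken[OF dg(2)[OF le0]] .
  qed
qed

end
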